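(* Let $G$ be a 2-connected graph on $n$ vertices and let $C$ be a longest cycle in $G$, of length $c$, where $10\leq c\leq n-1$. If the number of edges of $G$ with at most one endpoint in $V(C)$ is more than $(\lfloor c/2\rfloor-1)(n-c)$, then either $G$ is isomorphic to a subgraph of $W_{n,\lfloor c/2\rfloor,c}$, or $c$ is odd and $G$ is isomorphic to a subgraph of a member of $\mathcal{X}_{n,c}\cup\mathcal{Y}_{n,c}$.
   Context: Graphs are simple and finite. $W_{n,k,c}$: a clique $K_{c-k+1}$ plus $n-(c-k+1)$ new vertices each joined exactly to the same $k$ vertices of the clique. For odd $c$: $G\in\mathcal{X}_{n,c}$ if $|V(G)|=n$, $V(G)=A\cup B\cup X$ (disjoint), $G[A]\cong K_{\lfloor c/2\rfloor}$, $B,X$ independent, $A$ completely joined to $B$, and there exist $a\in A,b\in B$ with $N_G(x)=\{a,b\}$ for all $x\in X$. $G\in\mathcal{Y}_{n,c}$ if $|V(G)|=n$, $V(G)=A\cup B\cup Y$ (disjoint), $G[A]\cong K_{\lfloor c/2\rfloor}$, $B$ independent, $A$ completely joined to $B$, $G[Y]$ is a star forest with at least two stars each having at least one edge, and there exist $a,b\in A$ such that for every star $S$ of $G[Y]$, the set of vertices outside $S$ adjacent to $S$ is $\{a,b\}$, and if $|V(S)|\geq 3$ then all leaves of $S$ have degree 2 in $G$ and have a common neighbor in $\{a,b\}$. *)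

theory Defs
  imports Main
begin

record 'a sgraph =
  verts :: "'a set"
  edges :: "'a set set"

definition simple_graph :: "'a sgraph \<Rightarrow> bool" where
  "simple_graph G \<longleftrightarrow> finite (verts G) \<and> (\<forall>e\<in>edges G. e \<subseteq> verts G \<and> card e = 2)"

definition nbhd :: "'a sgraph \<Rightarrow> 'a \<Rightarrow> 'a set" where
  "nbhd G v = {u \<in> verts G. {u, v} \<in> edges G}"

definition degree :: "'a sgraph \<Rightarrow> 'a \<Rightarrow> nat" where
  "degree G v = card (nbhd G v)"

definition set_nbhd :: "'a sgraph \<Rightarrow> 'a set \<Rightarrow> 'a set" where
  "set_nbhd G S = {u \<in> verts G - S. \<exists>s\<in>S. {u, s} \<in> edges G}"

definition induced :: "'a sgraph \<Rightarrow> 'a set \<Rightarrow> 'a sgraph" where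
  "induced G S = \<lparr>verts = verts G \<inter> S, edges = {e \<in> edges G. e \<subseteq> S}\<rparr>"

definition subgraph :: "'a sgraph \<Rightarrow> 'a sgraph \<Rightarrow> bool" where
  "subgraph H G \<longleftrightarrow> simple_graph H \<and> verts H \<subseteq> verts G \<and> edges H \<subseteq> edges G"

definition isomorphic :: "'a sgraph \<Rightarrow> 'b sgraph \<Rightarrow> bool" where
  "isomorphic G H \<longleftrightarrow>
     (\<exists>f. bij_betw f (verts G) (verts H) \<and>
          (\<forall>u\<in>verts G. \<forall>v\<in>verts G. {u, v} \<in> edges G \<longleftrightarrow> {f u, f v} \<in> edges H))"

definition iso_to_subgraph :: "'a sgraph \<Rightarrow> 'b sgraph \<Rightarrow> bool" where
  "iso_to_subgraph G H \<longleftrightarrow> (\<exists>H'. subgraph H' H \<and> isomorphic G H')"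

definition reachable :: "'a sgraph \<Rightarrow> 'a \<Rightarrow> 'a \<Rightarrow> bool" where
  "reachable G u v \<longleftrightarrow> (u, v) \<in> {(x, y). {x, y} \<in> edges G}\<^sup>*"

definition connected_graph :: "'a sgraph \<Rightarrow> bool" where
  "connected_graph G \<longleftrightarrow> verts G \<noteq> {} \<and> (\<forall>u\<in>verts G. \<forall>v\<in>verts G. reachable G u v)"

definition k_connected :: "nat \<Rightarrow> 'a sgraph \<Rightarrow> bool" where
  "k_connected k G \<longleftrightarrow> card (verts G) > k \<and>
     (\<forall>S. S \<subseteq> verts G \<and> card S < k \<longrightarrow> connected_graph (induced G (verts G - S)))"

definition components :: "'a sgraph \<Rightarrow> 'a set set" where
  "components G = {{v \<in> verts G. reachable G u v} | u. u \<in> verts G}"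

text \<open>A cycle is given by the list of its vertices in cyclic order, so that its length
  as a cycle is the length of the list.\<close>

definition is_cycle :: "'a sgraph \<Rightarrow> 'a list \<Rightarrow> bool" where
  "is_cycle G C \<longleftrightarrow> length C \<ge> 3 \<and> distinct C \<and> set C \<subseteq> verts G \<and>
     (\<forall>i<length C. {C ! i, C ! (Suc i mod length C)} \<in> edges G)"

definition longest_cycle :: "'a sgraph \<Rightarrow> 'a list \<Rightarrow> bool" where
  "longest_cycle G C \<longleftrightarrow> is_cycle G C \<and> (\<forall>D. is_cycle G D \<longrightarrow> length D \<le> length C)"

definition clique :: "'a sgraph \<Rightarrow> 'a set \<Rightarrow> bool" where
  "clique G A \<longleftrightarrow> (\<forall>u\<in>A. \<forall>v\<in>A. u \<noteq> v \<longrightarrow> {u, v} \<in> edges G)"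

definition independent :: "'a sgraph \<Rightarrow> 'a set \<Rightarrow> bool" where
  "independent G B \<longleftrightarrow> (\<forall>u\<in>B. \<forall>v\<in>B. {u, v} \<notin> edges G)"

definition completely_joined :: "'a sgraph \<Rightarrow> 'a set \<Rightarrow> 'a set \<Rightarrow> bool" where
  "completely_joined G A B \<longleftrightarrow> (\<forall>u\<in>A. \<forall>v\<in>B. {u, v} \<in> edges G)"

text \<open>A star may consist of its centre alone; the requirement that it has an edge is
  imposed separately.\<close>

definition is_star :: "'a sgraph \<Rightarrow> bool" where
  "is_star S \<longleftrightarrow> (\<exists>z\<in>verts S. edges S = {{z, x} | x. x \<in> verts S - {z}})"

definition star_forest :: "'a sgraph \<Rightarrow> bool" where
  "star_forest F \<longleftrightarrow> (\<forall>S\<in>components F. is_star (induced F S))"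

definition leaves :: "'a sgraph \<Rightarrow> 'a set" where
  "leaves S = {v \<in> verts S. degree S v = 1}"

text \<open>For \<open>k \<le> c - k + 1 \<le> n\<close>: the clique is \<open>{..<c - k + 1}\<close>, and the remaining vertices
  \<open>c - k + 1, \<dots>, n - 1\<close> are joined exactly to the \<open>k\<close> clique vertices in \<open>{..<k}\<close>.\<close>

definition W_graph :: "nat \<Rightarrow> nat \<Rightarrow> nat \<Rightarrow> nat sgraph" where
  "W_graph n k c = \<lparr>verts = {..<n},
     edges = {{i, j} | i j. i < j \<and> j < c - k + 1} \<union>
             {{i, j} | i j. i < k \<and> c - k + 1 \<le> j \<and> j < n}\<rparr>"

definition X_family :: "nat \<Rightarrow> nat \<Rightarrow> 'a sgraph set" where
  "X_family n c = {G. simple_graph G \<and> card (verts G) = n \<and>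
     (\<exists>A B X. verts G = A \<union> B \<union> X \<and> A \<inter> B = {} \<and> A \<inter> X = {} \<and> B \<inter> X = {} \<and>
        card A = c div 2 \<and> clique G A \<and>
        independent G B \<and> independent G X \<and> completely_joined G A B \<and>
        (\<exists>a\<in>A. \<exists>b\<in>B. \<forall>x\<in>X. nbhd G x = {a, b}))}"

definition Y_family :: "nat \<Rightarrow> nat \<Rightarrow> 'a sgraph set" where
  "Y_family n c = {G. simple_graph G \<and> card (verts G) = n \<and>
     (\<exists>A B Y. verts G = A \<union> B \<union> Y \<and> A \<inter> B = {} \<and> A \<inter> Y = {} \<and> B \<inter> Y = {} \<and>
        card A = c div 2 \<and> clique G A \<and>
        independent G B \<and> completely_joined G A B \<and>
        star_forest (induced G Y) \<and> card (components (induced G Y)) \<ge> 2 \<and>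
        (\<forall>S\<in>components (induced G Y). edges (induced G S) \<noteq> {}) \<and>
        (\<exists>a\<in>A. \<exists>b\<in>A. \<forall>S\<in>components (induced G Y).
           set_nbhd G S = {a, b} \<and>
           (card S \<ge> 3 \<longrightarrow>
              (\<forall>l\<in>leaves (induced G S). degree G l = 2) \<and>
              (\<exists>w\<in>{a, b}. \<forall>l\<in>leaves (induced G S). w \<in> nbhd G l))))}"

end

theory Submission
  imports Defs
begin

text \<open>
  Put \<open>k = \<lfloor>c/2\<rfloor>\<close> and call a set \<open>D\<close> of vertices off \<open>C\<close> dense if more than \<open>(k - 1)|D|\<close> edges lie
  inside \<open>D\<close> or between \<open>D\<close> and \<open>C\<close>. In a smallest dense set every vertex has at least \<open>k\<close>
  neighbours in \<open>D \<union> C\<close>. Take a longest path that leaves \<open>C\<close> at a vertex \<open>a\<close>, stays off \<open>C\<close> and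
  ends at some \<open>u \<in> D\<close>. If \<open>u\<close> has no neighbour on \<open>C\<close> other than \<open>a\<close>, then its \<open>k - 1\<close>
  neighbours on the path and two disjoint paths to \<open>C\<close> give an ear with \<open>k\<close> inner vertices, too
  long for a longest cycle. Otherwise, counting the gaps on \<open>C\<close> between the neighbours of \<open>u\<close>
  leaves no slack: the path is a clique and a component of \<open>D\<close>, which is not dense unless it is a
  single vertex. So some vertex \<open>v\<close> has exactly \<open>k\<close> neighbours, all of them on \<open>C\<close>.

  Let \<open>A\<close> be the neighbourhood of \<open>v\<close>. It takes every second vertex of \<open>C\<close>, up to one gap of
  length three when \<open>c\<close> is odd. Rerouting \<open>C\<close> through \<open>v\<close> shows that the vertices in the gaps of
  length two have no neighbour outside \<open>A\<close>, and that a path off \<open>A\<close> joining two vertices of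
  \<open>A\<close> has at most two inner vertices, for even \<open>c\<close> at most one. Hence \<open>G - A\<close> has no edge
  (even \<open>c\<close>), or a single edge, a single star, or several stars attached to the same two vertices of
  \<open>A\<close>; these are the three families.
\<close>

section \<open>Paths, cycles and two disjoint paths\<close>

text \<open>The density count leaves one case open. A clique component on \<open>r\<close> vertices,
  each with \<open>k + 1 - r\<close> neighbours on \<open>C\<close>, exceeds the threshold exactly
  for \<open>r < 3\<close>, so two vertices are not excluded by it: they give one edge plus
  \<open>2(k - 1)\<close> edges to \<open>C\<close>. Here both have the same \<open>k - 1\<close>
  neighbours on \<open>C\<close>, which must lie at least three apart along \<open>C\<close>, so
  \<open>3(k - 1) <= c <= 2k + 1\<close>. This fails from \<open>k = 5\<close> on, which is the
  origin of \<open>10 <= c\<close>. The obstacle afterwards is that a path attached to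
  \<open>A\<close> may run through the gap of \<open>C\<close> that is set apart, and then it cannot
  be spliced into a cycle that also uses this gap. Therefore the alternating configuration is a
  locale over an arbitrary longest cycle \<open>S @ X\<close> and is interpreted again for other
  cycles with the same \<open>A\<close>: for even \<open>c\<close> a rotation moves the gap
  elsewhere, and for odd \<open>c\<close> an edge of \<open>G - A\<close> disjoint from the gap
  takes its place. Combining two interpretations removes the exception made for the gap.\<close>

definition adj :: "'a sgraph \<Rightarrow> 'a \<Rightarrow> 'a \<Rightarrow> bool" where
  "adj G u v \<longleftrightarrow> {u, v} \<in> edges G"

definition gpath :: "'a sgraph \<Rightarrow> 'a list \<Rightarrow> bool" where
  "gpath G p \<longleftrightarrow> p \<noteq> [] \<and> distinct p \<and> set p \<subseteq> verts G \<and> successively (adj G) p"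

lemma adj_sym: "adj G u v \<longleftrightarrow> adj G v u"
  by (simp add: adj_def insert_commute)

lemma successively_adj_swap [simp]:
  "successively (\<lambda>x y. adj G y x) p \<longleftrightarrow> successively (adj G) p"
proof -
  have "(\<lambda>x y. adj G y x) = adj G" by (simp add: fun_eq_iff adj_sym)
  then show ?thesis by (rule arg_cong)
qed

lemma gpath_rev [simp]: "gpath G (rev p) \<longleftrightarrow> gpath G p"
  by (simp add: gpath_def)

lemma gpath_append:
  assumes "p \<noteq> []" "q \<noteq> []"
  shows "gpath G (p @ q) \<longleftrightarrow> gpath G p \<and> gpath G q \<and> set p \<inter> set q = {} \<and> adj G (last p) (hd q)"
  using assms by (auto simp: gpath_def successively_append_iff)

lemma tl_rev_butlast: "tl (rev xs) = rev (butlast xs)"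
  by (cases xs rule: rev_cases) auto

lemma gpath_first_hit:
  assumes "gpath G p" "last p \<in> F"
  obtains q where "gpath G q" "hd q = hd p" "last q \<in> F" "set (butlast q) \<inter> F = {}"
    "set q \<subseteq> set p"
proof -
  have ne: "p \<noteq> []" using assms by (simp add: gpath_def)
  then have "\<exists>x\<in>set p. x \<in> F" using assms last_in_set by blast
  then obtain ys x zs where s: "p = ys @ x # zs" "x \<in> F" "\<forall>y\<in>set ys. y \<notin> F"
    using split_list_first_prop[of p "\<lambda>x. x \<in> F"] by blast
  have p: "p = (ys @ [x]) @ zs" using s by simp
  have "gpath G (ys @ [x])"
    using assms(1) gpath_append[of "ys @ [x]" zs] unfolding p by (cases "zs = []") auto
  moreover have "hd (ys @ [x]) = hd p" using s by (cases ys) auto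
  ultimately show thesis using that[of "ys @ [x]"] s by auto
qed

text \<open>Without the index modulo the length, a cycle glued from lists can be checked with
  \<open>successively_append_iff\<close>.\<close>

lemma is_cycle_iff:
  "is_cycle G L \<longleftrightarrow> length L \<ge> 3 \<and> distinct L \<and> set L \<subseteq> verts G \<and>
     successively (adj G) L \<and> adj G (last L) (hd L)"
proof (cases "length L \<ge> 3")
  case True
  define m where "m = length L"
  have m: "m \<ge> 3" "m = length L" using True by (auto simp: m_def)
  have ne: "L \<noteq> []" using True by auto
  have "(\<forall>i<m. {L ! i, L ! (Suc i mod m)} \<in> edges G) \<longleftrightarrow>
        (\<forall>i. Suc i < m \<longrightarrow> adj G (L ! i) (L ! Suc i)) \<and> adj G (L ! (m - 1)) (L ! 0)" (is "?l \<longleftrightarrow> ?r")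
  proof
    assume l: ?l
    have "adj G (L ! i) (L ! Suc i)" if "Suc i < m" for i
      using l[rule_format, of i] that by (simp add: adj_def)
    moreover have "adj G (L ! (m - 1)) (L ! 0)"
      using l[rule_format, of "m - 1"] m(1) by (simp add: adj_def)
    ultimately show ?r by blast
  next
    assume r: ?r
    show ?l
    proof (intro allI impI)
      fix i assume "i < m"
      then show "{L ! i, L ! (Suc i mod m)} \<in> edges G"
        using r m by (cases "Suc i < m") (auto simp: adj_def dest: less_antisym)
    qed
  qed
  then show ?thesis
    using True ne m by (simp add: is_cycle_def successively_conv_nth last_conv_nth hd_conv_nth)
qed (simp add: is_cycle_def)

lemma is_cycle_rotate:
  assumes "is_cycle G (xs @ ys)"
  shows "is_cycle G (ys @ xs)"
  using assms by (cases "xs = []"; cases "ys = []") (auto simp: is_cycle_iff successively_append_iff)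

lemma longest_cycle_rotate:
  assumes "longest_cycle G (xs @ ys)"
  shows "longest_cycle G (ys @ xs)"
  using assms is_cycle_rotate[of G xs ys] by (auto simp: longest_cycle_def)

locale two_connected_graph =
  fixes G :: "'a sgraph"
  assumes simple: "simple_graph G" and conn: "k_connected 2 G"
begin

lemma adj_verts: "adj G u v \<Longrightarrow> u \<in> verts G \<and> v \<in> verts G \<and> u \<noteq> v"
  using simple by (fastforce simp: adj_def simple_graph_def)

lemma finite_verts: "finite (verts G)"
  using simple by (simp add: simple_graph_def)

lemma adj_irrefl [simp]: "\<not> adj G u u"
  using adj_verts by blast

lemma path_avoiding:
  assumes "s \<in> verts G" "t \<in> verts G" "s \<noteq> w" "t \<noteq> w"
  obtains p where "gpath G p" "hd p = s" "last p = t" "w \<notin> set p"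
proof -
  \<comment> \<open>\<open>w\<close> may lie outside the graph, whereas \<open>k_connected\<close>
    only quantifies over sets of vertices; hence the intersection.\<close>
  let ?H = "induced G (verts G - ({w} \<inter> verts G))"
  have "card ({w} \<inter> verts G) < 2"
    using card_mono[of "{w}" "{w} \<inter> verts G"] by simp
  then have "connected_graph ?H"
    using conn by (auto simp: k_connected_def)
  then have "reachable ?H s t"
    using assms by (auto simp: connected_graph_def induced_def)
  then have "(s, t) \<in> {(x, y). {x, y} \<in> edges ?H}\<^sup>*" by (simp add: reachable_def)
  then have "\<exists>p. gpath G p \<and> hd p = s \<and> last p = t \<and> w \<notin> set p"
  proof (induction rule: rtrancl_induct)
    case base
    show ?case using assms by (intro exI[of _ "[s]"]) (auto simp: gpath_def)
  next
    case (step y z)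
    then obtain p where p: "gpath G p" "hd p = s" "last p = y" "w \<notin> set p" by blast
    have e: "adj G y z" "z \<noteq> w" using step(2) by (auto simp: induced_def adj_def)
    have "gpath G (p @ [z])" if "z \<notin> set p"
      using that p e adj_verts[OF e(1)] by (auto simp: gpath_append gpath_def successively_append_iff)
    then show ?case
    proof (cases "z \<in> set p")
      \<comment> \<open>The walk returns to the path built so far: cut that path at
        \<open>z\<close>.\<close>
      case True
      obtain q where "gpath G q" "hd q = hd p" "last q = z" "set q \<subseteq> set p"
      proof -
        obtain ys zs where s: "p = (ys @ [z]) @ zs"
          using True by (metis append.assoc append_Cons append_Nil split_list)
        have "gpath G (ys @ [z])"
          using p(1) gpath_append[of "ys @ [z]" zs] unfolding s by (cases "zs = []") auto
        then show thesis using that[of "ys @ [z]"] s by (cases ys) auto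
      qed
      then show ?thesis using p by auto
    next
      case False
      have "p \<noteq> []" using p by (simp add: gpath_def)
      then show ?thesis using \<open>z \<notin> set p \<Longrightarrow> gpath G (p @ [z])\<close> False p e
        by (intro exI[of _ "p @ [z]"]) auto
    qed
  qed
  then show thesis using that by blast
qed

text \<open>Where the two paths end is left open, so that the same notion covers both stages of the
  construction: paths with a common end and disjoint paths. The start \<open>z\<close> of
  \<open>p\<close> is prescribed because later one of the two paths has to leave from a given
  vertex.\<close>

definition from_set :: "'a set \<Rightarrow> 'a \<Rightarrow> 'a list \<Rightarrow> 'a list \<Rightarrow> bool" where
  "from_set Z z p q \<longleftrightarrow> gpath G p \<and> gpath G q \<and> hd p = z \<and> z \<in> Z \<and> hd q \<in> Z \<and> hd q \<noteq> z \<and>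
     set (tl p) \<inter> Z = {} \<and> set (tl q) \<inter> Z = {}"

lemma gpath_ne: "gpath G p \<Longrightarrow> p \<noteq> []" by (simp add: gpath_def)

text \<open>\<open>M\<close> enters \<open>p\<close> from outside. Following \<open>p\<close> up to
  the entry and then \<open>M\<close> backwards keeps the start of \<open>p\<close>, moves its end
  to \<open>hd M\<close>, and drops the rest of \<open>p\<close> with its end \<open>w\<close>,
  which is left to the other path.\<close>

lemma splice_path:
  assumes p: "gpath G p" and M: "gpath G M" "last M \<in> set p" "set (butlast M) \<inter> set p = {}"
    "w \<noteq> last M" "last p = w"
    and Z: "set (tl p) \<inter> Z = {}" "set (butlast M) \<inter> Z = {}"
  obtains q where "gpath G q" "hd q = hd p" "last q = hd M" "set q \<subseteq> set p \<union> set M"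
    "w \<in> set q \<Longrightarrow> w \<in> set M" "set (tl q) \<inter> Z = {}"
proof -
  obtain ys zs where s: "p = (ys @ [last M]) @ zs"
    using M(2) by (metis append.assoc append_Cons append_Nil split_list)
  have zs: "zs \<noteq> []" using s M by auto
  have Mne: "M \<noteq> []" using M by (simp add: gpath_def)
  have g1: "gpath G (ys @ [last M])"
    using p gpath_append[of "ys @ [last M]" zs] zs unfolding s by blast
  have w: "w \<in> set zs" using s zs M by auto
  have wn: "w \<notin> set (ys @ [last M])"
    using p s w by (auto simp: gpath_def)
  let ?q = "(ys @ [last M]) @ rev (butlast M)"
  have "gpath G ?q"
  proof (cases "butlast M = []")
    case True then show ?thesis using g1 by simp
  next
    case False
    have "gpath G (butlast M @ [last M])" using M Mne by simp
    then have "gpath G (butlast M)" "adj G (last (butlast M)) (last M)"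
      using False by (auto simp: gpath_append simp del: append_butlast_last_id)
    then show ?thesis using False g1 M(3) s
      by (subst gpath_append) (auto simp: hd_rev adj_sym)
  qed
  moreover have "hd ?q = hd p" using s by (cases ys) auto
  moreover have "last ?q = hd M"
    using Mne by (cases M rule: rev_cases) (auto simp: last_rev)
  moreover have "set ?q \<subseteq> set p \<union> set M" using s by (auto dest: in_set_butlastD)
  moreover have "w \<in> set M" if "w \<in> set ?q" using that wn by (auto dest: in_set_butlastD)
  moreover have "set (tl ?q) \<inter> Z = {}" using Z s by (cases ys) auto
  ultimately show thesis using that by blast
qed

text \<open>By 2-connectivity a path from \<open>t\<close> to \<open>z\<close> avoids
  \<open>w\<close>; stop it at its first contact with the two paths or with \<open>Z\<close>. If it
  meets \<open>p\<close> or \<open>q\<close>, that path is diverted to \<open>t\<close> and the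
  other keeps the end \<open>w\<close>. If it meets \<open>Z\<close> off both paths, its reverse
  replaces \<open>q\<close>.\<close>

lemma from_set_split:
  assumes f: "from_set Z z p q" and pq: "set p \<inter> set q = {w}" "last p = w" "last q = w"
    and Zv: "Z \<subseteq> verts G" "w \<notin> Z" and t: "t \<in> verts G" "t \<noteq> w" "t \<notin> Z"
  obtains p' q' where "from_set Z z p' q'" "set p' \<inter> set q' = {}" "{last p', last q'} = {w, t}"
proof -
  have gp: "gpath G p" "gpath G q" using f by (auto simp: from_set_def)
  then have ne: "p \<noteq> []" "q \<noteq> []" by (auto simp: gpath_def)
  let ?F = "(set p \<union> set q \<union> Z) - {w}"
  have z: "z \<in> ?F" "z \<in> verts G" "z \<noteq> w" using f Zv by (auto simp: from_set_def)
  obtain M0 where M0: "gpath G M0" "hd M0 = t" "last M0 = z" "w \<notin> set M0"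
    using path_avoiding[OF t(1) z(2) t(2) z(3)] by blast
  obtain M where M: "gpath G M" "hd M = t" "last M \<in> ?F" "set (butlast M) \<inter> ?F = {}" "w \<notin> set M"
    using gpath_first_hit[OF M0(1), of ?F] M0 z(1) by (metis subsetD)
  have Mne: "M \<noteq> []" using M gpath_ne by blast
  have bM: "set (butlast M) \<inter> Z = {}" "set (butlast M) \<inter> set p = {}" "set (butlast M) \<inter> set q = {}"
    using M(4,5) Zv by (auto dest: in_set_butlastD)
  have sM: "set M = insert (last M) (set (butlast M))"
    using Mne by (metis append_butlast_last_id list.simps(15) rotate1.simps(2) set_rotate1)
  consider "last M \<in> set p" | "last M \<in> set q" | "last M \<in> Z - set p - set q" using M(3) by blast
  then show thesis
  proof cases
    case 1
    have w: "w \<noteq> last M" using M(3) by blast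
    obtain p' where p': "gpath G p'" "hd p' = hd p" "last p' = hd M" "set p' \<subseteq> set p \<union> set M"
      "w \<in> set p' \<Longrightarrow> w \<in> set M" "set (tl p') \<inter> Z = {}"
      using splice_path[OF gp(1) M(1) 1 bM(2) w pq(2) _ bM(1)] f by (auto simp: from_set_def)
    have "last M \<notin> set q" using 1 pq(1) w by (metis IntI singletonD)
    have "set p' \<inter> set q = {}"
    proof (rule ccontr)
      assume "set p' \<inter> set q \<noteq> {}"
      then obtain x where x: "x \<in> set p'" "x \<in> set q" by auto
      have "x \<noteq> w" using x(1) p'(5) M(5) by metis
      then have "x \<notin> set p" using pq(1) x(2) by (metis IntI Int_commute singletonD)
      then have "x \<in> set M" using x(1) p'(4) by auto
      then show False using sM bM(2,3) x(2) \<open>last M \<notin> set q\<close> by auto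
    qed
    then show thesis using that[of p' q] f p' pq M(2) by (auto simp: from_set_def)
  next
    case 2
    have w: "w \<noteq> last M" using M(3) by blast
    obtain q' where q': "gpath G q'" "hd q' = hd q" "last q' = hd M" "set q' \<subseteq> set q \<union> set M"
      "w \<in> set q' \<Longrightarrow> w \<in> set M" "set (tl q') \<inter> Z = {}"
      using splice_path[OF gp(2) M(1) 2 bM(3) w pq(3) _ bM(1)] f by (auto simp: from_set_def)
    have "last M \<notin> set p" using 2 pq(1) w by (metis IntI singletonD)
    have "set q' \<inter> set p = {}"
    proof (rule ccontr)
      assume "set q' \<inter> set p \<noteq> {}"
      then obtain x where x: "x \<in> set q'" "x \<in> set p" by auto
      have "x \<noteq> w" using x(1) q'(5) M(5) by metis
      then have "x \<notin> set q" using pq(1) x(2) by (metis IntI Int_commute singletonD)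
      then have "x \<in> set M" using x(1) q'(4) by auto
      then show False using sM bM(2,3) x(2) \<open>last M \<notin> set p\<close> by auto
    qed
    then show thesis using that[of p q'] f q' pq M(2) by (auto simp: from_set_def Int_commute)
  next
    case 3
    have "set p \<inter> set (rev M) = {}" using 3 sM bM by auto
    moreover have "from_set Z z p (rev M)"
      using f M 3 bM Mne ne unfolding from_set_def
      by (auto simp: hd_rev tl_rev_butlast)
    ultimately show thesis using that[of p "rev M"] pq(2) M(2) Mne by (auto simp: last_rev)
  qed
qed

text \<open>Fan form of Menger's theorem for two paths, by induction along \<open>P\<close>. Let
  \<open>w\<close> be the vertex before the last vertex \<open>t\<close>: the two paths to
  \<open>w\<close> are split so that they end in \<open>w\<close> and \<open>t\<close>, and the edge
  from \<open>w\<close> to \<open>t\<close> joins them again at \<open>t\<close>. The base case is a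
  single edge together with a path from \<open>t\<close> towards \<open>z'\<close> avoiding
  \<open>z\<close>.\<close>

lemma two_paths_to_vertex:
  assumes "gpath G P" "hd P = z" "set (tl P) \<inter> Z = {}" "z \<in> Z" "z' \<in> Z" "z' \<noteq> z"
    "Z \<subseteq> verts G" "length P \<ge> 2"
  shows "\<exists>p q. from_set Z z p q \<and> set p \<inter> set q = {last P} \<and> last p = last P \<and> last q = last P"
  using assms
proof (induction P rule: rev_induct)
  case (snoc t P)
  have Pne: "P \<noteq> []" using snoc.prems by auto
  have P: "gpath G P" "t \<in> verts G" "t \<notin> set P" "adj G (last P) t"
    using snoc.prems(1) Pne by (auto simp: gpath_append gpath_def successively_append_iff)
  have tZ: "t \<notin> Z" "set (tl P) \<inter> Z = {}" "hd P = z" using snoc.prems Pne by auto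
  show ?case
  proof (cases "length P \<ge> 2")
    case False
    then have "length P = 1" using Pne by (cases P) (auto simp: Suc_le_eq)
    then have Pz: "P = [z]" using tZ(3) by (cases P) auto
    have tz: "t \<noteq> z" using P Pz by auto
    have "z' \<in> verts G" using snoc.prems by auto
    then obtain M0 where M0: "gpath G M0" "hd M0 = t" "last M0 = z'" "z \<notin> set M0"
      using path_avoiding[OF P(2) _ tz snoc.prems(6)] by blast
    then obtain M where M: "gpath G M" "hd M = t" "last M \<in> Z" "set (butlast M) \<inter> Z = {}" "z \<notin> set M"
      using gpath_first_hit[OF M0(1), of Z] snoc.prems by (metis subsetD)
    have Mne: "M \<noteq> []" using M gpath_ne by blast
    have "from_set Z z [z, t] (rev M)"
      unfolding from_set_def using M Mne tZ snoc.prems P Pz tz last_in_set[OF Mne]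
      by (auto simp: gpath_def hd_rev tl_rev_butlast)
    moreover have "set [z, t] \<inter> set (rev M) = {t}" using M Mne hd_in_set[OF Mne] by auto
    ultimately show ?thesis using M Mne by (intro exI[of _ "[z,t]"] exI[of _ "rev M"]) (auto simp: last_rev)
  next
    case True
    let ?w = "last P"
    obtain p q where pq: "from_set Z z p q" "set p \<inter> set q = {?w}" "last p = ?w" "last q = ?w"
      using snoc.IH[OF P(1) tZ(3,2) snoc.prems(4-7) True] by blast
    have "?w \<in> set (tl P)" using True by (cases P) auto
    then have wZ: "?w \<notin> Z" using tZ by blast
    have tw: "t \<noteq> ?w" using P Pne by auto
    obtain p' q' where s: "from_set Z z p' q'" "set p' \<inter> set q' = {}" "{last p', last q'} = {?w, t}"
      using from_set_split[OF pq snoc.prems(7) wZ P(2) tw tZ(1)] by blast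
    have ne: "p' \<noteq> []" "q' \<noteq> []" using s gpath_ne by (auto simp: from_set_def)
    consider "last p' = ?w" "last q' = t" | "last p' = t" "last q' = ?w" using s(3) tw by (auto simp: doubleton_eq_iff)
    then show ?thesis
    proof cases
      case 1
      have tp: "t \<notin> set p'" "t \<in> set q'" using s 1 ne last_in_set[of q'] by auto
      have "gpath G (p' @ [t])" using s tp 1 P ne by (subst gpath_append) (auto simp: from_set_def gpath_def)
      then have "from_set Z z (p' @ [t]) q'" using s tZ ne by (auto simp: from_set_def)
      then show ?thesis using tp s 1 by (intro exI[of _ "p' @ [t]"] exI[of _ q']) auto
    next
      case 2
      have tp: "t \<notin> set q'" "t \<in> set p'" using s 2 ne last_in_set[of p'] by auto
      have "gpath G (q' @ [t])" using s tp 2 P ne by (subst gpath_append) (auto simp: from_set_def gpath_def)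
      then have "from_set Z z p' (q' @ [t])" using s tZ ne by (auto simp: from_set_def)
      then show ?thesis using tp s 2 by (intro exI[of _ p'] exI[of _ "q' @ [t]"]) auto
    qed
  qed
qed simp

text \<open>Set form of the same theorem: split the fan at \<open>last P\<close> towards a second
  vertex of \<open>Y\<close>, then cut both paths at their first vertex in \<open>Y\<close>.\<close>

lemma two_disjoint_paths:
  assumes P: "gpath G P" "hd P = z" "set (tl P) \<inter> Z = {}" "last P \<in> Y"
    and Z: "z \<in> Z" "z' \<in> Z" "z' \<noteq> z" "Z \<subseteq> verts G"
    and Y: "y \<in> Y" "y' \<in> Y" "y \<noteq> y'" "Y \<subseteq> verts G" "Y \<inter> Z = {}"
  obtains p q where "from_set Z z p q" "set p \<inter> set q = {}" "last p \<in> Y" "last q \<in> Y"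
    "set (butlast p) \<inter> Y = {}" "set (butlast q) \<inter> Y = {}"
proof -
  have len: "length P \<ge> 2"
  proof (rule ccontr)
    assume "\<not> ?thesis"
    then have "P = [z]" using P(1,2) by (cases P) (auto simp: gpath_def Suc_le_eq)
    then show False using P Z Y by auto
  qed
  obtain p0 q0 where 0: "from_set Z z p0 q0" "set p0 \<inter> set q0 = {last P}" "last p0 = last P" "last q0 = last P"
    using two_paths_to_vertex[OF P(1-3) Z len] by blast
  obtain t where t: "t \<in> Y" "t \<noteq> last P" using Y by metis
  obtain p1 q1 where 1: "from_set Z z p1 q1" "set p1 \<inter> set q1 = {}" "{last p1, last q1} = {last P, t}"
    using from_set_split[OF 0 Z(4), of t] t Y P by blast
  have l: "last p1 \<in> Y" "last q1 \<in> Y" using 1(3) t P(4) by (auto simp: doubleton_eq_iff)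
  obtain p where p: "gpath G p" "hd p = hd p1" "last p \<in> Y" "set (butlast p) \<inter> Y = {}" "set p \<subseteq> set p1"
    using gpath_first_hit[of G p1 Y] 1 l by (auto simp: from_set_def)
  obtain q where q: "gpath G q" "hd q = hd q1" "last q \<in> Y" "set (butlast q) \<inter> Y = {}" "set q \<subseteq> set q1"
    using gpath_first_hit[of G q1 Y] 1 l by (auto simp: from_set_def)
  have tl: "set (tl r) \<inter> Z = {}" if "gpath G r" "hd r = hd r1" "set r \<subseteq> set r1" "set (tl r1) \<inter> Z = {}"
    "gpath G r1" for r r1
    using that by (cases r; cases r1) (auto simp: gpath_def)
  have "from_set Z z p q" using 1 p q tl[of p p1] tl[of q q1] by (auto simp: from_set_def)
  then show thesis using that[of p q] p q 1 by blast
qed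

end

section \<open>Ears of a longest cycle\<close>

lemma spaced_set_Max:
  fixes I :: "nat set"
  assumes "finite I" "I \<noteq> {}" "\<forall>i\<in>I. lo \<le> i" "\<forall>i\<in>I. \<forall>j\<in>I. i < j \<longrightarrow> i + d \<le> j"
  shows "lo + d * (card I - 1) \<le> Max I"
  using assms
proof (induction I rule: finite_linorder_max_induct)
  case (insert b A)
  show ?case
  proof (cases "A = {}")
    case True then show ?thesis using insert by simp
  next
    case False
    have IH: "lo + d * (card A - 1) \<le> Max A" using insert False by auto
    have "Max A + d \<le> b" using insert False by (metis Max_in insertCI)
    moreover have "Max (insert b A) = b"
      using insert by (intro Max_eqI) (auto simp: less_imp_le)
    moreover have "card (insert b A) - 1 = Suc (card A - 1)"
      using insert False by (metis One_nat_def Suc_pred card_gt_0_iff card_insert_disjoint diff_Suc_1 less_irrefl)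
    ultimately show ?thesis using IH by simp
  qed
qed simp

locale longest_cycle_graph = two_connected_graph +
  fixes C :: "'a list"
  assumes longest: "longest_cycle G C"
begin

lemma cycle: "is_cycle G C" and cycle_le: "is_cycle G D \<Longrightarrow> length D \<le> length C"
  using longest by (auto simp: longest_cycle_def)

lemma C_facts: "distinct C" "set C \<subseteq> verts G" "length C \<ge> 3" "successively (adj G) C" "adj G (last C) (hd C)"
  using cycle by (auto simp: is_cycle_iff)

text \<open>An ear at \<open>s\<close> and \<open>b\<close> is given by its interior.\<close>

definition ear :: "'a \<Rightarrow> 'a list \<Rightarrow> 'a \<Rightarrow> bool" where
  "ear s D b \<longleftrightarrow> gpath G D \<and> set D \<inter> set C = {} \<and> adj G s (hd D) \<and> adj G (last D) b"

text \<open>Replacing either arc between the ends by \<open>D\<close> gives a cycle, so each arc has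
  at least \<open>length D\<close> inner vertices. \<open>L\<close> may be a rotation of
  \<open>C\<close>, so that a chosen vertex can be put at position 0.\<close>

lemma ear_gap:
  assumes L: "longest_cycle G L" "set L = set C" and ij: "i < j" "j < length L"
    and D: "ear (L ! i) D (L ! j)"
  shows "i + length D + 1 \<le> j" "j - i + length D + 1 \<le> length L"
proof -
  have le: "length D' \<le> length L" if "is_cycle G D'" for D'
    using L that by (auto simp: longest_cycle_def)
  have Lc: "distinct L" "set L \<subseteq> verts G" "successively (adj G) L" "adj G (last L) (hd L)" "L \<noteq> []"
    using L(1) ij by (auto simp: longest_cycle_def is_cycle_iff)
  have Dne: "D \<noteq> []" and Dd: "distinct D" "set D \<subseteq> verts G" "successively (adj G) D" "set D \<inter> set L = {}"
    and Da: "adj G (L ! i) (hd D)" "adj G (last D) (L ! j)"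
    using D L by (auto simp: ear_def gpath_def)
  have lD: "length D \<ge> 1" using Dne by (cases D) auto
  have succ: "successively (adj G) (take m L)" "successively (adj G) (drop m L)" for m
    using Lc(3) successively_append_iff[of "adj G" "take m L" "drop m L"] by auto
  have l1: "last (take (Suc i) L) = L ! i" using ij by (simp add: take_Suc_conv_app_nth)
  have l2: "hd (drop j L) = L ! j" using ij by (simp add: hd_drop_conv_nth)
  have ne: "take (Suc i) L \<noteq> []" "drop j L \<noteq> []" using ij Lc by auto
  have dis: "set (take (Suc i) L) \<inter> set (drop j L) = {}"
    using Lc(1) ij by (intro set_take_disj_set_drop_if_distinct) auto
  have sub: "set (take m L) \<subseteq> set L" "set (drop m L) \<subseteq> set L" for m
    by (auto dest: in_set_takeD in_set_dropD)
  have "is_cycle G (take (Suc i) L @ D @ drop j L)"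
    unfolding is_cycle_iff
    using Lc Dd Da Dne ne succ l1 l2 dis sub[of "Suc i"] sub[of j] ij lD
    by (auto simp: successively_append_iff)
  from le[OF this] show "i + length D + 1 \<le> j" using ij by simp
  let ?M = "drop i (take (Suc j) L)"
  have Mne: "?M \<noteq> []" using ij by simp
  have M: "last ?M = L ! j" "hd ?M = L ! i"
    using ij by (auto simp: take_Suc_conv_app_nth hd_drop_conv_nth)
  have Ms: "set ?M \<subseteq> set L" by (meson in_set_dropD in_set_takeD subsetI)
  have "successively (adj G) ?M"
    using succ(1)[of "Suc j"] successively_append_iff[of "adj G" "take i (take (Suc j) L)" ?M]
    unfolding append_take_drop_id by blast
  then have "is_cycle G (?M @ rev D)"
    unfolding is_cycle_iff
    using Lc Dd Da Dne Mne M Ms ij lD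
    by (auto simp: successively_append_iff hd_rev last_rev adj_sym)
  from le[OF this] show "j - i + length D + 1 \<le> length L" using ij by simp
qed

text \<open>Rotate \<open>s\<close> to position 0. The attachments then keep distance
  \<open>r + 1\<close> from \<open>s\<close> on both sides and distance \<open>m + 1\<close> from
  one another; the bound adds up these distances.\<close>

lemma spaced_attachments:
  assumes s: "s \<in> set C" and T: "T \<subseteq> set C - {s}" "T \<noteq> {}"
    and r: "\<And>b. b \<in> T \<Longrightarrow> \<exists>D. length D = r \<and> ear s D b"
    and m: "\<And>b b'. b \<in> T \<Longrightarrow> b' \<in> T \<Longrightarrow> b \<noteq> b' \<Longrightarrow> \<exists>D. length D = m \<and> ear b D b'"
  shows "2 * r + 2 + (m + 1) * (card T - 1) \<le> length C"
proof -
  obtain xs ys where C: "C = xs @ s # ys" using split_list[OF s] by blast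
  define L where "L = s # ys @ xs"
  have L: "longest_cycle G L" "set L = set C" "length L = length C" "L ! 0 = s"
    using longest_cycle_rotate[of G xs "s # ys"] longest C by (auto simp: L_def)
  have dL: "distinct L" using L(1) by (simp add: longest_cycle_def is_cycle_def)
  define I where "I = {i. i < length L \<and> L ! i \<in> T}"
  have fI: "finite I" by (auto simp: I_def)
  have im: "(\<lambda>i. L ! i) ` I = T"
  proof
    show "T \<subseteq> (\<lambda>i. L ! i) ` I"
    proof
      fix b assume b: "b \<in> T"
      then have "b \<in> set L" using T(1) L(2) by blast
      then obtain i where "i < length L" "L ! i = b" by (auto simp: in_set_conv_nth)
      then show "b \<in> (\<lambda>i. L ! i) ` I" using b by (auto simp: I_def)
    qed
  qed (auto simp: I_def)
  have "inj_on (\<lambda>i. L ! i) I" using dL by (auto simp: I_def inj_on_def nth_eq_iff_index_eq)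
  then have card: "card I = card T" using im card_image[of "\<lambda>i. L ! i" I] by simp
  have ne: "I \<noteq> {}" using im T(2) by auto
  have pos: "0 < i" "i < length L" "L ! i \<in> T" if "i \<in> I" for i
    using that T(1) L(4) by (auto simp: I_def intro!: gr0I)
  have low: "\<forall>i\<in>I. r + 1 \<le> i" and high: "i + r + 1 \<le> length L" if "i \<in> I" for i
  proof -
    have *: "r + 1 \<le> i \<and> i + r + 1 \<le> length L" if i: "i \<in> I" for i
    proof -
      obtain D where "length D = r" "ear s D (L ! i)" using r pos(3)[OF i] by blast
      then show ?thesis using ear_gap[OF L(1,2) pos(1,2)[OF i], of D] L(4) by auto
    qed
    show "\<forall>i\<in>I. r + 1 \<le> i" using * by blast
    show "i + r + 1 \<le> length L" using * that by blast
  qed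
  have sp: "\<forall>i\<in>I. \<forall>j\<in>I. i < j \<longrightarrow> i + (m + 1) \<le> j"
  proof (intro ballI impI)
    fix i j assume ij: "i \<in> I" "j \<in> I" "i < j"
    then have "L ! i \<noteq> L ! j" using dL pos(2) by (auto simp: nth_eq_iff_index_eq)
    then obtain D where "length D = m" "ear (L ! i) D (L ! j)" using m pos(3) ij by blast
    then show "i + (m + 1) \<le> j" using ear_gap(1)[OF L(1,2) ij(3) pos(2)[OF ij(2)], of D] by auto
  qed
  have "r + 1 + (m + 1) * (card I - 1) \<le> Max I"
    using spaced_set_Max[OF fI ne _ sp, of "r + 1"] low ne by blast
  moreover have "Max I + r + 1 \<le> length L" using high fI ne by simp
  ultimately show ?thesis using card L(3) by simp
qed

text \<open>The whole path \<open>D\<close> is an ear from \<open>s\<close> to each other neighbour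
  of its end \<open>u\<close>, and \<open>u\<close> alone is an ear between two of those: distances
  of \<open>length D + 1\<close> next to \<open>s\<close> and of two elsewhere.\<close>

lemma gap_bound:
  assumes D: "gpath G D" "set D \<inter> set C = {}" "adj G s (hd D)" "s \<in> set C" "last D = u"
    and T: "T = {b \<in> set C. adj G u b}" "T - {s} \<noteq> {}"
  shows "2 * length D + 2 * card (T - {s}) \<le> length C"
proof -
  have u: "u \<notin> set C" "u \<in> verts G" using D last_in_set[of D] by (auto simp: gpath_def)
  have "2 * length D + 2 + (1 + 1) * (card (T - {s}) - 1) \<le> length C"
  proof (rule spaced_attachments[OF D(4)])
    fix b b' assume "b \<in> T - {s}" "b' \<in> T - {s}"
    then have "ear b [u] b'" using T u by (auto simp: ear_def gpath_def adj_sym)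
    then show "\<exists>D. length D = 1 \<and> ear b D b'" by (intro exI[of _ "[u]"]) auto
  next
    fix b assume "b \<in> T - {s}"
    then have "ear s D b" using D T by (auto simp: ear_def)
    then show "\<exists>D'. length D' = length D \<and> ear s D' b" by blast
  qed (use T in auto)
  moreover have "card (T - {s}) \<ge> 1"
    using T by (simp add: Suc_le_eq card_gt_0_iff)
  ultimately show ?thesis by simp
qed

lemma ear_length:
  assumes "ear s D b" "s \<in> set C" "b \<in> set C" "s \<noteq> b"
  shows "2 * length D + 2 \<le> length C"
  using spaced_attachments[of s "{b}" "length D" 0] assms by auto

text \<open>With \<open>w\<close> on the cycle this gives a contact with the cycle other than
  \<open>w\<close>; with \<open>w\<close> off the cycle it leads away from a known neighbour of
  \<open>u\<close>.\<close>

lemma exists_ear_from: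
  assumes u: "u \<in> verts G" "u \<notin> set C" "w \<noteq> u"
  obtains D s where "gpath G D" "set D \<inter> set C = {}" "hd D = u" "adj G (last D) s" "s \<in> set C" "w \<notin> set D" "s \<noteq> w"
proof -
  have "card (set C) \<ge> 3" using C_facts distinct_card[of C] by simp
  then have "card (set C - {w}) \<noteq> 0" using card_Diff1_le[of "set C" w] by (cases "w \<in> set C") auto
  then have "set C - {w} \<noteq> {}" by (metis card.empty)
  then obtain c where c: "c \<in> set C" "c \<noteq> w" by auto
  obtain p where p: "gpath G p" "hd p = u" "last p = c" "w \<notin> set p"
    using path_avoiding[of u c w] u c C_facts by auto
  obtain q where q: "gpath G q" "hd q = u" "last q \<in> set C" "set (butlast q) \<inter> set C = {}" "w \<notin> set q"
    using gpath_first_hit[OF p(1), of "set C"] p c by (metis subsetD)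
  have ne: "butlast q \<noteq> []" using q u by (cases q rule: rev_cases) (auto simp: gpath_def)
  have qd: "q = butlast q @ [last q]" using q by (simp add: gpath_def)
  have "gpath G (butlast q)" "adj G (last (butlast q)) (last q)"
    using q(1) ne gpath_append[of "butlast q" "[last q]"] qd by auto
  moreover have "hd (butlast q) = u" using q(2) ne qd by (metis hd_append2)
  moreover have "last q \<noteq> w" "w \<notin> set (butlast q)" using q(5) last_in_set[OF gpath_ne[OF q(1)]] by (auto dest: in_set_butlastD)
  ultimately show thesis using that q by blast
qed

end

section \<open>A vertex with the maximum number of neighbours on the cycle\<close>

context longest_cycle_graph
begin

definition dg :: "'a set \<Rightarrow> 'a \<Rightarrow> nat" where
  "dg S u = card {v \<in> S. adj G u v}"

text \<open>Twice the number of edges inside \<open>S\<close> or between \<open>S\<close> and the cycle.\<close>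

definition wt :: "'a set \<Rightarrow> nat" where
  "wt S = (\<Sum>u\<in>S. dg S u + 2 * dg (set C) u)"

lemma wt_remove:
  assumes "finite S" "u \<in> S"
  shows "wt S = wt (S - {u}) + 2 * dg S u + 2 * dg (set C) u"
proof -
  have 1: "dg S x = dg (S - {u}) x + (if adj G u x then 1 else 0)" if "x \<in> S - {u}" for x
  proof (cases "adj G u x")
    case True
    then have "{v \<in> S. adj G x v} = insert u {v \<in> S - {u}. adj G x v}"
      using assms by (auto simp: adj_sym)
    then show ?thesis using True assms by (simp add: dg_def)
  next
    case False
    then have "{v \<in> S. adj G x v} = {v \<in> S - {u}. adj G x v}" by (auto simp: adj_sym)
    then show ?thesis using False by (simp add: dg_def)
  qed
  have "(\<Sum>x\<in>S - {u}. if adj G u x then 1 else 0) = card {x \<in> S - {u}. adj G u x}"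
    using assms by (simp add: sum.If_cases Int_def)
  moreover have "{x \<in> S - {u}. adj G u x} = {x \<in> S. adj G u x}" by auto
  ultimately have 2: "(\<Sum>x\<in>S - {u}. if adj G u x then 1 else 0) = dg S u" by (simp add: dg_def)
  have "(\<Sum>x\<in>S - {u}. dg S x + 2 * dg (set C) x)
      = (\<Sum>x\<in>S - {u}. (dg (S - {u}) x + 2 * dg (set C) x) + (if adj G u x then 1 else 0))"
    by (rule sum.cong) (simp_all add: 1)
  also have "\<dots> = wt (S - {u}) + dg S u"
    unfolding sum.distrib 2 wt_def by (simp add: sum.distrib)
  finally show ?thesis
    using sum.remove[OF assms, of "\<lambda>x. dg S x + 2 * dg (set C) x"] by (simp add: wt_def)
qed

lemma wt_closed:
  assumes "finite S" "Q \<subseteq> S" "\<And>x y. x \<in> Q \<Longrightarrow> y \<in> S - Q \<Longrightarrow> \<not> adj G x y"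
  shows "wt S = wt Q + wt (S - Q)"
proof -
  have 1: "dg S x = dg Q x" if "x \<in> Q" for x
    unfolding dg_def using assms that by (intro arg_cong[where f = card]) auto
  have 2: "dg S x = dg (S - Q) x" if "x \<in> S - Q" for x
    unfolding dg_def using assms that by (intro arg_cong[where f = card]) (auto simp: adj_sym)
  have "wt S = (\<Sum>u\<in>S - Q. dg S u + 2 * dg (set C) u) + (\<Sum>u\<in>Q. dg S u + 2 * dg (set C) u)"
    unfolding wt_def using assms by (simp add: sum.subset_diff)
  then show ?thesis using 1 2 by (simp add: wt_def)
qed

lemma finite_edges: "finite (edges G)"
  by (rule finite_subset[of _ "Pow (verts G)"]) (use simple in \<open>auto simp: simple_graph_def\<close>)

lemma edge_doubleton:
  assumes "e \<in> edges G"
  obtains u v where "e = {u, v}" "u \<noteq> v" "u \<in> verts G" "v \<in> verts G"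
proof -
  have "card e = 2" "e \<subseteq> verts G" using simple assms by (auto simp: simple_graph_def)
  then show thesis using that by (auto simp: card_2_iff)
qed

text \<open>The edges split into those inside the complement, counted at both ends, and those from
  the complement to the cycle, counted at the end off the cycle.\<close>

lemma edges_le_wt: "2 * card {e \<in> edges G. card (e \<inter> set C) \<le> 1} \<le> wt (verts G - set C)"
proof -
  let ?S = "verts G - set C"
  let ?E1 = "{e \<in> edges G. e \<subseteq> ?S}"
  let ?E2 = "(\<lambda>(u, v). {u, v}) ` (SIGMA u:?S. {v \<in> set C. adj G u v})"
  have fin: "finite ?S" using finite_verts by simp
  have sub: "{e \<in> edges G. card (e \<inter> set C) \<le> 1} \<subseteq> ?E1 \<union> ?E2"
  proof
    fix e assume "e \<in> {e \<in> edges G. card (e \<inter> set C) \<le> 1}"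
    then have e: "e \<in> edges G" "card (e \<inter> set C) \<le> 1" by auto
    obtain u v where uv: "e = {u, v}" "u \<noteq> v" "u \<in> verts G" "v \<in> verts G"
      using edge_doubleton[OF e(1)] by blast
    have adj: "adj G u v" "adj G v u" using e uv by (auto simp: adj_def insert_commute)
    have "\<not> (u \<in> set C \<and> v \<in> set C)"
    proof
      assume "u \<in> set C \<and> v \<in> set C"
      then have "e \<inter> set C = {u, v}" using uv by auto
      then show False using e(2) uv(2) by simp
    qed
    then consider "u \<in> ?S" "v \<in> ?S" | "u \<in> ?S" "v \<in> set C" | "v \<in> ?S" "u \<in> set C" using uv by blast
    then show "e \<in> ?E1 \<union> ?E2"
    proof cases
      case 1 then show ?thesis using e uv by auto
    next
      case 2
      then have "(u, v) \<in> (SIGMA u:?S. {v \<in> set C. adj G u v})" using adj by auto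
      then show ?thesis using uv(1) by (metis (mono_tags, lifting) UnI2 case_prod_conv imageI)
    next
      case 3
      then have "(v, u) \<in> (SIGMA u:?S. {v \<in> set C. adj G u v})" using adj by auto
      then show ?thesis using uv(1)
        by (metis (mono_tags, lifting) UnI2 case_prod_conv imageI insert_commute)
    qed
  qed
  have f1: "finite ?E1" using finite_edges by simp
  have fs: "finite (SIGMA u:?S. {v \<in> set C. adj G u v})" using fin by auto
  have c2: "card ?E2 \<le> (\<Sum>u\<in>?S. dg (set C) u)"
    using card_image_le[OF fs, of "\<lambda>(u, v). {u, v}"] fin by (simp add: dg_def)
  have "(\<Sum>u\<in>?S. card {e \<in> ?E1. u \<in> e}) = 2 * card ?E1"
  proof (rule sum_multicount[where R = "\<lambda>u e. u \<in> e", OF fin f1], rule ballI)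
    fix e assume e: "e \<in> ?E1"
    then have "{u \<in> ?S. u \<in> e} = e" by blast
    moreover have "card e = 2" using e simple by (simp add: simple_graph_def)
    ultimately show "card {u \<in> ?S. u \<in> e} = 2" by (simp only:)
  qed
  moreover have "card {e \<in> ?E1. u \<in> e} \<le> dg ?S u" if "u \<in> ?S" for u
  proof -
    have "{e \<in> ?E1. u \<in> e} \<subseteq> (\<lambda>v. {u, v}) ` {v \<in> ?S. adj G u v}"
    proof
      fix e assume e: "e \<in> {e \<in> ?E1. u \<in> e}"
      then have "e \<in> edges G" by simp
      then obtain x y where "e = {x, y}" by (rule edge_doubleton)
      then obtain v where "e = {u, v}" using e by blast
      then show "e \<in> (\<lambda>v. {u, v}) ` {v \<in> ?S. adj G u v}" using e by (auto simp: adj_def)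
    qed
    then show ?thesis unfolding dg_def using fin by (intro surj_card_le) auto
  qed
  ultimately have c1: "2 * card ?E1 \<le> (\<Sum>u\<in>?S. dg ?S u)"
    using sum_mono[of ?S "\<lambda>u. card {e \<in> ?E1. u \<in> e}" "dg ?S"] by simp
  have "card {e \<in> edges G. card (e \<inter> set C) \<le> 1} \<le> card (?E1 \<union> ?E2)"
    using sub f1 fs by (intro card_mono) auto
  also have "\<dots> \<le> card ?E1 + card ?E2" by (rule card_Un_le)
  finally have "2 * card {e \<in> edges G. card (e \<inter> set C) \<le> 1} \<le> 2 * card ?E1 + 2 * card ?E2" by simp
  also have "\<dots> \<le> wt ?S" using c1 c2 by (simp add: wt_def sum.distrib sum_distrib_left[symmetric])
  finally show ?thesis .
qed

lemma ear_of_gpath: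
  assumes "gpath G (s # D @ [b])" "D \<noteq> []" "set D \<inter> set C = {}"
  shows "ear s D b"
  using assms by (cases D) (auto simp: ear_def gpath_def successively_append_iff successively_Cons)

text \<open>The path turns back at a neighbour \<open>z\<close> of its end, so that the resulting ear passes
  through all neighbours of the end.\<close>

lemma ear_through_neighbours:
  assumes q: "gpath G q" "set q \<inter> set C = {}" "adj G a (hd q)" "a \<in> set C" "last q = u"
    and N: "N \<subseteq> set q" "N \<noteq> {}" "\<And>x. x \<in> N \<Longrightarrow> adj G u x"
  obtains s D b where "ear s D b" "s \<in> set C" "b \<in> set C" "s \<noteq> b" "card N + 1 \<le> length D"
proof -
  have uN: "u \<notin> N" using N(3)[of u] by auto
  have "\<exists>x\<in>set q. x \<in> N" using N by auto
  then obtain q1 x q2 where q12: "q = q1 @ x # q2" "x \<in> N" "\<forall>y\<in>set q1. y \<notin> N"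
    using split_list_first_prop[of q "\<lambda>x. x \<in> N"] by blast
  have xu: "x \<noteq> u" using uN q12 by auto
  have q2: "q2 \<noteq> []" "last q2 = u" using q12 q(5) xu by (auto split: if_splits)
  \<comment> \<open>\<open>x\<close> is the first neighbour of \<open>u\<close> on the path, and
    \<open>?Z\<close> the stretch from \<open>x\<close> to \<open>u\<close>. The part before
    \<open>x\<close>, read backwards, reaches \<open>a\<close> on the cycle and starts the search
    for two disjoint paths from \<open>?Z\<close> to the cycle, one of them leaving at
    \<open>x\<close>.\<close>
  let ?Z = "set (x # q2)"
  let ?P = "rev (a # q1 @ [x])"
  have qd: "distinct q" "set q \<subseteq> verts G" "successively (adj G) q" using q by (auto simp: gpath_def)
  have aq: "a \<notin> set q" using q by auto
  have "gpath G (a # q1 @ [x])"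
    using qd q12 aq q(3) adj_verts[OF q(3)]
    by (auto simp: gpath_def successively_append_iff successively_Cons hd_append split: if_splits)
  then have P: "gpath G ?P" by (simp only: gpath_rev)
  have P2: "hd ?P = x" "set (tl ?P) \<inter> ?Z = {}" "last ?P \<in> set C"
    using qd q12 aq q(4) by auto
  have uZ: "u \<in> ?Z" using q2 last_in_set[of q2] by auto
  have Zv: "?Z \<subseteq> verts G" "set C \<inter> ?Z = {}" using qd q12 q(2) by auto
  have "card (set C) \<ge> 3" using C_facts distinct_card[of C] by simp
  then have "\<not> set C \<subseteq> {a}" using card_mono[of "{a}" "set C"] by auto
  then obtain y' where y': "y' \<in> set C" "a \<noteq> y'" by auto
  obtain p p' where pp: "from_set ?Z x p p'" "set p \<inter> set p' = {}" "last p \<in> set C" "last p' \<in> set C"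
    "set (butlast p) \<inter> set C = {}" "set (butlast p') \<inter> set C = {}"
    using two_disjoint_paths[OF P P2 _ uZ _ Zv(1) q(4) y' C_facts(2) Zv(2)] xu by (metis list.set_intros(1))
  have split: "\<exists>r0 s. r = hd r # r0 @ [s]" if "gpath G r" "hd r \<notin> set C" "last r \<in> set C" for r
    using that by (cases r; cases "tl r" rule: rev_cases) (auto simp: gpath_def)
  have hZ: "hd p = x" "hd p' \<in> ?Z" "hd p' \<noteq> x" using pp(1) by (auto simp: from_set_def)
  obtain p0 s where p0: "p = x # p0 @ [s]" using split[of p] pp hZ Zv by (fastforce simp: from_set_def)
  obtain y where y: "y = hd p'" by blast
  obtain p0' b where p0': "p' = y # p0' @ [b]" using split[of p'] pp hZ Zv y by (fastforce simp: from_set_def)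
  have "y \<in> set q2" using hZ y by auto
  then obtain m1 m2 where m: "q2 = m1 @ y # m2" by (meson split_list)
  have "\<exists>z\<in>set (x # m1). z \<in> N" using q12 by auto
  then obtain n1 z n2 where n: "x # m1 = n1 @ z # n2" "z \<in> N" "\<forall>t\<in>set n2. t \<notin> N"
    using split_list_last_prop[of "x # m1" "\<lambda>x. x \<in> N"] by blast
  have qn: "q = q1 @ (n1 @ [z]) @ n2 @ (y # m2)"
    using q12(1) m n(1) by simp
  have hdn: "hd (n1 @ [z]) = x" using n(1) by (cases n1) auto
  \<comment> \<open>\<open>y\<close> is where the second path leaves, and \<open>z\<close> is the
    last neighbour of \<open>u\<close> before \<open>y\<close>. Go from \<open>x\<close> to
    \<open>z\<close>, jump to \<open>u\<close> and come back to \<open>y\<close>; only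
    \<open>n2\<close> is skipped, and it contains no neighbour of \<open>u\<close>.\<close>
  let ?mid = "(n1 @ [z]) @ rev (y # m2)"
  have lu: "last (y # m2) = u" using q(5) qn by simp
  have "gpath G (n1 @ [z])" "gpath G (y # m2)"
    using qd unfolding qn by (auto simp: gpath_def successively_append_iff successively_Cons)
  moreover have "set (n1 @ [z]) \<inter> set (rev (y # m2)) = {}" using qd unfolding qn by auto
  moreover have "hd (rev (y # m2)) = u" using lu by (simp only: hd_rev)
  ultimately have mid: "gpath G ?mid"
    using N(3)[OF n(2)] gpath_rev[of G "y # m2"] by (subst gpath_append) (auto simp: adj_sym)
  have midZ: "set ?mid \<subseteq> ?Z"
  proof -
    have "?Z = set (n1 @ z # n2) \<union> set (y # m2)" using m n(1) by (metis append_Cons set_append)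
    then show ?thesis by auto
  qed
  have gp: "gpath G p" "gpath G p'" "set (tl p) \<inter> ?Z = {}" "set (tl p') \<inter> ?Z = {}"
    using pp(1) by (auto simp: from_set_def)
  have a1: "gpath G (p0 @ [s])" "adj G x (hd (p0 @ [s]))"
    using gp(1) gpath_append[of "[x]" "p0 @ [s]"] p0 by auto
  have a2: "gpath G (p0' @ [b])" "adj G y (hd (p0' @ [b]))"
    using gp(2) gpath_append[of "[y]" "p0' @ [b]"] p0' by auto
  have g2: "gpath G (?mid @ (p0' @ [b]))"
    using mid a2 gp(4) midZ p0' by (subst gpath_append) auto
  have hdm: "hd (?mid @ (p0' @ [b])) = x" using hdn by (cases n1) auto
  have "gpath G (rev (p0 @ [s]) @ (?mid @ (p0' @ [b])))"
  proof (subst gpath_append)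
    have "set (p0 @ [s]) \<inter> set ?mid = {}" using gp(3) midZ p0 by auto
    moreover have "set (p0 @ [s]) \<inter> set (p0' @ [b]) = {}" using pp(2) p0 p0' by auto
    ultimately have "set (rev (p0 @ [s])) \<inter> set (?mid @ (p0' @ [b])) = {}" by auto
    moreover have "adj G (last (rev (p0 @ [s]))) (hd (?mid @ (p0' @ [b])))"
      unfolding hdm using a1(2) by (subst last_rev) (auto simp: adj_sym)
    moreover have "gpath G (rev (p0 @ [s]))" using a1(1) by (simp only: gpath_rev)
    ultimately show "gpath G (rev (p0 @ [s])) \<and> gpath G (?mid @ p0' @ [b]) \<and>
        set (rev (p0 @ [s])) \<inter> set (?mid @ p0' @ [b]) = {} \<and>
        adj G (last (rev (p0 @ [s]))) (hd (?mid @ p0' @ [b]))" using g2 by blast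
  qed auto
  then have "gpath G (s # (rev p0 @ ?mid @ p0') @ [b])" by simp
  moreover have "set p0 \<inter> set C = {}" "set p0' \<inter> set C = {}"
    using pp(5,6) p0 p0' by (auto simp: butlast_append)
  moreover have "set ?mid \<inter> set C = {}" using midZ Zv by blast
  ultimately have "ear s (rev p0 @ ?mid @ p0') b"
    by (intro ear_of_gpath) auto
  moreover have "s \<in> set C" "b \<in> set C" "s \<noteq> b" using pp(2-4) p0 p0' by auto
  moreover have "card N + 1 \<le> length (rev p0 @ ?mid @ p0')"
  proof -
    have "N \<union> {u} \<subseteq> set ?mid"
    proof -
      have "u \<in> set (y # m2)" using lu by (metis last_in_set list.distinct(1))
      then show ?thesis using N(1) q12(3) n(3) unfolding qn by auto
    qed
    then have "card (N \<union> {u}) \<le> length ?mid"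
      by (meson List.finite_set card_length card_mono le_trans)
    moreover have "card (N \<union> {u}) = card N + 1"
      using uN N(1) finite_subset by fastforce
    ultimately show ?thesis by simp
  qed
  ultimately show thesis using that by blast
qed

end

context longest_cycle_graph
begin

lemma exists_full_vertex:
  assumes k: "k = length C div 2" "k \<ge> 5"
    and w: "wt (verts G - set C) > 2 * (k - 1) * card (verts G - set C)"
  obtains v where "v \<in> verts G" "v \<notin> set C" "{b. adj G v b} \<subseteq> set C" "card {b. adj G v b} = k"
proof -
  have len: "length C \<le> 2 * k + 1" using k by linarith
  define dense where "dense S \<longleftrightarrow> S \<subseteq> verts G - set C \<and> wt S > 2 * (k - 1) * card S" for S
  have "dense (verts G - set C)" using w by (simp add: dense_def)
  then obtain S where S: "dense S" "\<And>S'. dense S' \<Longrightarrow> card S \<le> card S'"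
    using ex_has_least_nat[of dense _ card] by blast
  have SV: "S \<subseteq> verts G - set C" using S(1) by (simp add: dense_def)
  then have fS: "finite S" using finite_verts by (auto intro: finite_subset)
  have Sne: "S \<noteq> {}" using S(1) by (auto simp: dense_def wt_def)
  \<comment> \<open>A vertex of smaller degree could be deleted: this loses at most
    \<open>k - 1\<close> edges and one vertex, so the rest would still be dense.\<close>
  have deg: "dg S u + dg (set C) u \<ge> k" if u: "u \<in> S" for u
  proof (rule ccontr)
    assume "\<not> ?thesis"
    then have "2 * dg S u + 2 * dg (set C) u \<le> 2 * (k - 1)" by simp
    then have "wt (S - {u}) + 2 * (k - 1) > 2 * (k - 1) * card S"
      using S(1) wt_remove[OF fS u] by (simp add: dense_def)
    moreover have "card S = Suc (card (S - {u}))" using fS u by (metis card.remove)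
    ultimately have "dense (S - {u})" using SV by (auto simp: dense_def)
    then show False using S(2)[of "S - {u}"] \<open>card S = Suc (card (S - {u}))\<close> by simp
  qed
  \<comment> \<open>If a union of components of \<open>S\<close> were not dense, the rest of
    \<open>S\<close> would be a smaller dense set.\<close>
  have closed: "wt Q > 2 * (k - 1) * card Q"
    if Q: "Q \<subseteq> S" "Q \<noteq> {}" "\<And>x y. x \<in> Q \<Longrightarrow> y \<in> S - Q \<Longrightarrow> \<not> adj G x y" for Q
  proof (rule ccontr)
    assume "\<not> ?thesis"
    moreover have "wt S = wt Q + wt (S - Q)" using wt_closed[OF fS Q(1) Q(3)] by blast
    moreover have cS: "card S = card Q + card (S - Q)"
      using Q(1) fS by (metis card_Diff_subset card_mono finite_subset le_add_diff_inverse)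
    ultimately have "dense (S - Q)" using S(1) SV by (auto simp: dense_def add_mult_distrib2 simp del: distrib_left_numeral)
    then have "card S \<le> card (S - Q)" using S(2) by blast
    then have "card Q = 0" using cS by simp
    then show False using Q(1,2) fS by (metis card_0_eq finite_subset)
  qed

  \<comment> \<open>The start \<open>a\<close> is part of the candidate, so that \<open>key\<close>
    applies to every start that the same path admits.\<close>
  define tail where "tail = (\<lambda>(a, q). a \<in> set C \<and> gpath G q \<and> set q \<inter> set C = {} \<and> adj G a (hd q) \<and> last q \<in> S)"
  obtain aq0 where "tail aq0"
  proof -
    obtain u where u: "u \<in> S" using Sne by auto
    have "hd C \<in> set C" using C_facts(3) by (intro hd_in_set) auto
    then have "u \<in> verts G" "u \<notin> set C" "hd C \<noteq> u" using u SV by auto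
    then obtain D s where "gpath G D" "set D \<inter> set C = {}" "hd D = u" "adj G (last D) s" "s \<in> set C"
      using exists_ear_from by metis
    then have "tail (s, rev D)" using u by (auto simp: tail_def gpath_def hd_rev last_rev adj_sym)
    then show thesis using that by blast
  qed
  moreover have "\<forall>aq. tail aq \<longrightarrow> length (snd aq) < Suc (card (verts G))"
  proof (intro allI impI)
    fix aq assume "tail aq"
    then have "distinct (snd aq)" "set (snd aq) \<subseteq> verts G" by (auto simp: tail_def gpath_def)
    then show "length (snd aq) < Suc (card (verts G))"
      using finite_verts by (metis card_mono distinct_card less_Suc_eq_le)
  qed
  ultimately obtain aq where aq: "tail aq" "\<And>aq'. tail aq' \<Longrightarrow> length (snd aq') \<le> length (snd aq)"
    using ex_has_greatest_nat[of tail aq0 "\<lambda>x. length (snd x)"] by blast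
  obtain a q where aq_eq: "aq = (a, q)" by (cases aq)
  define r where "r = length q"
  have tq: "tail (a, q)" using aq aq_eq by simp
  have max: "length q' \<le> r" if "tail (a', q')" for a' q'
    using aq(2)[OF that] aq_eq r_def by simp
  define T where "T u = {b \<in> set C. adj G u b}" for u
  have fT: "finite (T u)" for u by (simp add: T_def)
  \<comment> \<open>With \<open>N\<close> the neighbours of \<open>u\<close> in \<open>S\<close>,
    maximality gives \<open>card N <= r - 1\<close>, and the gap bound gives
    \<open>card (T u - {a'}) <= k - r\<close>. These add up to \<open>k - 1\<close>, while
    \<open>deg\<close> asks for \<open>k\<close>: hence \<open>a'\<close> is in \<open>T u\<close>
    and all bounds are equalities.\<close>
  have key: "a' \<in> T (last q') \<and> card (T (last q')) + r = k + 1 \<and>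
      {v \<in> S. adj G (last q') v} = set q' - {last q'}"
    if t: "tail (a', q')" and l: "length q' = r" for a' q'
  proof -
    define u where "u = last q'"
    have q': "a' \<in> set C" "gpath G q'" "set q' \<inter> set C = {}" "adj G a' (hd q')" "u \<in> S"
      using t by (auto simp: tail_def u_def)
    have ne: "q' \<noteq> []" using q' gpath_ne by blast
    let ?N = "{v \<in> S. adj G u v}"
    have Nq: "?N \<subseteq> set q' - {u}"
    proof
      fix v assume v: "v \<in> ?N"
      have "v \<in> set q'"
      proof (rule ccontr)
        assume nv: "v \<notin> set q'"
        have "gpath G (q' @ [v])"
          using v nv q' ne SV by (subst gpath_append) (auto simp: u_def gpath_def)
        then have "tail (a', q' @ [v])" using q' v SV ne by (auto simp: tail_def)
        from max[OF this] show False using l by simp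
      qed
      then show "v \<in> set q' - {u}" using v by auto
    qed
    have cq: "card (set q' - {u}) = r - 1"
      using q'(2) ne l by (simp add: u_def gpath_def distinct_card)
    have dN: "card ?N \<le> r - 1" using card_mono[OF _ Nq] cq by simp
    have dg: "k \<le> card ?N + card (T u)" using deg[OF q'(5)] by (simp add: dg_def T_def)
    have r1: "r \<ge> 1" using ne l by (cases q') auto
    \<comment> \<open>Otherwise \<open>u\<close> has at least \<open>k - 1\<close> neighbours on the
      path, and the ear through them and \<open>u\<close> has at least \<open>k\<close> inner
      vertices, so that \<open>2k + 2 <= c\<close>.\<close>
    have "T u - {a'} \<noteq> {}"
    proof
      assume "T u - {a'} = {}"
      then have "T u \<subseteq> {a'}" by blast
      then have "card (T u) \<le> 1" using card_mono[of "{a'}" "T u"] by simp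
      then have cN: "card ?N + 1 \<ge> k" using dg by simp
      have "card ?N \<noteq> 0" using cN k(2) by linarith
      then have "?N \<noteq> {}" by (metis card.empty)
      moreover have "?N \<subseteq> set q'" using Nq by blast
      ultimately obtain s D b where "ear s D b" "s \<in> set C" "b \<in> set C" "s \<noteq> b" "card ?N + 1 \<le> length D"
        using ear_through_neighbours[OF q'(2,3,4,1) u_def[symmetric], of ?N] by blast
      then show False using ear_length[of s D b] len cN by simp
    qed
    then have "2 * r + 2 * card (T u - {a'}) \<le> length C"
      using gap_bound[OF q'(2,3,4,1) u_def[symmetric] T_def] l by simp
    then have b: "r + card (T u - {a'}) \<le> k" using len by linarith
    have a: "a' \<in> T u"
    proof (rule ccontr)
      assume "a' \<notin> T u"
      then show False using b dg dN r1 by simp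
    qed
    have "card (T u) = card (T u - {a'}) + 1" using a fT card.remove[of "T u" a'] by simp
    then have "card (T u) + r = k + 1" "card ?N = r - 1" using b dg dN r1 by linarith+
    then show ?thesis using a card_subset_eq[OF _ Nq] cq u_def by auto
  qed

  have q: "a \<in> set C" "gpath G q" "set q \<inter> set C = {}" "adj G a (hd q)" "last q \<in> S"
    using tq by (auto simp: tail_def)
  have qne: "q \<noteq> []" using q gpath_ne by blast
  note kq = key[OF tq r_def[symmetric]]
  have rk: "r \<le> k"
  proof -
    have "card (T (last q)) > 0" using kq fT card_gt_0_iff by blast
    then show ?thesis using kq by linarith
  qed
  have qS: "set q \<subseteq> S" using kq q by blast
  \<comment> \<open>Turning the path around at \<open>x\<close> makes \<open>x\<close> its end, so \<open>key\<close> applies to every vertex of the path.\<close>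
  have rot: "\<exists>q'. tail (a, q') \<and> set q' = set q \<and> length q' = r \<and> last q' = x" if x: "x \<in> set q" for x
  proof (cases "x = last q")
    case True then show ?thesis using tq r_def by blast
  next
    case False
    obtain q1 q2 where q12: "q = q1 @ x # q2" using split_list[OF x] by blast
    have ux: "adj G (last q) y" if "y \<in> set q" "y \<noteq> last q" for y using kq that by blast
    have hdr: "hd (rev (x # q2)) = last q" using q12 by (simp only: hd_rev) simp
    have dq: "distinct q" using q by (simp add: gpath_def)
    show ?thesis
    proof (cases "q1 = []")
      case True
      have "tail (a, rev q)" using q kq qS qne hd_in_set[OF qne]
        by (auto simp: tail_def hd_rev last_rev T_def adj_sym)
      then show ?thesis using True q12 r_def by (intro exI[of _ "rev q"]) auto
    next
      case q1: False
      have g: "gpath G q1" "gpath G (x # q2)" "set q1 \<inter> set (x # q2) = {}"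
        using q(2) gpath_append[of q1 "x # q2"] q12 q1 by auto
      have "last q1 \<noteq> last q"
        using g(3) q1 q12 last_in_set[OF q1] last_in_set[of "x # q2"] by (metis disjoint_iff last_appendR list.distinct(1))
      then have "adj G (last q1) (last q)" using ux[of "last q1"] q1 q12 by (auto simp: adj_sym)
      then have "gpath G (q1 @ rev (x # q2))"
        using g q1 hdr gpath_rev[of G "x # q2"] by (subst gpath_append) auto
      moreover have "x \<in> S" using qS x by auto
      ultimately have "tail (a, q1 @ rev (x # q2))" using q q12 q1 by (auto simp: tail_def)
      then show ?thesis using q12 r_def by (intro exI[of _ "q1 @ rev (x # q2)"]) auto
    qed
  qed
  have all: "a \<in> T x" "card (T x) + r = k + 1" "{v \<in> S. adj G x v} = set q - {x}" if "x \<in> set q" for x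
    using rot[OF that] key by metis+
  have cq: "card (set q) = r" using q(2) by (simp add: r_def gpath_def distinct_card)
  consider "r = 1" | "r = 2" | "r \<ge> 3" using qne r_def by (cases q; cases "tl q"; cases "tl (tl q)") auto
  then show thesis
  proof cases
    case 1
    then obtain v where v: "q = [v]" using r_def by (auto simp: length_Suc_conv)
    have vC: "v \<in> verts G" "v \<notin> set C" using v q by (auto simp: gpath_def)
    have cT: "card (T v) = k" using kq v 1 by simp
    \<comment> \<open>\<open>key\<close> excludes neighbours in \<open>S\<close> only. A neighbour
      \<open>x\<close> off the cycle gives a path of at least two vertices from the cycle through
      \<open>x\<close> to \<open>v\<close>, and the gap bound yields
      \<open>4 + 2(k - 1) <= c\<close>.\<close>
    have sub: "{b. adj G v b} \<subseteq> set C"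
    proof (rule ccontr)
      assume "\<not> ?thesis"
      then obtain x where x: "adj G v x" "x \<notin> set C" by auto
      then have "x \<in> verts G" "v \<noteq> x" using adj_verts by auto
      then obtain D s where D: "gpath G D" "set D \<inter> set C = {}" "hd D = x" "adj G (last D) s" "s \<in> set C" "v \<notin> set D"
        using exists_ear_from[of x v] x by metis
      have Dne: "D \<noteq> []" using D gpath_ne by blast
      have g: "gpath G (rev D @ [v])"
        using D Dne vC x by (subst gpath_append) (auto simp: last_rev adj_sym gpath_def)
      have card: "card (T v - {s}) \<ge> k - 1" using cT fT by (metis card_Diff_singleton_if diff_le_self order_refl)
      then have "card (T v - {s}) \<noteq> 0" using k(2) by linarith
      then have "T v - {s} \<noteq> {}" by (metis card.empty)
      then have "2 * length (rev D @ [v]) + 2 * card (T v - {s}) \<le> length C"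
        using gap_bound[OF g _ _ D(5) _ T_def] D Dne vC by (auto simp: hd_rev adj_sym)
      moreover have "length D \<ge> 1" using Dne by (cases D) auto
      ultimately show False using card len k by simp
    qed
    then have "{b. adj G v b} = T v" by (auto simp: T_def)
    then show thesis using that[of v] vC cT sub by auto
  next
    case 2
    then obtain x u where xu: "q = [x, u]" using r_def by (auto simp: length_Suc_conv numeral_2_eq_2)
    \<comment> \<open>Each neighbour of \<open>x\<close> on the cycle can serve as the start of the
      path \<open>[x, u]\<close>, and \<open>key\<close> puts every start into
      \<open>T u\<close>.\<close>
    have "T x \<subseteq> T u"
    proof
      fix a' assume "a' \<in> T x"
      then have "tail (a', q)" using xu q by (auto simp: tail_def T_def adj_sym)
      then show "a' \<in> T u" using key r_def xu by force
    qed
    moreover have "card (T x) = card (T u)" using all(2)[of x] all(2)[of u] xu by simp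
    ultimately have T: "T x = T u" using fT card_subset_eq by blast
    have cT: "card (T u) = k - 1" using all(2)[of u] xu 2 by simp
    have "card (T u - {a}) = k - 2" using cT all(1)[of u] xu fT by simp
    \<comment> \<open>Any two of the \<open>k - 1\<close> common neighbours are joined by an ear on
      \<open>x\<close> and \<open>u\<close>, hence at least three apart on the cycle. This gives
      \<open>3k - 3 <= 2k + 1\<close>, against \<open>k >= 5\<close>.\<close>
    moreover have "2 * 2 + 2 + (2 + 1) * (card (T u - {a}) - 1) \<le> length C"
    proof (rule spaced_attachments[OF q(1)])
      have e: "ear s [x, u] b" if "s \<in> T u" "b \<in> T u" for s b
        using that T q(2,3) xu by (auto simp: ear_def T_def gpath_def adj_sym)
      show "\<exists>D. length D = 2 \<and> ear a D b" if "b \<in> T u - {a}" for b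
        using e[of a b] that all(1)[of u] xu by (intro exI[of _ "[x, u]"]) auto
      show "\<exists>D. length D = 2 \<and> ear s D b" if "s \<in> T u - {a}" "b \<in> T u - {a}" for s b
        using e[of s b] that by (intro exI[of _ "[x, u]"]) auto
      have "card (T u - {a}) \<noteq> 0" using calculation k(2) by linarith
      then show "T u - {a} \<noteq> {}" by (metis card.empty)
    qed (auto simp: T_def)
    ultimately show thesis using len k by simp
  next
    case 3
    have "\<not> adj G x y" if "x \<in> set q" "y \<in> S - set q" for x y
      using all(3)[OF that(1)] that by blast
    \<comment> \<open>The clique \<open>set q\<close> is closed in \<open>S\<close>, hence dense;
      but its weight per vertex is \<open>2k + 1 - r\<close>, which exceeds \<open>2(k - 1)\<close>
      only for \<open>r < 3\<close>.\<close>
    then have "wt (set q) > 2 * (k - 1) * card (set q)" using closed[OF qS] qne by auto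
    moreover have "dg (set q) x + 2 * dg (set C) x = (r - 1) + 2 * (k + 1 - r)" if x: "x \<in> set q" for x
    proof -
      have "{v \<in> set q. adj G x v} = set q - {x}" using all(3)[OF x] qS by blast
      then have "dg (set q) x = r - 1" using x cq by (simp add: dg_def)
      moreover have "dg (set C) x = k + 1 - r" using all(2)[OF x] by (simp add: dg_def T_def)
      ultimately show ?thesis by simp
    qed
    then have "wt (set q) = (\<Sum>x\<in>set q. (r - 1) + 2 * (k + 1 - r))"
      unfolding wt_def by (intro sum.cong) auto
    ultimately have "card (set q) * (2 * (k - 1)) < card (set q) * ((r - 1) + 2 * (k + 1 - r))"
      by (simp add: mult.commute)
    then have "2 * (k - 1) < (r - 1) + 2 * (k + 1 - r)" by simp
    then show thesis using 3 rk by simp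
  qed
qed

end

section \<open>The alternating structure of the cycle\<close>

lemma card_no_consecutive_le:
  assumes "I \<subseteq> {..<2 * k - 1}" "\<forall>i\<in>I. Suc i \<notin> I"
  shows "card I \<le> k"
proof (cases "I = {}")
  case False
  have f: "finite I" using assms(1) finite_subset by blast
  have "\<forall>i\<in>I. \<forall>j\<in>I. i < j \<longrightarrow> i + 2 \<le> j" using assms(2) by (metis Suc_leI add_2_eq_Suc' le_neq_implies_less)
  then have "2 * (card I - 1) \<le> Max I" using spaced_set_Max[OF f False, of 0 2] by simp
  moreover have "Max I < 2 * k - 1" using Max_in[OF f False] assms(1) by auto
  ultimately show ?thesis by linarith
qed simp

text \<open>There is no slack. In the step, exactly one of the last two positions
  \<open>2k - 1\<close> and \<open>2k\<close> is taken, the earlier ones hold \<open>k\<close>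
  elements and are settled by induction, and \<open>2k - 1\<close> is ruled out by its
  predecessor.\<close>

lemma no_consecutive_evens:
  assumes "I \<subseteq> {..<2 * k - 1}" "\<forall>i\<in>I. Suc i \<notin> I" "card I = k"
  shows "I = (\<lambda>i. 2 * i) ` {..<k}"
proof -
  have "(\<lambda>i. 2 * i) ` {..<k} \<subseteq> I"
    using assms
  proof (induction k arbitrary: I)
    case (Suc k)
    let ?I = "I \<inter> {..<2 * k - 1}"
    have f: "finite I" using Suc.prems(1) finite_subset by blast
    have c1: "card ?I \<le> k" using card_no_consecutive_le[of ?I k] Suc.prems(2) by auto
    have "I - ?I \<subseteq> {2 * k - 1, 2 * k}" using Suc.prems(1) by auto
    moreover have "\<not> (2 * k - 1 \<in> I \<and> 2 * k \<in> I \<and> k > 0)"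
      using Suc.prems(2) by (metis Suc_pred' mult_pos_pos zero_less_numeral)
    ultimately have "I - ?I \<subseteq> {2 * k} \<or> I - ?I \<subseteq> {2 * k - 1}" by (cases "k > 0") auto
    then have "card (I - ?I) \<le> 1" using card_mono[of "{_}" "I - ?I"] by fastforce
    moreover have "card I = card ?I + card (I - ?I)" using f
      by (metis Int_lower1 card_Diff_subset card_mono finite_Int le_add_diff_inverse)
    ultimately have c: "card ?I = k" "card (I - ?I) = 1" using c1 Suc.prems(3) by auto
    have ev: "(\<lambda>i. 2 * i) ` {..<k} \<subseteq> ?I" using Suc.IH[of ?I] Suc.prems c by auto
    have "2 * k - 1 \<notin> I - ?I" if "k > 0"
    proof -
      have "2 * (k - 1) \<in> I" using ev that by auto
      moreover have "Suc (2 * (k - 1)) = 2 * k - 1" using that by auto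
      ultimately show ?thesis using Suc.prems(2) by auto
    qed
    then have "I - ?I \<subseteq> {2 * k}" using \<open>I - ?I \<subseteq> {2 * k - 1, 2 * k}\<close> by (cases "k > 0") auto
    then have "2 * k \<in> I" using c(2) by (metis DiffD1 card.empty subset_singletonD insertI1 zero_neq_one)
    then show ?case using ev by (auto simp: lessThan_Suc)
  qed simp
  moreover have "card ((\<lambda>i. 2 * i) ` {..<k}) = k" by (subst card_image) (auto simp: inj_on_def)
  moreover have "finite I" using assms(1) finite_subset by blast
  ultimately show ?thesis using assms(3) card_subset_eq by metis
qed

context longest_cycle_graph
begin

text \<open>Neighbours of \<open>v\<close> are never consecutive on the cycle, so \<open>k\<close>
  of them leave gaps of one vertex each, except for a single gap of two vertices if \<open>c\<close>
  is odd. The rotation puts that gap at the end as \<open>X\<close>; for even \<open>c\<close>,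
  \<open>X\<close> is a gap like the others.\<close>

lemma exists_alternating_rotation:
  assumes k: "k = length C div 2" "k \<ge> 2"
    and v: "v \<in> verts G" "v \<notin> set C" "{b. adj G v b} \<subseteq> set C" "card {b. adj G v b} = k"
  obtains S X where "longest_cycle G (S @ X)" "set (S @ X) = set C" "length (S @ X) = length C"
    "length S = 2 * k - 1" "{b. adj G v b} = (\<lambda>i. S ! (2 * i)) ` {..<k}"
proof -
  let ?c = "length C"
  let ?N = "{b. adj G v b}"
  have c3: "?c \<ge> 3" using C_facts by simp
  then have Cne: "C \<noteq> []" by auto
  have rot: "longest_cycle G (rotate p C)" "set (rotate p C) = set C" for p
    using longest_cycle_rotate[of G "take (p mod ?c) C" "drop (p mod ?c) C"] longest
    by (auto simp: rotate_drop_take[of p C, symmetric])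
  have ear: "ear a [v] b" if "a \<in> ?N" "b \<in> ?N" for a b
    using that v by (auto simp: ear_def gpath_def adj_sym)
  have consec: "rotate p C ! Suc i \<notin> ?N" if "rotate p C ! i \<in> ?N" "Suc i < ?c" for p i
    using ear_gap(1)[OF rot, of i "Suc i" p "[v]"] that ear by force
  have wrap: "rotate p C ! (?c - 1) \<notin> ?N" if "rotate p C ! 0 \<in> ?N" for p
    using ear_gap(2)[OF rot, of 0 "?c - 1" p "[v]"] that ear c3 by force
  have rn: "rotate p C ! i = C ! ((p + i) mod ?c)" if "i < ?c" for p i
    using that by (simp add: nth_rotate)
  have ne: "?N \<noteq> {}" using v(4) k(2) by (metis card.empty not_numeral_le_zero)
  then obtain p0 where p0: "p0 < ?c" "C ! p0 \<in> ?N"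
    using v(3) by (metis (no_types, lifting) all_not_in_conv in_set_conv_nth subsetD)
  \<comment> \<open>For odd \<open>c\<close> the start must lie just after the long gap. If two
    steps back from every neighbour of \<open>v\<close> there were again a neighbour,
    \<open>k\<close> such steps would lead from \<open>p0\<close> to its successor, as
    \<open>k(c - 2)\<close> is 1 modulo \<open>c = 2k + 1\<close>.\<close>
  have "\<exists>p. rotate p C ! 0 \<in> ?N \<and> (odd ?c \<longrightarrow> rotate p C ! (?c - 2) \<notin> ?N)"
  proof (rule ccontr)
    assume "\<not> ?thesis"
    moreover have r0: "rotate p0 C ! 0 \<in> ?N" using p0 Cne rn[of 0 p0] by simp
    ultimately have oddc: "odd ?c" and bk: "\<And>p. rotate p C ! 0 \<in> ?N \<Longrightarrow> rotate p C ! (?c - 2) \<in> ?N"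
      using p0 r0 by auto
    have ck: "?c = 2 * k + 1" using oddc k by presburger
    have it: "C ! ((p0 + m * (?c - 2)) mod ?c) \<in> ?N" for m
    proof (induction m)
      case 0 then show ?case using p0 by simp
    next
      case (Suc m)
      then have "rotate (p0 + m * (?c - 2)) C ! (?c - 2) \<in> ?N"
        using bk[of "p0 + m * (?c - 2)"] rn[of 0] c3 Cne by simp
      then show ?case using rn[of "?c - 2" "p0 + m * (?c - 2)"] c3 Cne
        by (simp add: add.assoc add.commute[of "?c - 2"])
    qed
    have "k * (?c - 2) = (k - 1) * ?c + 1"
      using k(2) unfolding ck by (cases k) (auto simp: algebra_simps)
    then have "(p0 + k * (?c - 2)) mod ?c = (p0 + 1) mod ?c"
      by (metis add.assoc add.commute mod_mult_self1)
    then have "rotate p0 C ! Suc 0 \<in> ?N" using it[of k] rn[of 1 p0] c3 Cne by simp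
    then show False using consec[of p0 0] rn[of 0 p0] p0 c3 Cne by auto
  qed
  then obtain p where p: "rotate p C ! 0 \<in> ?N" "odd ?c \<Longrightarrow> rotate p C ! (?c - 2) \<notin> ?N" by blast
  define L where "L = rotate p C"
  have L: "longest_cycle G L" "set L = set C" "length L = ?c" using rot by (auto simp: L_def)
  have dL: "distinct L" using L(1) by (simp add: longest_cycle_def is_cycle_def)
  define I where "I = {i. i < ?c \<and> L ! i \<in> ?N}"
  have I1: "I \<subseteq> {..<2 * k - 1}"
  proof
    fix i assume i: "i \<in> I"
    have "i \<noteq> ?c - 1" using i wrap[OF p(1)] by (auto simp: I_def L_def)
    moreover have "i \<noteq> ?c - 2" if "odd ?c" using i p(2)[OF that] by (auto simp: I_def L_def)
    moreover have "i < ?c" using i by (simp add: I_def)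
    ultimately show "i \<in> {..<2 * k - 1}" using k by (cases "odd ?c") (auto elim!: oddE evenE)
  qed
  have I2: "\<forall>i\<in>I. Suc i \<notin> I" using consec[of p] by (auto simp: I_def L_def)
  have im: "(\<lambda>i. L ! i) ` I = ?N"
  proof
    show "?N \<subseteq> (\<lambda>i. L ! i) ` I"
    proof
      fix b assume b: "b \<in> ?N"
      then have "b \<in> set L" using v(3) L(2) by blast
      then obtain i where "i < ?c" "L ! i = b" using L(3) by (auto simp: in_set_conv_nth)
      then show "b \<in> (\<lambda>i. L ! i) ` I" using b by (auto simp: I_def)
    qed
  qed (auto simp: I_def)
  have "inj_on (\<lambda>i. L ! i) I" using dL L(3) by (auto simp: I_def inj_on_def nth_eq_iff_index_eq)
  then have "card I = k" using im v(4) card_image[of "\<lambda>i. L ! i" I] by simp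
  then have I: "I = (\<lambda>i. 2 * i) ` {..<k}" using no_consecutive_evens[OF I1 I2] by blast
  have "?N = (\<lambda>i. take (2 * k - 1) L ! (2 * i)) ` {..<k}"
    unfolding im[symmetric] I image_image by (intro image_cong) auto
  moreover have "length (take (2 * k - 1) L) = 2 * k - 1" using L(3) k by simp
  ultimately show thesis
    using that[of "take (2 * k - 1) L" "drop (2 * k - 1) L"] L by simp
qed

end

text \<open>Here \<open>m = 2k - 2\<close>. The gap \<open>X\<close> is kept apart even if it has
  only one vertex, so that both parities share the rerouting lemmas. As a locale, the configuration
  can be interpreted again for another cycle with the same \<open>v\<close>.\<close>

locale alternating_cycle = two_connected_graph +
  fixes m :: nat and S X :: "'a list" and v :: 'a
  assumes m: "even m" "m \<ge> 2" and lS: "length S = Suc m" and lX: "X \<noteq> []" "length X \<le> 2"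
    and lc: "longest_cycle G (S @ X)"
    and v: "v \<in> verts G" "v \<notin> set (S @ X)" and nv: "{b. adj G v b} = {S ! i | i. i \<le> m \<and> even i}"

sublocale alternating_cycle \<subseteq> longest_cycle_graph G "S @ X"
  by unfold_locales (rule lc)

context alternating_cycle
begin

definition A where "A = {S ! i | i. i \<le> m \<and> even i}"
definition B where "B = insert v {S ! i | i. i \<le> m \<and> odd i}"
definition seg where "seg i j = drop i (take (Suc j) S)"

lemma dS: "distinct S" "distinct X" "set S \<inter> set X = {}" "set S \<subseteq> verts G" "set X \<subseteq> verts G"
  "successively (adj G) S" "successively (adj G) X" "adj G (last S) (hd X)" "adj G (last X) (hd S)" "S \<noteq> []"
proof -
  show "S \<noteq> []" using lS by auto
  then show "distinct S" "distinct X" "set S \<inter> set X = {}" "set S \<subseteq> verts G" "set X \<subseteq> verts G"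
    "successively (adj G) S" "successively (adj G) X" "adj G (last S) (hd X)" "adj G (last X) (hd S)"
    using C_facts lX(1) by (auto simp: successively_append_iff)
qed

lemma dX: "adj G (S ! m) (hd X)" "adj G (hd X) (S ! m)" "adj G (last X) (S ! 0)" "adj G (S ! 0) (last X)"
  using dS(8-10) lS by (auto simp: last_conv_nth hd_conv_nth adj_sym)

lemma S_eq: "i \<le> m \<Longrightarrow> j \<le> m \<Longrightarrow> S ! i = S ! j \<longleftrightarrow> i = j"
  using dS(1) lS by (simp add: nth_eq_iff_index_eq)

lemma in_A: "i \<le> m \<Longrightarrow> S ! i \<in> A \<longleftrightarrow> even i"
  using S_eq by (fastforce simp: A_def)

lemma adj_v: "adj G v b \<longleftrightarrow> b \<in> A"
  using nv by (auto simp: A_def)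

lemma adj_v_S: "i \<le> m \<Longrightarrow> even i \<Longrightarrow> adj G v (S ! i)" "i \<le> m \<Longrightarrow> even i \<Longrightarrow> adj G (S ! i) v"
  using adj_v in_A adj_sym by metis+

lemma S_cases: "a \<in> set S \<Longrightarrow> \<exists>i\<le>m. a = S ! i"
  using lS by (auto simp: in_set_conv_nth less_Suc_eq_le)

lemma A_cases: "a \<in> A \<Longrightarrow> \<exists>i\<le>m. even i \<and> a = S ! i"
  by (auto simp: A_def)

lemma A_S: "A \<subseteq> set S" using lS by (auto simp: A_def)

lemma seg_facts:
  assumes "i \<le> j" "j \<le> m"
  shows "seg i j \<noteq> []" "hd (seg i j) = S ! i" "last (seg i j) = S ! j" "length (seg i j) = Suc j - i"
    "successively (adj G) (seg i j)" "distinct (seg i j)"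
proof -
  show "seg i j \<noteq> []" "hd (seg i j) = S ! i" "length (seg i j) = Suc j - i" "distinct (seg i j)"
    using assms lS dS(1) by (auto simp: seg_def hd_drop_conv_nth)
  show "last (seg i j) = S ! j" using assms lS by (auto simp: seg_def take_Suc_conv_app_nth)
  have "successively (adj G) (take (Suc j) S)"
    using dS(6) successively_append_iff[of "adj G" "take (Suc j) S" "drop (Suc j) S"]
    unfolding append_take_drop_id by blast
  then show "successively (adj G) (seg i j)"
    using successively_append_iff[of "adj G" "take i (take (Suc j) S)" "seg i j"]
    unfolding seg_def append_take_drop_id by blast
qed

lemma seg_disjoint:
  "set (seg i j) \<inter> set X = {}" "set X \<inter> set (seg i j) = {}" "v \<notin> set (seg i j)" "set (seg i j) \<subseteq> verts G"
  "set D \<inter> set S = {} \<Longrightarrow> set D \<inter> set (seg i j) = {}"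
proof -
  have "set (seg i j) \<subseteq> set S" unfolding seg_def by (meson in_set_dropD in_set_takeD subsetI)
  then show "set (seg i j) \<inter> set X = {}" "set X \<inter> set (seg i j) = {}" "v \<notin> set (seg i j)" "set (seg i j) \<subseteq> verts G"
    "set D \<inter> set S = {} \<Longrightarrow> set D \<inter> set (seg i j) = {}"
    using dS v by auto
qed

lemma seg_seg_disjoint:
  assumes "j < i' \<or> j' < i"
  shows "set (seg i j) \<inter> set (seg i' j') = {}"
proof -
  have *: "set (seg i j) \<inter> set (seg i' j') = {}" if "j < i'" for i j i' j'
  proof -
    have "Suc j \<le> i'" using that by simp
    with dS(1) have "set (take (Suc j) S) \<inter> set (drop i' S) = {}"
      by (rule set_take_disj_set_drop_if_distinct)
    moreover have "set (seg i j) \<subseteq> set (take (Suc j) S)" unfolding seg_def by (rule set_drop_subset)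
    moreover have "set (seg i' j') \<subseteq> set (drop i' S)" unfolding seg_def drop_take by (rule set_take_subset)
    ultimately show ?thesis by blast
  qed
  show ?thesis using assms *[of j i' i j'] *[of j' i i' j] by auto
qed

section \<open>Reroutings of the cycle through \<open>v\<close>\<close>

text \<open>The interior \<open>D\<close> of a link may be empty; a link is then a single edge.\<close>

definition link :: "'a \<Rightarrow> 'a list \<Rightarrow> 'a \<Rightarrow> bool" where
  "link p D q \<longleftrightarrow> distinct D \<and> set D \<subseteq> verts G \<and> successively (adj G) (p # D @ [q])"

lemma link_sym: "link p D q \<Longrightarrow> link q (rev D) p"
proof -
  assume l: "link p D q"
  have "q # rev D @ [p] = rev (p # D @ [q])" by simp
  then show ?thesis using l unfolding link_def by (metis distinct_rev set_rev successively_adj_swap successively_rev)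
qed

text \<open>\<open>L\<close> is a path from \<open>q\<close> to \<open>p\<close> that
  \<open>D\<close> closes to a cycle. Each of the following lemmas exhibits such an
  \<open>L\<close>: it runs over most of \<open>S @ X\<close>, as a rule reconnecting two pieces
  through \<open>v\<close>, and comparing its length with that of the cycle bounds
  \<open>D\<close>.\<close>

lemma link_bound:
  assumes l: "link p D q" and L: "hd L = q" "last L = p" "distinct L" "set L \<subseteq> verts G"
    "successively (adj G) L" "length L \<ge> 3" and D: "set D \<inter> set L = {}"
  shows "length L + length D \<le> Suc m + length X"
proof -
  have ne: "L \<noteq> []" using L by auto
  have "is_cycle G (L @ D)"
    using l L D ne unfolding is_cycle_iff link_def
    by (cases "D = []") (auto simp: successively_append_iff successively_Cons hd_append)
  from cycle_le[OF this] show ?thesis using lS by simp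
qed

text \<open>The positions after \<open>p\<close> and \<open>q\<close> are even, so \<open>v\<close>
  joins them. \<open>L\<close> misses nothing of the cycle and gains \<open>v\<close>: too long even
  for \<open>D = []\<close>. The same count works in the next two lemmas, where an end of
  \<open>X\<close> replaces an odd vertex.\<close>

lemma no_link_odd_odd:
  assumes link: "link (S ! p) D (S ! q)"
    and pq: "odd p" "odd q" "p < q" "q \<le> m"
    and D: "set D \<inter> set S = {}" "set D \<inter> set X = {}" "v \<notin> set D"
  shows "False"
proof -
  have q: "Suc p \<le> q" "Suc q \<le> m" "0 \<le> p" "q \<le> m" "m \<le> m" "p \<le> m"
    using pq m by presburger+
  let ?L = "rev (seg (Suc p) q) @ [v] @ seg (Suc q) m @ X @ seg 0 p"
  note f = seg_facts[OF q(1) q(4)] seg_facts[OF q(2) q(5)] seg_facts[OF q(3) q(6)]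
  have d: "set (seg (Suc p) q) \<inter> set (seg (Suc q) m) = {}" "set (seg (Suc q) m) \<inter> set (seg (Suc p) q) = {}" "set (seg (Suc p) q) \<inter> set (seg 0 p) = {}" "set (seg 0 p) \<inter> set (seg (Suc p) q) = {}" "set (seg (Suc q) m) \<inter> set (seg 0 p) = {}" "set (seg 0 p) \<inter> set (seg (Suc q) m) = {}"
    using q pq by (auto intro!: seg_seg_disjoint)
  have "length ?L + length D \<le> Suc m + length X"
  proof (rule link_bound[OF link])
    show "successively (adj G) ?L"
      using q pq m adj_v_S[of "Suc p"] adj_v_S[of "Suc q"]
      by (simp add: successively_append_iff successively_Cons f lX dS(7) dX last_rev hd_rev hd_append)
    show "distinct ?L" using v by (simp add: f d dS seg_disjoint Int_Un_distrib)
    show "hd ?L = S ! q" "last ?L = S ! p" "set ?L \<subseteq> verts G" "3 \<le> length ?L" "set D \<inter> set ?L = {}"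
      using v D q pq m by (simp_all add: f dS lX seg_disjoint hd_append hd_rev last_rev Int_Un_distrib)
  qed
  then show ?thesis using q pq lX m by (cases D) (auto simp: f)
qed

lemma no_link_odd_hd:
  assumes link: "link (S ! Suc p) D (hd X)"
    and pq: "even p" "Suc p \<le> m"
    and D: "set D \<inter> set S = {}" "set D \<inter> set X = {}" "v \<notin> set D"
  shows "False"
proof -
  have q: "0 \<le> p" "Suc p \<le> m" "p \<le> m" "m \<le> m"
    using pq m by presburger+
  let ?L = "X @ seg 0 p @ [v] @ rev (seg (Suc p) m)"
  note f = seg_facts[OF q(1) q(3)] seg_facts[OF q(2) q(4)]
  have d: "set (seg 0 p) \<inter> set (seg (Suc p) m) = {}" "set (seg (Suc p) m) \<inter> set (seg 0 p) = {}"
    using q pq by (auto intro!: seg_seg_disjoint)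
  have "length ?L + length D \<le> Suc m + length X"
  proof (rule link_bound[OF link])
    show "successively (adj G) ?L"
      using q pq m adj_v_S[of "p"] adj_v_S[of "m"]
      by (simp add: successively_append_iff successively_Cons f lX dS(7) dX last_rev hd_rev hd_append)
    show "distinct ?L" using v by (simp add: f d dS seg_disjoint Int_Un_distrib)
    show "hd ?L = hd X" "last ?L = S ! Suc p" "set ?L \<subseteq> verts G" "3 \<le> length ?L" "set D \<inter> set ?L = {}"
      using v D q pq m by (simp_all add: f dS lX seg_disjoint hd_append hd_rev last_rev Int_Un_distrib)
  qed
  then show ?thesis using q pq lX m by (cases D) (auto simp: f)
qed

lemma no_link_odd_last:
  assumes link: "link (S ! p) D (last X)"
    and pq: "odd p" "p \<le> m"
    and D: "set D \<inter> set S = {}" "set D \<inter> set X = {}" "v \<notin> set D"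
  shows "False"
proof -
  have q: "Suc p \<le> m" "0 \<le> p" "m \<le> m" "p \<le> m"
    using pq m by presburger+
  let ?L = "rev X @ rev (seg (Suc p) m) @ [v] @ seg 0 p"
  note f = seg_facts[OF q(1) q(3)] seg_facts[OF q(2) q(4)]
  have d: "set (seg (Suc p) m) \<inter> set (seg 0 p) = {}" "set (seg 0 p) \<inter> set (seg (Suc p) m) = {}"
    using q pq by (auto intro!: seg_seg_disjoint)
  have "length ?L + length D \<le> Suc m + length X"
  proof (rule link_bound[OF link])
    show "successively (adj G) ?L"
      using q pq m adj_v_S[of "Suc p"] adj_v_S[of "0"]
      by (simp add: successively_append_iff successively_Cons f lX dS(7) dX last_rev hd_rev hd_append)
    show "distinct ?L" using v by (simp add: f d dS seg_disjoint Int_Un_distrib)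
    show "hd ?L = last X" "last ?L = S ! p" "set ?L \<subseteq> verts G" "3 \<le> length ?L" "set D \<inter> set ?L = {}"
      using v D q pq m by (simp_all add: f dS lX seg_disjoint hd_append hd_rev last_rev Int_Un_distrib)
  qed
  then show ?thesis using q pq lX m by (cases D) (auto simp: f)
qed

text \<open>\<open>L\<close> gains \<open>v\<close> and misses only position \<open>q + 1\<close>,
  so it is as long as the cycle, and a nonempty \<open>D\<close> makes it longer.\<close>

lemma no_link_odd_even1:
  assumes link: "link (S ! p) D (S ! q)"
    and pq: "odd p" "p \<le> m" "even q" "Suc q < p" "D \<noteq> []"
    and D: "set D \<inter> set S = {}" "set D \<inter> set X = {}" "v \<notin> set D"
  shows "False"
proof -
  have q: "0 \<le> q" "Suc p \<le> m" "Suc (Suc q) \<le> p" "q \<le> m" "m \<le> m" "p \<le> m"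
    using pq m by presburger+
  let ?L = "rev (seg 0 q) @ rev X @ rev (seg (Suc p) m) @ [v] @ seg (Suc (Suc q)) p"
  note f = seg_facts[OF q(1) q(4)] seg_facts[OF q(2) q(5)] seg_facts[OF q(3) q(6)]
  have d: "set (seg 0 q) \<inter> set (seg (Suc p) m) = {}" "set (seg (Suc p) m) \<inter> set (seg 0 q) = {}" "set (seg 0 q) \<inter> set (seg (Suc (Suc q)) p) = {}" "set (seg (Suc (Suc q)) p) \<inter> set (seg 0 q) = {}" "set (seg (Suc p) m) \<inter> set (seg (Suc (Suc q)) p) = {}" "set (seg (Suc (Suc q)) p) \<inter> set (seg (Suc p) m) = {}"
    using q pq by (auto intro!: seg_seg_disjoint)
  have "length ?L + length D \<le> Suc m + length X"
  proof (rule link_bound[OF link])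
    show "successively (adj G) ?L"
      using q pq m adj_v_S[of "Suc p"] adj_v_S[of "Suc (Suc q)"]
      by (simp add: successively_append_iff successively_Cons f lX dS(7) dX last_rev hd_rev hd_append)
    show "distinct ?L" using v by (simp add: f d dS seg_disjoint Int_Un_distrib)
    show "hd ?L = S ! q" "last ?L = S ! p" "set ?L \<subseteq> verts G" "3 \<le> length ?L" "set D \<inter> set ?L = {}"
      using v D q pq m by (simp_all add: f dS lX seg_disjoint hd_append hd_rev last_rev Int_Un_distrib)
  qed
  then show ?thesis using q pq lX m by (cases D) (auto simp: f)
qed

text \<open>The ends are consecutive on the cycle, so \<open>D\<close> can be inserted into their
  edge; likewise in the next lemma.\<close>

lemma no_link_odd_even2:
  assumes link: "link (S ! Suc q) D (S ! q)"
    and pq: "Suc q \<le> m" "even q" "D \<noteq> []"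
    and D: "set D \<inter> set S = {}" "set D \<inter> set X = {}" "v \<notin> set D"
  shows "False"
proof -
  have q: "0 \<le> q" "Suc q \<le> m" "q \<le> m" "m \<le> m"
    using pq m by presburger+
  let ?L = "rev (seg 0 q) @ rev X @ rev (seg (Suc q) m)"
  note f = seg_facts[OF q(1) q(3)] seg_facts[OF q(2) q(4)]
  have d: "set (seg 0 q) \<inter> set (seg (Suc q) m) = {}" "set (seg (Suc q) m) \<inter> set (seg 0 q) = {}"
    using q pq by (auto intro!: seg_seg_disjoint)
  have "length ?L + length D \<le> Suc m + length X"
  proof (rule link_bound[OF link])
    show "successively (adj G) ?L"
      using q pq m
      by (simp add: successively_append_iff successively_Cons f lX dS(7) dX last_rev hd_rev hd_append)
    show "distinct ?L" using v by (simp add: f d dS seg_disjoint Int_Un_distrib)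
    show "hd ?L = S ! q" "last ?L = S ! Suc q" "set ?L \<subseteq> verts G" "3 \<le> length ?L" "set D \<inter> set ?L = {}"
      using v D q pq m by (simp_all add: f dS lX seg_disjoint hd_append hd_rev last_rev Int_Un_distrib)
  qed
  then show ?thesis using q pq lX m by (cases D) (auto simp: f)
qed

lemma no_link_odd_even3:
  assumes link: "link (S ! p) D (S ! Suc p)"
    and pq: "odd p" "Suc p \<le> m" "D \<noteq> []"
    and D: "set D \<inter> set S = {}" "set D \<inter> set X = {}" "v \<notin> set D"
  shows "False"
proof -
  have q: "Suc p \<le> m" "0 \<le> p" "m \<le> m" "p \<le> m"
    using pq m by presburger+
  let ?L = "seg (Suc p) m @ X @ seg 0 p"
  note f = seg_facts[OF q(1) q(3)] seg_facts[OF q(2) q(4)]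
  have d: "set (seg (Suc p) m) \<inter> set (seg 0 p) = {}" "set (seg 0 p) \<inter> set (seg (Suc p) m) = {}"
    using q pq by (auto intro!: seg_seg_disjoint)
  have "length ?L + length D \<le> Suc m + length X"
  proof (rule link_bound[OF link])
    show "successively (adj G) ?L"
      using q pq m
      by (simp add: successively_append_iff successively_Cons f lX dS(7) dX last_rev hd_rev hd_append)
    show "distinct ?L" using v by (simp add: f d dS seg_disjoint Int_Un_distrib)
    show "hd ?L = S ! Suc p" "last ?L = S ! p" "set ?L \<subseteq> verts G" "3 \<le> length ?L" "set D \<inter> set ?L = {}"
      using v D q pq m by (simp_all add: f dS lX seg_disjoint hd_append hd_rev last_rev Int_Un_distrib)
  qed
  then show ?thesis using q pq lX m by (cases D) (auto simp: f)
qed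

text \<open>Mirror image of \<open>no_link_odd_even1\<close>, for an even vertex after the odd one:
  only position \<open>r + 1\<close> is missed.\<close>

lemma no_link_odd_even4:
  assumes link: "link (S ! Suc p) D (S ! Suc (Suc r))"
    and pq: "even p" "Suc (Suc r) \<le> m" "even r" "p < r" "D \<noteq> []"
    and D: "set D \<inter> set S = {}" "set D \<inter> set X = {}" "v \<notin> set D"
  shows "False"
proof -
  have q: "Suc (Suc r) \<le> m" "0 \<le> p" "Suc p \<le> r" "m \<le> m" "p \<le> m" "r \<le> m"
    using pq m by presburger+
  let ?L = "seg (Suc (Suc r)) m @ X @ seg 0 p @ [v] @ rev (seg (Suc p) r)"
  note f = seg_facts[OF q(1) q(4)] seg_facts[OF q(2) q(5)] seg_facts[OF q(3) q(6)]
  have d: "set (seg (Suc (Suc r)) m) \<inter> set (seg 0 p) = {}" "set (seg 0 p) \<inter> set (seg (Suc (Suc r)) m) = {}" "set (seg (Suc (Suc r)) m) \<inter> set (seg (Suc p) r) = {}" "set (seg (Suc p) r) \<inter> set (seg (Suc (Suc r)) m) = {}" "set (seg 0 p) \<inter> set (seg (Suc p) r) = {}" "set (seg (Suc p) r) \<inter> set (seg 0 p) = {}"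
    using q pq by (auto intro!: seg_seg_disjoint)
  have "length ?L + length D \<le> Suc m + length X"
  proof (rule link_bound[OF link])
    show "successively (adj G) ?L"
      using q pq m adj_v_S[of "p"] adj_v_S[of "r"]
      by (simp add: successively_append_iff successively_Cons f lX dS(7) dX last_rev hd_rev hd_append)
    show "distinct ?L" using v by (simp add: f d dS seg_disjoint Int_Un_distrib)
    show "hd ?L = S ! Suc (Suc r)" "last ?L = S ! Suc p" "set ?L \<subseteq> verts G" "3 \<le> length ?L" "set D \<inter> set ?L = {}"
      using v D q pq m by (simp_all add: f dS lX seg_disjoint hd_append hd_rev last_rev Int_Un_distrib)
  qed
  then show ?thesis using q pq lX m by (cases D) (auto simp: f)
qed

text \<open>\<open>L\<close> gains \<open>v\<close> and misses \<open>p + 1\<close> and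
  \<open>q + 1\<close>, so one vertex is left for \<open>D\<close>. The next lemma is the mirror
  image; together they cover all pairs of even positions except \<open>0\<close> and
  \<open>m\<close>, where either rerouting would pass an end of \<open>S\<close>.\<close>

lemma link_even_even1:
  assumes link: "link (S ! q) D (S ! p)"
    and pq: "even p" "Suc q < m" "even q" "p < q"
    and D: "set D \<inter> set S = {}" "set D \<inter> set X = {}" "v \<notin> set D"
  shows "length D \<le> 1"
proof -
  have q: "0 \<le> p" "Suc (Suc q) \<le> m" "Suc (Suc p) \<le> q" "p \<le> m" "m \<le> m" "q \<le> m"
    using pq m by presburger+
  let ?L = "rev (seg 0 p) @ rev X @ rev (seg (Suc (Suc q)) m) @ [v] @ seg (Suc (Suc p)) q"
  note f = seg_facts[OF q(1) q(4)] seg_facts[OF q(2) q(5)] seg_facts[OF q(3) q(6)]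
  have d: "set (seg 0 p) \<inter> set (seg (Suc (Suc q)) m) = {}" "set (seg (Suc (Suc q)) m) \<inter> set (seg 0 p) = {}" "set (seg 0 p) \<inter> set (seg (Suc (Suc p)) q) = {}" "set (seg (Suc (Suc p)) q) \<inter> set (seg 0 p) = {}" "set (seg (Suc (Suc q)) m) \<inter> set (seg (Suc (Suc p)) q) = {}" "set (seg (Suc (Suc p)) q) \<inter> set (seg (Suc (Suc q)) m) = {}"
    using q pq by (auto intro!: seg_seg_disjoint)
  have "length ?L + length D \<le> Suc m + length X"
  proof (rule link_bound[OF link])
    show "successively (adj G) ?L"
      using q pq m adj_v_S[of "Suc (Suc q)"] adj_v_S[of "Suc (Suc p)"]
      by (simp add: successively_append_iff successively_Cons f lX dS(7) dX last_rev hd_rev hd_append)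
    show "distinct ?L" using v by (simp add: f d dS seg_disjoint Int_Un_distrib)
    show "hd ?L = S ! p" "last ?L = S ! q" "set ?L \<subseteq> verts G" "3 \<le> length ?L" "set D \<inter> set ?L = {}"
      using v D q pq m by (simp_all add: f dS lX seg_disjoint hd_append hd_rev last_rev Int_Un_distrib)
  qed
  then show ?thesis using q pq lX m by (simp add: f)
qed

lemma link_even_even2:
  assumes link: "link (S ! Suc (Suc p)) D (S ! Suc (Suc r))"
    and pq: "even p" "Suc (Suc r) \<le> m" "even r" "p < r"
    and D: "set D \<inter> set S = {}" "set D \<inter> set X = {}" "v \<notin> set D"
  shows "length D \<le> 1"
proof -
  have q: "Suc (Suc r) \<le> m" "0 \<le> p" "Suc (Suc p) \<le> r" "m \<le> m" "p \<le> m" "r \<le> m"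
    using pq m by presburger+
  let ?L = "seg (Suc (Suc r)) m @ X @ seg 0 p @ [v] @ rev (seg (Suc (Suc p)) r)"
  note f = seg_facts[OF q(1) q(4)] seg_facts[OF q(2) q(5)] seg_facts[OF q(3) q(6)]
  have d: "set (seg (Suc (Suc r)) m) \<inter> set (seg 0 p) = {}" "set (seg 0 p) \<inter> set (seg (Suc (Suc r)) m) = {}" "set (seg (Suc (Suc r)) m) \<inter> set (seg (Suc (Suc p)) r) = {}" "set (seg (Suc (Suc p)) r) \<inter> set (seg (Suc (Suc r)) m) = {}" "set (seg 0 p) \<inter> set (seg (Suc (Suc p)) r) = {}" "set (seg (Suc (Suc p)) r) \<inter> set (seg 0 p) = {}"
    using q pq by (auto intro!: seg_seg_disjoint)
  have "length ?L + length D \<le> Suc m + length X"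
  proof (rule link_bound[OF link])
    show "successively (adj G) ?L"
      using q pq m adj_v_S[of "p"] adj_v_S[of "r"]
      by (simp add: successively_append_iff successively_Cons f lX dS(7) dX last_rev hd_rev hd_append)
    show "distinct ?L" using v by (simp add: f d dS seg_disjoint Int_Un_distrib)
    show "hd ?L = S ! Suc (Suc r)" "last ?L = S ! Suc (Suc p)" "set ?L \<subseteq> verts G" "3 \<le> length ?L" "set D \<inter> set ?L = {}"
      using v D q pq m by (simp_all add: f dS lX seg_disjoint hd_append hd_rev last_rev Int_Un_distrib)
  qed
  then show ?thesis using q pq lX m by (simp add: f)
qed

text \<open>\<open>L\<close> gains \<open>v\<close> and leaves out position \<open>r + 1\<close> and
  the whole gap \<open>X\<close>. Hence \<open>D\<close> may pass through \<open>X\<close>, and its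
  bound is \<open>length X\<close>.\<close>

lemma link_even_first:
  assumes link: "link (S ! Suc (Suc r)) D (S ! 0)"
    and pq: "even r" "Suc (Suc r) \<le> m"
    and D: "set D \<inter> set S = {}" "v \<notin> set D"
  shows "length D \<le> length X"
proof -
  have q: "0 \<le> r" "Suc (Suc r) \<le> m" "r \<le> m" "m \<le> m"
    using pq m by presburger+
  let ?L = "seg 0 r @ [v] @ rev (seg (Suc (Suc r)) m)"
  note f = seg_facts[OF q(1) q(3)] seg_facts[OF q(2) q(4)]
  have d: "set (seg 0 r) \<inter> set (seg (Suc (Suc r)) m) = {}" "set (seg (Suc (Suc r)) m) \<inter> set (seg 0 r) = {}"
    using q pq by (auto intro!: seg_seg_disjoint)
  have "length ?L + length D \<le> Suc m + length X"
  proof (rule link_bound[OF link])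
    show "successively (adj G) ?L"
      using q pq m adj_v_S[of "r"] adj_v_S[of "m"]
      by (simp add: successively_append_iff successively_Cons f lX dS(7) dX last_rev hd_rev hd_append)
    show "distinct ?L" using v by (simp add: f d dS seg_disjoint Int_Un_distrib)
    show "hd ?L = S ! 0" "last ?L = S ! Suc (Suc r)" "set ?L \<subseteq> verts G" "3 \<le> length ?L" "set D \<inter> set ?L = {}"
      using v D q pq m by (simp_all add: f dS lX seg_disjoint hd_append hd_rev last_rev Int_Un_distrib)
  qed
  then show ?thesis using q pq lX m by (simp add: f)
qed

lemma link_even_last:
  assumes link: "link (S ! q) D (S ! m)"
    and pq: "Suc q < m" "even q"
    and D: "set D \<inter> set S = {}" "v \<notin> set D"
  shows "length D \<le> length X"
proof -
  have q: "Suc (Suc q) \<le> m" "0 \<le> q" "m \<le> m" "q \<le> m"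
    using pq m by presburger+
  let ?L = "rev (seg (Suc (Suc q)) m) @ [v] @ seg 0 q"
  note f = seg_facts[OF q(1) q(3)] seg_facts[OF q(2) q(4)]
  have d: "set (seg (Suc (Suc q)) m) \<inter> set (seg 0 q) = {}" "set (seg 0 q) \<inter> set (seg (Suc (Suc q)) m) = {}"
    using q pq by (auto intro!: seg_seg_disjoint)
  have "length ?L + length D \<le> Suc m + length X"
  proof (rule link_bound[OF link])
    show "successively (adj G) ?L"
      using q pq m adj_v_S[of "Suc (Suc q)"] adj_v_S[of "0"]
      by (simp add: successively_append_iff successively_Cons f lX dS(7) dX last_rev hd_rev hd_append)
    show "distinct ?L" using v by (simp add: f d dS seg_disjoint Int_Un_distrib)
    show "hd ?L = S ! m" "last ?L = S ! q" "set ?L \<subseteq> verts G" "3 \<le> length ?L" "set D \<inter> set ?L = {}"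
      using v D q pq m by (simp_all add: f dS lX seg_disjoint hd_append hd_rev last_rev Int_Un_distrib)
  qed
  then show ?thesis using q pq lX m by (simp add: f)
qed

end

section \<open>Neighbours of the odd vertices and paths attached to \<open>A\<close>\<close>

lemma gpath_neighbour:
  assumes "gpath G P" "x \<in> set P" "length P \<ge> 2"
  shows "\<exists>y\<in>set P. adj G x y"
proof -
  obtain p1 p2 where P: "P = p1 @ x # p2" using split_list[OF assms(2)] by blast
  show ?thesis
  proof (cases p2)
    case Nil
    then have "p1 \<noteq> []" using assms(3) P by auto
    then have "adj G (last p1) x" "last p1 \<in> set P"
      using assms(1) P Nil by (auto simp: gpath_def successively_append_iff)
    then show ?thesis by (auto simp: adj_sym)
  next
    case (Cons y ys)
    then show ?thesis using assms(1) P by (auto simp: gpath_def successively_append_iff)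
  qed
qed

context alternating_cycle
begin

lemma X_cases: "s \<in> set X \<Longrightarrow> s = hd X \<or> s = last X"
  using lX by (cases X; cases "tl X"; cases "tl (tl X)") auto

lemma S_AB: "set S \<subseteq> A \<union> B" "v \<in> B" "A \<inter> B = {}" "set X \<inter> A = {}" "set X \<inter> B = {}" "A \<subseteq> verts G" "B \<subseteq> verts G"
proof -
  show "set S \<subseteq> A \<union> B" using S_cases by (fastforce simp: A_def B_def)
  show "v \<in> B" by (simp add: B_def)
  have "v \<notin> A" using v A_S by auto
  then show "A \<inter> B = {}" using in_A by (auto simp: B_def)
  show "set X \<inter> A = {}" using A_S dS by blast
  have BS: "B \<subseteq> insert v (set S)" using lS by (auto simp: B_def)
  then show "set X \<inter> B = {}" using dS v by auto
  show "A \<subseteq> verts G" using A_S dS by blast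
  show "B \<subseteq> verts G" using BS dS v by auto
qed

text \<open>Collects the cases by the position of \<open>s\<close>. The disjunction in the
  assumptions exempts the one permitted connection, an edge to \<open>A\<close>.\<close>

lemma no_link_odd:
  assumes l: "link (S ! p) D s" "odd p" "p \<le> m" and s: "s \<in> set (S @ X)" "s \<noteq> S ! p" "D \<noteq> [] \<or> s \<notin> A"
    and D: "set D \<inter> set S = {}" "set D \<inter> set X = {}" "v \<notin> set D"
  shows False
proof (cases "s \<in> set S")
  case True
  then obtain q where q: "q \<le> m" "s = S ! q" using S_cases by blast
  have pq: "p \<noteq> q" using q s by auto
  show False
  proof (cases "even q")
    case True
    then have Dne: "D \<noteq> []" using s(3) in_A q by auto
    note l' = l(1)[unfolded q(2)]
    obtain p' where p': "p = Suc p'" "even p'" using l(2) by (cases p) auto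
    consider "Suc q < p" | "p = Suc q" | "q = Suc p" | "Suc p < q" using pq by linarith
    then show False
    proof cases
      case 1 then show ?thesis using no_link_odd_even1[OF l' l(2,3) True 1 Dne D] by simp
    next
      case 2 then show ?thesis using no_link_odd_even2[of q D] l l' True Dne D by simp
    next
      case 3 then show ?thesis using no_link_odd_even3[of p D] l l' q Dne D by simp
    next
      case 4
      then obtain r where r: "q = Suc (Suc r)" by (metis Suc_lessE Suc_less_eq2 less_iff_Suc_add)
      have "p' < r" using 4 r p' by simp
      then show ?thesis using no_link_odd_even4[of p' D r] l' r p' q True Dne D by simp
    qed
  next
    case False
    then show False
      using no_link_odd_odd[of p D q] no_link_odd_odd[of q "rev D" p] link_sym[OF l(1)] l q pq D
      by (cases "p < q") auto
  qed
next
  case False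
  then have "s = hd X \<or> s = last X" using s X_cases by auto
  moreover obtain p' where p': "p = Suc p'" "even p'" using l(2) by (cases p) auto
  ultimately show False using no_link_odd_hd[of p' D] no_link_odd_last[of p D] l D by auto
qed

lemma path_off_cycle_v:
  assumes "gpath G D" "set D \<inter> set (S @ X) = {}" "v \<in> set D"
  shows "length D \<le> 1"
proof (rule ccontr)
  assume "\<not> ?thesis"
  then obtain y where "y \<in> set D" "adj G v y" using gpath_neighbour[OF assms(1,3)] by auto
  then show False using adj_v A_S assms(2) by auto
qed

text \<open>For \<open>v\<close> this is its defining property. For an odd vertex, a neighbour
  outside \<open>A\<close> contradicts \<open>no_link_odd\<close>: on the cycle it gives a link with
  empty interior, and off the cycle 2-connectivity continues it to a second vertex of the
  cycle.\<close>

lemma B_neighbours: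
  assumes b: "b \<in> B" "adj G b u"
  shows "u \<in> A"
proof (rule ccontr)
  assume uA: "u \<notin> A"
  have "b \<noteq> v" using adj_v b uA by auto
  then obtain p where p: "odd p" "p \<le> m" "b = S ! p" using b by (auto simp: B_def)
  have bA: "b \<notin> A" using in_A p by auto
  then have uv: "u \<noteq> v" using adj_v[of b] b adj_sym by metis
  have ub: "u \<noteq> b" "u \<in> verts G" using adj_verts[OF b(2)] by auto
  show False
  proof (cases "u \<in> set (S @ X)")
    case True
    have "link (S ! p) [] u" using b p by (simp add: link_def)
    then show False using no_link_odd[of p "[]" u] p True ub uA by auto
  next
    case False
    obtain D s where D: "gpath G D" "set D \<inter> set (S @ X) = {}" "hd D = u" "adj G (last D) s"
      "s \<in> set (S @ X)" "b \<notin> set D" "s \<noteq> b"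
      using exists_ear_from[of u b] False ub by metis
    have Dne: "D \<noteq> []" using D gpath_ne by blast
    have "v \<notin> set D"
    proof
      assume "v \<in> set D"
      then have "D = [v]" using path_off_cycle_v[OF D(1,2)] by (cases D; cases "tl D") auto
      then show False using D(3) uv by simp
    qed
    moreover have "link (S ! p) D s"
      using D Dne b p by (auto simp: link_def gpath_def successively_append_iff successively_Cons)
    ultimately show False using no_link_odd[of p D s] p D Dne by auto
  qed
qed

lemma edge_off_A: "adj G z z' \<Longrightarrow> z \<notin> A \<Longrightarrow> z' \<notin> A \<Longrightarrow> z \<notin> B \<and> z' \<notin> B"
  using B_neighbours adj_sym by metis

text \<open>Vertices of \<open>X\<close> are allowed on \<open>P\<close>; this is why the bounds
  below distinguish paths that avoid \<open>X\<close>.\<close>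

definition att :: "'a list \<Rightarrow> 'a \<Rightarrow> 'a \<Rightarrow> bool" where
  "att P a a' \<longleftrightarrow> gpath G P \<and> set P \<inter> A = {} \<and> set P \<inter> B = {} \<and> a \<in> A \<and> a' \<in> A \<and> a \<noteq> a' \<and>
     adj G a (hd P) \<and> adj G (last P) a'"

lemma att_rev: "att P a a' \<Longrightarrow> att (rev P) a' a"
  by (auto simp: att_def gpath_def hd_rev last_rev adj_sym)

lemma att_link: "att P a a' \<Longrightarrow> link a P a' \<and> set P \<inter> set S = {} \<and> v \<notin> set P"
  using S_AB by (auto simp: att_def link_def gpath_def successively_append_iff successively_Cons)

lemma att_end_le':
  assumes a: "att P a a'" "a' = S ! 0 \<or> a' = S ! m"
  shows "length P \<le> length X"
proof -
  have l: "link a P a'" "set P \<inter> set S = {}" "v \<notin> set P" using att_link[OF a(1)] by auto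
  obtain q where q: "q \<le> m" "even q" "a = S ! q" using a(1) A_cases by (auto simp: att_def)
  have ne: "a \<noteq> a'" using a(1) by (simp add: att_def)
  show ?thesis
  proof (cases "a' = S ! 0")
    case True
    then have "q \<noteq> 0" using ne q(3) by metis
    then obtain r where "q = Suc (Suc r)" using q(2) by (cases q; cases "q - 1") auto
    then show ?thesis using link_even_first[of r P] l q True by auto
  next
    case False
    then have "q < m" using a(2) ne q by (cases "q = m") auto
    then have "Suc q < m" using q(2) m by (metis Suc_lessI even_Suc)
    then show ?thesis using link_even_last[of q P] l q a(2) False by auto
  qed
qed

lemma att_end_le:
  assumes "att P a a'" "a \<in> {S ! 0, S ! m} \<or> a' \<in> {S ! 0, S ! m}"
  shows "length P \<le> length X"
  using att_end_le'[OF assms(1)] att_end_le'[OF att_rev[OF assms(1)]] assms(2) by auto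

text \<open>The rerouted cycles use \<open>X\<close>, so \<open>P\<close> has to avoid it; the two
  ends of \<open>S\<close> are the pair for which neither rerouting exists.\<close>

lemma att_off_X:
  assumes a: "att P a a'" "set P \<inter> set X = {}"
  shows "length P \<le> 1 \<or> {a, a'} = {S ! 0, S ! m}"
proof -
  have *: "length P \<le> 1 \<or> {a, a'} = {S ! 0, S ! m}"
    if a: "att P a a'" "set P \<inter> set X = {}" and ij: "i < j" "j \<le> m" "even i" "even j" "a = S ! i" "a' = S ! j" for P a a' i j
  proof (cases "j < m")
    case True
    then have "Suc j < m" using ij m by (metis Suc_lessI even_Suc)
    then show ?thesis
      using link_even_even1[of j "rev P" i] link_sym[of a P a'] att_link[OF a(1)] a(2) ij by auto
  next
    case False
    then have jm: "j = m" using ij by simp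
    show ?thesis
    proof (cases "i = 0")
      case True then show ?thesis using ij jm by auto
    next
      case False
      then obtain p where p: "i = Suc (Suc p)" using ij(3) by (cases i; cases "i - 1") auto
      then obtain r where r: "j = Suc (Suc r)" using ij(1) by (metis Suc_lessE)
      show ?thesis
        using link_even_even2[of p P r] att_link[OF a(1)] a(2) ij p r by auto
    qed
  qed
  obtain i where i: "i \<le> m" "even i" "a = S ! i" using a(1) A_cases by (auto simp: att_def)
  obtain j where j: "j \<le> m" "even j" "a' = S ! j" using a(1) A_cases by (auto simp: att_def)
  have "i \<noteq> j" using a(1) i j by (auto simp: att_def)
  then consider "i < j" | "j < i" by linarith
  then show ?thesis
  proof cases
    case 1 then show ?thesis using *[OF a 1] i j by blast
  next
    case 2
    then show ?thesis using *[OF att_rev[OF a(1)] _ 2] a(2) i j by (auto simp: insert_commute)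
  qed
qed

text \<open>Two disjoint paths from the ends of the edge to \<open>A\<close>, joined by the edge,
  form the attached path. It avoids \<open>B\<close> because a vertex of \<open>B\<close> on it
  would have its neighbour on the path in \<open>A\<close>.\<close>

lemma edge_attached:
  assumes z: "adj G z z'" "z \<notin> A" "z' \<notin> A"
  obtains p p' a a' where "att (rev p @ p') a a'" "p \<noteq> []" "p' \<noteq> []" "hd p = z" "hd p' = z'"
proof -
  have zv: "z \<in> verts G" "z' \<in> verts G" "z \<noteq> z'" using adj_verts[OF z(1)] by auto
  have A2: "S ! 0 \<in> A" "S ! m \<in> A" "S ! 0 \<noteq> S ! m" using in_A m S_eq by auto
  obtain P0 where P0: "gpath G P0" "hd P0 = z" "last P0 = S ! 0" "z' \<notin> set P0"
    using path_avoiding[of z "S ! 0" z'] zv A2(1) S_AB(6) z by (metis subsetD)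
  obtain P where P: "gpath G P" "hd P = z" "last P \<in> A" "z' \<notin> set P"
    using gpath_first_hit[OF P0(1), of A] P0 A2 by (metis subsetD)
  have tP: "set (tl P) \<inter> {z, z'} = {}" using P by (cases P) (auto simp: gpath_def)
  have Zv: "{z, z'} \<subseteq> verts G" "A \<inter> {z, z'} = {}" using zv z by auto
  obtain q q' where q: "from_set {z, z'} z q q'" "set q \<inter> set q' = {}" "last q \<in> A" "last q' \<in> A"
    "set (butlast q) \<inter> A = {}" "set (butlast q') \<inter> A = {}"
    using two_disjoint_paths[OF P(1,2) tP P(3), of z' "S ! 0" "S ! m"] zv A2 S_AB Zv by (metis insertI1 insertI2)
  have g: "gpath G q" "gpath G q'" "hd q = z" "hd q' = z'" using q(1) by (auto simp: from_set_def)
  have dec: "\<exists>p a. r = p @ [a] \<and> p \<noteq> [] \<and> hd p = hd r \<and> gpath G p \<and> adj G (last p) a \<and> last r = a \<and> butlast r = p"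
    if "gpath G r" "hd r \<notin> A" "last r \<in> A" for r
  proof -
    have ne: "r \<noteq> []" using that gpath_ne by blast
    then have r: "r = butlast r @ [last r]" by simp
    have b: "butlast r \<noteq> []" using that ne by (cases r rule: rev_cases) auto
    have "gpath G (butlast r)" "adj G (last (butlast r)) (last r)"
      using that(1) gpath_append[OF b, of "[last r]"] r by auto
    moreover have "hd (butlast r) = hd r" using b r by (metis hd_append2)
    ultimately show ?thesis using r b by blast
  qed
  obtain p a where p: "q = p @ [a]" "p \<noteq> []" "hd p = z" "gpath G p" "adj G (last p) a" "a \<in> A" "set p \<inter> A = {}"
    using dec[of q] g z q by metis
  obtain p' a' where p': "q' = p' @ [a']" "p' \<noteq> []" "hd p' = z'" "gpath G p'" "adj G (last p') a'" "a' \<in> A" "set p' \<inter> A = {}"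
    using dec[of q'] g z q by metis
  have gp: "gpath G (rev p @ p')"
    using p p' q(2) z(1) by (subst gpath_append) (auto simp: last_rev)
  have l2: "length (rev p @ p') \<ge> 2" using p(2) p'(2) by (cases p; cases p') auto
  have "set (rev p @ p') \<inter> B = {}"
  proof (rule ccontr)
    assume "\<not> ?thesis"
    then obtain x where x: "x \<in> set (rev p @ p')" "x \<in> B" by blast
    then obtain y where "y \<in> set (rev p @ p')" "adj G x y" using gpath_neighbour[OF gp _ l2] by blast
    then show False using B_neighbours[OF x(2)] p(7) p'(7) by auto
  qed
  then have "att (rev p @ p') a a'"
    using gp p p' q(2) by (auto simp: att_def hd_rev adj_sym)
  then show thesis using that p p' by blast
qed

text \<open>The vertex of \<open>X\<close> is like an odd vertex, so its neighbours lie in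
  \<open>A\<close>, and an attached path with two or more vertices avoids it. Then
  \<open>att_off_X\<close> forces the ends \<open>S ! 0\<close> and \<open>S ! m\<close>, where
  \<open>att_end_le\<close> allows only one vertex.\<close>

lemma even_outcome:
  assumes X1: "length X = 1" and z: "adj G z z'"
  shows "z \<in> A \<or> z' \<in> A"
proof (rule ccontr)
  assume "\<not> ?thesis"
  then have zA: "z \<notin> A" "z' \<notin> A" by auto
  obtain x where x: "X = [x]" using X1 by (cases X) auto
  let ?S = "drop 2 S @ X @ take 1 S"
  have lS2: "length (drop 2 S) = m - 1" using lS by simp
  have nth: "?S ! i = (if i = m then S ! 0 else S ! (i + 2))" if "i \<le> m" "even i" for i
  proof (cases "i = m")
    case True
    have "take 1 S = [S ! 0]" using lS by (cases S) auto
    moreover have "\<not> m < m - Suc 0" by simp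
    ultimately show ?thesis using True m lS2 x by (simp add: nth_append)
  next
    case False
    then have "i < m - 1" using that m by presburger
    then show ?thesis using False lS2 lS by (simp add: nth_append)
  qed
  \<comment> \<open>Rotating the cycle by two positions turns \<open>x\<close> into a vertex of \<open>B\<close>.\<close>
  interpret R: alternating_cycle G m ?S "[S ! 1]" v
  proof unfold_locales
    show "length ?S = Suc m" using lS x m by simp
    have "drop 2 S @ X @ take 2 S = (drop 2 S @ X @ take 1 S) @ [S ! 1]"
      using lS m by (simp add: take_Suc_conv_app_nth numeral_2_eq_2)
    then show "longest_cycle G (?S @ [S ! 1])"
      using longest_cycle_rotate[of G "take 2 S" "drop 2 S @ X"] lc by (simp add: append_assoc[symmetric] del: append_assoc)
    have "set (?S @ [S ! 1]) \<subseteq> set (S @ X)"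
      using lS m by (auto dest: in_set_dropD in_set_takeD)
    then show "v \<notin> set (?S @ [S ! 1])" using v by blast
    show "{b. adj G v b} = {?S ! i | i. i \<le> m \<and> even i}"
    proof -
      have "{?S ! i | i. i \<le> m \<and> even i} = {S ! i | i. i \<le> m \<and> even i}" (is "?l = ?r")
      proof
        show "?l \<subseteq> ?r"
        proof
          fix b assume "b \<in> ?l"
          then obtain i where i: "b = ?S ! i" "i \<le> m" "even i" by blast
          show "b \<in> ?r"
          proof (cases "i = m")
            case True then show ?thesis using i nth[of i] by (auto intro!: exI[of _ 0])
          next
            case False
            then have "i + 2 \<le> m" using i m by presburger
            then show ?thesis using i nth[of i] False by (auto intro!: exI[of _ "i + 2"])
          qed
        qed
        show "?r \<subseteq> ?l"
        proof
          fix b assume "b \<in> ?r"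
          then obtain i where i: "b = S ! i" "i \<le> m" "even i" by blast
          show "b \<in> ?l"
          proof (cases "i = 0")
            case True then show ?thesis using i nth[of m] m by (auto intro!: exI[of _ m])
          next
            case False
            then have "i - 2 + 2 = i" "i - 2 \<noteq> m" "i - 2 \<le> m" "even (i - 2)" using i m by presburger+
            then show ?thesis using i nth[of "i - 2"] by (auto intro!: exI[of _ "i - 2"])
          qed
        qed
      qed
      then show ?thesis using nv by simp
    qed
  qed (use m v in auto)
  have RA: "R.A = A" using R.adj_v adj_v by blast
  have "?S ! (m - 1) = x" using lS2 x m by (simp add: nth_append)
  then have "x \<in> R.B" using m unfolding R.B_def by (auto intro!: exI[of _ "m - 1"])
  then have xA: "y \<in> A" if "adj G x y" for y using R.B_neighbours that RA by blast
  obtain p p' a a' where p: "att (rev p @ p') a a'" "p \<noteq> []" "p' \<noteq> []" "hd p = z" "hd p' = z'"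
    using edge_attached[OF z zA] by blast
  let ?P = "rev p @ p'"
  have l2: "length ?P \<ge> 2" using p(2,3) by (cases p; cases p') auto
  have g: "gpath G ?P" "set ?P \<inter> A = {}" using p(1) by (auto simp: att_def)
  have "x \<notin> set ?P" using gpath_neighbour[OF g(1) _ l2, of x] xA g(2) by blast
  then have "{a, a'} = {S ! 0, S ! m}" using att_off_X[OF p(1)] x l2 by auto
  then have "length ?P \<le> length X" using att_end_le[OF p(1)] by auto
  then show False using l2 X1 by simp
qed

end

section \<open>The graph off the alternating set\<close>

definition outer :: "'a sgraph \<Rightarrow> 'a set \<Rightarrow> 'a \<Rightarrow> 'a \<Rightarrow> bool" where
  "outer G A u u' \<longleftrightarrow> adj G u u' \<and> u \<notin> A \<and> u' \<notin> A"

definition nbA :: "'a sgraph \<Rightarrow> 'a set \<Rightarrow> 'a \<Rightarrow> 'a set" where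
  "nbA G A u = {a \<in> A. adj G a u}"

text \<open>The edges of \<open>G - A\<close> form a star with centre \<open>z\<close>, whose leaves
  are all attached to the single vertex \<open>w\<close>. In \<open>X_family\<close> the centre
  becomes the vertex \<open>b\<close>, and the leaves become the set \<open>X\<close>.\<close>

definition star_structure :: "'a sgraph \<Rightarrow> 'a set \<Rightarrow> bool" where
  "star_structure G A \<longleftrightarrow> (\<exists>z w. z \<in> verts G - A \<and> w \<in> A \<and>
     (\<forall>u u'. outer G A u u' \<longrightarrow> u = z \<or> u' = z) \<and>
     (\<forall>l. outer G A z l \<longrightarrow> {b. adj G l b} = {w, z}))"

text \<open>A star forest is expressed by forbidding triangles and paths on four vertices; two
  disjoint edges then lie in different stars. Such conditions on short paths are what the cycle
  arguments yield, and they are easily transported along a bijection.\<close>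

definition star_forest_structure :: "'a sgraph \<Rightarrow> 'a set \<Rightarrow> 'a \<Rightarrow> 'a \<Rightarrow> bool" where
  "star_forest_structure G A a b \<longleftrightarrow> a \<in> A \<and> b \<in> A \<and>
     (\<forall>u u'. outer G A u u' \<longrightarrow> nbA G A u \<union> nbA G A u' = {a, b}) \<and>
     (\<forall>u v w. outer G A u v \<and> outer G A v w \<and> u \<noteq> w \<longrightarrow>
        \<not> outer G A u w \<and> (\<exists>c. nbA G A u = {c} \<and> nbA G A w = {c})) \<and>
     (\<forall>u v w x. outer G A u v \<and> outer G A v w \<and> outer G A w x \<and> u \<noteq> w \<and> v \<noteq> x \<longrightarrow> u = x) \<and>
     (\<exists>u v w x. outer G A u v \<and> outer G A w x \<and> {u, v} \<inter> {w, x} = {})"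

lemma outer_sym: "outer G A u v \<longleftrightarrow> outer G A v u"
  unfolding outer_def by (metis adj_sym)

context alternating_cycle
begin

lemma outer_AB: "outer G A u w \<Longrightarrow> u \<notin> A \<and> w \<notin> A \<and> u \<notin> B \<and> w \<notin> B \<and> u \<in> verts G \<and> w \<in> verts G \<and> u \<noteq> w"
  using edge_off_A[of u w] adj_verts[of u w] by (auto simp: outer_def)

text \<open>If \<open>P\<close> has three or more vertices, it is not attached at an end of
  \<open>S\<close>. Cutting it at \<open>x\<close> and leaving towards \<alpha> gives two paths
  attached at an end of \<open>S\<close>, each with at most two vertices, so \<open>P\<close> is
  \<open>[p1, x, p3]\<close>. With \<open>y\<close>, attached to \<beta>, as an outer vertex there
  is again a path on three vertices, now attached at an end. The hypotheses are symmetric enough to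
  let either vertex of \<open>X\<close> be \<open>x\<close>.\<close>

lemma att_hits_X_le:
  assumes X2: "length X = 2" and P: "att P a a'" "x \<in> set P" and xy: "outer G A x y"
    and al: "adj G x \<alpha>" "adj G y \<beta>" "\<alpha> \<in> {S ! 0, S ! m}" "\<beta> \<in> {S ! 0, S ! m}"
  shows "length P \<le> 2"
proof (rule ccontr)
  assume n: "\<not> ?thesis"
  then have aa: "a \<notin> {S ! 0, S ! m}" "a' \<notin> {S ! 0, S ! m}" using att_end_le[OF P(1)] X2 by auto
  have AA: "\<alpha> \<in> A" "\<beta> \<in> A" using al in_A m by auto
  have Pf: "gpath G P" "set P \<inter> A = {}" "set P \<inter> B = {}" "a \<in> A" "a' \<in> A" "adj G a (hd P)" "adj G (last P) a'"
    using P(1) by (auto simp: att_def)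
  obtain P1 P2 where PP: "P = P1 @ x # P2" using split_list[OF P(2)] by blast
  have al': "\<alpha> \<noteq> a" "\<alpha> \<noteq> a'" "\<beta> \<noteq> a" "\<beta> \<noteq> a'" using al(3,4) aa by auto
  have "att (x # P2) \<alpha> a'"
    using Pf AA al(1) al' unfolding PP att_def by (auto simp: gpath_def successively_append_iff adj_sym)
  then have "length (x # P2) \<le> 2" using att_end_le X2 al by metis
  moreover have "att (P1 @ [x]) a \<alpha>"
    using Pf AA al(1) al' unfolding PP att_def
    by (cases P1) (auto simp: gpath_def successively_append_iff successively_Cons hd_append split: if_splits)
  then have "length (P1 @ [x]) \<le> 2" using att_end_le X2 al by metis
  ultimately have "length P1 = 1" "length P2 = 1" using n PP by auto
  then obtain p1 p3 where "P1 = [p1]" "P2 = [p3]" by (auto simp: length_Suc_conv)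
  then have P3: "P = [p1, x, p3]" using PP by simp
  have yo: "y \<notin> A" "y \<notin> B" "y \<in> verts G" "adj G x y" "x \<noteq> y" using outer_AB[OF xy] xy by (auto simp: outer_def)
  have "\<exists>Q. length Q = 3 \<and> (att Q \<beta> a' \<or> att Q a \<beta>)"
  proof (cases "y = p3")
    case True
    then have "att [p1, x, y] a \<beta>" using Pf P3 yo AA al(2) al' by (auto simp: att_def gpath_def)
    then show ?thesis by (intro exI[of _ "[p1, x, y]"]) auto
  next
    case False
    then have "att [y, x, p3] \<beta> a'" using Pf P3 yo AA al(2) al' by (auto simp: att_def gpath_def adj_sym)
    then show ?thesis by (intro exI[of _ "[y, x, p3]"]) auto
  qed
  then show False using att_end_le X2 al by (metis (no_types, lifting) eval_nat_numeral(3) not_less_eq_eq order_refl)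
qed

end

section \<open>Odd cycle length: the gap has two vertices\<close>

locale odd_alternating_cycle = alternating_cycle +
  fixes x y
  assumes Xxy: "X = [x, y]"
begin

lemma X2: "length X = 2" using Xxy by simp

lemma xy: "outer G A x y" "adj G x (S ! m)" "adj G y (S ! 0)" "x \<noteq> y"
proof -
  show "outer G A x y" using Xxy dS S_AB by (auto simp: outer_def)
  show "adj G x (S ! m)" "adj G y (S ! 0)" "x \<noteq> y" using dX dS(2) Xxy by auto
qed

lemma att_le2:
  assumes P: "att P a a'"
  shows "length P \<le> 2"
proof -
  consider "x \<in> set P" | "y \<in> set P" | "set P \<inter> set X = {}" using Xxy by auto
  then show ?thesis
  proof cases
    case 1
    then show ?thesis using att_hits_X_le[OF X2 P 1 xy(1,2,3)] by simp
  next
    case 2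
    have "outer G A y x" using xy(1) outer_sym by metis
    from att_hits_X_le[OF X2 P 2 this xy(3,2)] show ?thesis by simp
  next
    case 3
    then show ?thesis using att_off_X[OF P 3] att_end_le[OF P] X2 by auto
  qed
qed

text \<open>The attached path through the edge has at most two vertices, so it is the edge
  itself.\<close>

lemma edge_nbA:
  assumes z: "outer G A z z'"
  obtains a a' where "a \<in> nbA G A z" "a' \<in> nbA G A z'" "a \<noteq> a'"
proof -
  obtain p p' a a' where p: "att (rev p @ p') a a'" "p \<noteq> []" "p' \<noteq> []" "hd p = z" "hd p' = z'"
    using edge_attached z unfolding outer_def by metis
  have "length p + length p' \<le> 2" using att_le2[OF p(1)] by simp
  then have "p = [z]" "p' = [z']" using p by (cases p; cases p'; auto)+
  then have "a \<in> nbA G A z" "a' \<in> nbA G A z'" "a \<noteq> a'" using p(1) by (auto simp: att_def nbA_def adj_sym)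
  then show thesis using that by blast
qed

lemma att2:
  assumes "outer G A z z'" "a \<in> nbA G A z" "a' \<in> nbA G A z'" "a \<noteq> a'"
  shows "att [z, z'] a a'"
proof -
  have "adj G z z'" "a \<in> A" "a' \<in> A" "adj G a z" "adj G z' a'"
    using assms by (simp_all add: outer_def nbA_def adj_sym)
  then show ?thesis using outer_AB[OF assms(1)] assms(4) by (simp add: att_def gpath_def)
qed

lemma path3_eq:
  assumes o: "outer G A p q" "outer G A q r" "p \<noteq> r" "a \<in> nbA G A p" "a' \<in> nbA G A r"
  shows "a = a'"
proof (rule ccontr)
  assume "a \<noteq> a'"
  then have "att [p, q, r] a a'"
    using o outer_AB[OF o(1)] outer_AB[OF o(2)] by (auto simp: att_def gpath_def outer_def nbA_def adj_sym)
  then show False using att_le2 by fastforce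
qed

lemma path3_single:
  assumes o: "outer G A p q" "outer G A q r" "p \<noteq> r"
  obtains c where "nbA G A p = {c}" "nbA G A r = {c}"
proof -
  obtain c where c: "c \<in> nbA G A p" using edge_nbA[OF o(1)] by metis
  obtain d where d: "d \<in> nbA G A r" using edge_nbA[OF o(2)] by metis
  have "nbA G A p = {c}" "nbA G A r = {c}" using path3_eq[OF o] c d by blast+
  then show thesis using that by blast
qed

lemma no_triangle: "outer G A p q \<Longrightarrow> outer G A q r \<Longrightarrow> p \<noteq> r \<Longrightarrow> \<not> outer G A p r"
proof
  assume o: "outer G A p q" "outer G A q r" "p \<noteq> r" "outer G A p r"
  obtain a a' where "a \<in> nbA G A p" "a' \<in> nbA G A r" "a \<noteq> a'" using edge_nbA[OF o(4)] by blast
  then show False using path3_eq[OF o(1-3)] by blast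
qed

text \<open>Vertices at distance two share their single neighbour in \<open>A\<close>:
  \<open>c\<close> for \<open>p\<close> and \<open>r\<close>, \<open>d\<close> for \<open>q\<close>
  and \<open>t\<close>. By \<open>edge_nbA\<close> on the first edge, \<open>c\<close> and
  \<open>d\<close> differ, so the whole path would be attached to \<open>A\<close> with four
  vertices.\<close>

lemma no_path4:
  assumes o: "outer G A p q" "outer G A q r" "outer G A r t" "p \<noteq> r" "q \<noteq> t"
  shows "p = t"
proof (rule ccontr)
  assume pt: "p \<noteq> t"
  obtain c where c: "nbA G A p = {c}" "nbA G A r = {c}" using path3_single[OF o(1,2,4)] by blast
  obtain d where d: "nbA G A q = {d}" "nbA G A t = {d}" using path3_single[OF o(2,3,5)] by blast
  have cd: "c \<noteq> d" using edge_nbA[OF o(1)] c d by (metis singletonD)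
  then have "att [p, q, r, t] c d"
    using o pt outer_AB[OF o(1)] outer_AB[OF o(2)] outer_AB[OF o(3)] c d
    by (auto simp: att_def gpath_def outer_def nbA_def adj_sym)
  then show False using att_le2 by fastforce
qed

text \<open>Every choice of distinct attachments of \<open>z\<close> and \<open>z'\<close> is the
  pair of ends of \<open>S\<close>. A third attachment would allow another choice.\<close>

lemma edge_off_X:
  assumes z: "outer G A z z'" "z \<notin> {x, y}" "z' \<notin> {x, y}"
  shows "nbA G A z \<union> nbA G A z' = {S ! 0, S ! m}"
proof -
  have ends: "{a, a'} = {S ! 0, S ! m}" if "a \<in> nbA G A z" "a' \<in> nbA G A z'" "a \<noteq> a'" for a a'
    using att_off_X[OF att2[OF z(1) that]] z Xxy by auto
  obtain a a' where a: "a \<in> nbA G A z" "a' \<in> nbA G A z'" "a \<noteq> a'" using edge_nbA[OF z(1)] by metis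
  show ?thesis
  proof
    show "{S ! 0, S ! m} \<subseteq> nbA G A z \<union> nbA G A z'" unfolding ends[OF a, symmetric] using a by blast
    show "nbA G A z \<union> nbA G A z' \<subseteq> {S ! 0, S ! m}"
    proof
      fix c assume "c \<in> nbA G A z \<union> nbA G A z'"
      then consider "c \<in> nbA G A z" | "c \<in> nbA G A z'" by blast
      then show "c \<in> {S ! 0, S ! m}"
      proof cases
        case 1 then show ?thesis using ends[of c a'] ends[OF a] a by (cases "c = a'") auto
      next
        case 2 then show ?thesis using ends[of a c] ends[OF a] a by (cases "c = a") auto
      qed
    qed
  qed
qed

text \<open>The edge \<open>z z'\<close> is attached to the ends of \<open>S\<close> and can replace
  \<open>x y\<close> in the cycle, so \<open>edge_off_X\<close> holds relative to both edges. Every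
  outer edge is disjoint from one of them, since an edge between them would complete a path on four
  vertices.\<close>

lemma forest_outcome:
  assumes z: "outer G A z z'" "z \<notin> {x, y}" "z' \<notin> {x, y}"
  shows "star_forest_structure G A (S ! 0) (S ! m)"
proof -
  obtain a a' where a: "a \<in> nbA G A z" "a' \<in> nbA G A z'" "a \<noteq> a'" using edge_nbA[OF z(1)] by metis
  have "{a, a'} = {S ! 0, S ! m}" using att_off_X[OF att2[OF z(1) a]] z Xxy by auto
  then have "\<exists>x' y'. {x', y'} = {z, z'} \<and> S ! m \<in> nbA G A x' \<and> S ! 0 \<in> nbA G A y'"
  proof (cases "a = S ! m")
    case True
    then show ?thesis using \<open>{a, a'} = {S ! 0, S ! m}\<close> a
      by (intro exI[of _ z] exI[of _ z']) (auto simp: doubleton_eq_iff)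
  next
    case False
    then show ?thesis using \<open>{a, a'} = {S ! 0, S ! m}\<close> a
      by (intro exI[of _ z'] exI[of _ z]) (auto simp: doubleton_eq_iff)
  qed
  then obtain x' y' where x'y': "{x', y'} = {z, z'}" "S ! m \<in> nbA G A x'" "S ! 0 \<in> nbA G A y'" by blast
  have o': "outer G A x' y'" using x'y'(1) z(1) outer_sym by (metis doubleton_eq_iff)
  have adj': "adj G (S ! m) x'" "adj G (S ! 0) y'" using x'y' by (auto simp: nbA_def)
  note AB' = outer_AB[OF o']
  \<comment> \<open>The new edge can replace \<open>xy\<close> in the cycle.\<close>
  interpret R: odd_alternating_cycle G m S "[x', y']" v x' y'
  proof unfold_locales
    have ds: "x' \<notin> set S" "y' \<notin> set S" using AB' S_AB(1) by auto
    have e: "last S = S ! m" "hd S = S ! 0" using dS(10) lS by (auto simp: last_conv_nth hd_conv_nth)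
    have a: "adj G (last S) x'" "adj G x' y'" "adj G y' (hd S)" using adj' o' e by (auto simp: outer_def adj_sym)
    have "is_cycle G (S @ [x', y'])"
      unfolding is_cycle_iff using dS(1,4,6,10) lS ds AB' a m
      by (auto simp: successively_append_iff)
    moreover have "length (S @ [x', y']) = length (S @ X)" using X2 by simp
    ultimately show "longest_cycle G (S @ [x', y'])" using lc by (simp add: longest_cycle_def)
    show "v \<notin> set (S @ [x', y'])" using v AB' S_AB(2) by auto
  qed (use m lS v nv in simp_all)
  have dis: "{x, y} \<inter> {x', y'} = {}" using x'y' z by auto
  have all: "nbA G A u \<union> nbA G A u' = {S ! 0, S ! m}" if u: "outer G A u u'" for u u'
  proof -
    have no: False if st: "outer G A s t" "s \<in> {x, y}" "t \<in> {x', y'}" for s t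
    proof -
      obtain s' where s': "outer G A s' s" "s' \<in> {x, y}" using st(2) xy(1) outer_sym by (metis insertE insertI1 insertI2 singletonD)
      obtain t' where t': "outer G A t t'" "t' \<in> {x', y'}" using st(3) o' outer_sym by (metis insertE insertI1 insertI2 singletonD)
      have "s' \<noteq> t" "s \<noteq> t'" "s' \<noteq> t'" using s'(2) t'(2) st(2,3) dis by auto
      then show False using no_path4[OF s'(1) st(1) t'(1)] by blast
    qed
    consider "u \<notin> {x, y}" "u' \<notin> {x, y}" | "u \<notin> {x', y'}" "u' \<notin> {x', y'}"
      | "u \<in> {x, y}" "u' \<in> {x', y'}" | "u' \<in> {x, y}" "u \<in> {x', y'}" using dis by blast
    then show ?thesis
    proof cases
      case 1 then show ?thesis using edge_off_X[OF u] by blast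
    next
      case 2 then show ?thesis using R.edge_off_X[OF u] by blast
    next
      case 3 then show ?thesis using no[OF u] by blast
    next
      case 4 then show ?thesis using no[of u' u] u outer_sym by metis
    qed
  qed
  show ?thesis unfolding star_forest_structure_def
  proof (intro conjI allI impI)
    show "S ! 0 \<in> A" "S ! m \<in> A" using in_A m by auto
    show "\<exists>u v w x. outer G A u v \<and> outer G A w x \<and> {u, v} \<inter> {w, x} = {}"
      using xy(1) o' dis by blast
  next
    fix u u' assume "outer G A u u'"
    then show "nbA G A u \<union> nbA G A u' = {S ! 0, S ! m}" by (rule all)
  next
    fix u v w assume "outer G A u v \<and> outer G A v w \<and> u \<noteq> w"
    then show "\<not> outer G A u w" "\<exists>c. nbA G A u = {c} \<and> nbA G A w = {c}"
      using no_triangle path3_single by metis+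
  next
    fix u v w x assume "outer G A u v \<and> outer G A v w \<and> outer G A w x \<and> u \<noteq> w \<and> v \<noteq> x"
    then show "u = x" using no_path4 by blast
  qed
qed

text \<open>\<open>c\<close> is the vertex of the gap with a further neighbour \<open>z\<close>. An
  edge at \<open>d\<close> that avoids \<open>c\<close> would extend \<open>z\<close>,
  \<open>c\<close>, \<open>d\<close> to a path on four vertices or close a triangle. So
  \<open>c\<close> is the centre, and the leaves share their neighbour in \<open>A\<close> by
  \<open>path3_single\<close>.\<close>

lemma star_outcome:
  assumes all: "\<And>u u'. outer G A u u' \<Longrightarrow> {u, u'} \<inter> {x, y} \<noteq> {}"
    and co: "{c, d} = {x, y}" "outer G A c z" "z \<noteq> d"
  shows "star_structure G A"
proof -
  have cd: "outer G A c d" using co(1) xy(1) outer_sym by (metis doubleton_eq_iff)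
  have dc: "outer G A d c" "outer G A z c" using cd co(2) outer_sym by metis+
  have centre: "u = c \<or> u' = c" if u: "outer G A u u'" for u u'
  proof (rule ccontr)
    assume n: "\<not> ?thesis"
    then have "d \<in> {u, u'}" using all[OF u] co(1) by auto
    then obtain t where t: "outer G A d t" "t \<noteq> c" using u n outer_sym by (metis insertE singletonD)
    have "z = t" using no_path4[OF dc(2) cd t(1)] co(3) t(2) by blast
    then show False using no_triangle[OF dc(1) co(2)] co(3) t(1) by blast
  qed
  obtain w where w: "nbA G A d = {w}" "nbA G A z = {w}" using path3_single[OF dc(1) co(2)] co(3) by metis
  have leaf: "{b. adj G l b} = {w, c}" if l: "outer G A c l" for l
  proof -
    have lw: "nbA G A l = {w}"
    proof (cases "l = d")
      case False
      then obtain e where "nbA G A d = {e}" "nbA G A l = {e}" using path3_single[OF dc(1) l] by metis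
      then show ?thesis using w by simp
    qed (use w in auto)
    show ?thesis
    proof
      have "w \<in> nbA G A l" using lw by simp
      then show "{w, c} \<subseteq> {b. adj G l b}" using l by (simp add: nbA_def outer_def adj_sym)
      show "{b. adj G l b} \<subseteq> {w, c}"
      proof
        fix b assume "b \<in> {b. adj G l b}"
        then have b: "adj G l b" by simp
        show "b \<in> {w, c}"
        proof (cases "b \<in> A")
          case True
          then have "b \<in> nbA G A l" using b by (simp add: nbA_def adj_sym)
          then show ?thesis using lw by simp
        next
          case False
          then have "outer G A l b" using b l by (auto simp: outer_def)
          then show ?thesis using centre[of l b] outer_AB[OF l] by auto
        qed
      qed
    qed
  qed
  have "w \<in> nbA G A d" using w by simp
  then have "w \<in> A" by (simp add: nbA_def)
  moreover have "c \<in> verts G - A" using outer_AB[OF cd] by blast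
  ultimately show ?thesis unfolding star_structure_def
    by (intro exI[of _ c] exI[of _ w] conjI allI impI) (use centre leaf in \<open>simp_all\<close>)
qed

lemma odd_outcome:
  "(\<forall>u u'. outer G A u u' \<longrightarrow> {u, u'} = {x, y}) \<or> star_structure G A \<or>
   star_forest_structure G A (S ! 0) (S ! m)"
proof (cases "\<exists>z z'. outer G A z z' \<and> {z, z'} \<inter> {x, y} = {}")
  case True
  then show ?thesis using forest_outcome by blast
next
  case False
  then have all: "\<And>u u'. outer G A u u' \<Longrightarrow> {u, u'} \<inter> {x, y} \<noteq> {}" by blast
  show ?thesis
  proof (cases "\<forall>u u'. outer G A u u' \<longrightarrow> {u, u'} = {x, y}")
    case False
    then obtain u u' where u: "outer G A u u'" "{u, u'} \<noteq> {x, y}" by blast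
    have uu: "outer G A u' u" "u \<noteq> u'" using u outer_sym outer_AB[OF u(1)] by metis+
    consider "u = x" | "u = y" | "u' = x" | "u' = y" using all[OF u(1)] by blast
    then have "star_structure G A"
    proof cases
      case 1 then show ?thesis using star_outcome[OF all, of x y u'] u by auto
    next
      case 2 then show ?thesis using star_outcome[OF all, of y x u'] u by auto
    next
      case 3 then show ?thesis using star_outcome[OF all, of x y u] u uu by auto
    next
      case 4 then show ?thesis using star_outcome[OF all, of y x u] u uu by auto
    qed
    then show ?thesis by blast
  qed blast
qed

end

section \<open>Embeddings into the three families\<close>

lemma iso_to_subgraphI:
  assumes G: "simple_graph G" and f: "bij_betw f (verts G) (verts H)" "finite (verts H)"
    and e: "\<And>u v. adj G u v \<Longrightarrow> {f u, f v} \<in> edges H"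
  shows "iso_to_subgraph G H"
proof -
  have inj: "inj_on f (verts G)" using f by (simp add: bij_betw_def)
  let ?H = "\<lparr>verts = verts H, edges = (\<lambda>e. f ` e) ` edges G\<rparr>"
  have E: "e \<subseteq> verts G" "card e = 2" if "e \<in> edges G" for e using G that by (auto simp: simple_graph_def)
  have "subgraph ?H H"
    unfolding subgraph_def simple_graph_def
  proof (intro conjI ballI)
    fix e' assume "e' \<in> edges ?H"
    then obtain d where d: "d \<in> edges G" "e' = f ` d" by auto
    show "e' \<subseteq> verts ?H" using d(2) E(1)[OF d(1)] f(1) by (auto simp: bij_betw_def)
    show "card e' = 2" using d E[OF d(1)] inj by (metis card_image inj_on_subset)
  next
    show "edges ?H \<subseteq> edges H"
    proof
      fix e' assume "e' \<in> edges ?H"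
      then obtain d where d: "d \<in> edges G" "e' = f ` d" by auto
      obtain u v where "d = {u, v}" using E[OF d(1)] by (auto simp: card_2_iff)
      then show "e' \<in> edges H" using e d by (auto simp: adj_def)
    qed
  qed (use f in auto)
  moreover have "isomorphic G ?H"
    unfolding isomorphic_def
  proof (intro exI[of _ f] conjI ballI)
    fix u v assume uv: "u \<in> verts G" "v \<in> verts G"
    show "({u, v} \<in> edges G) = ({f u, f v} \<in> edges ?H)"
    proof
      assume "{f u, f v} \<in> edges ?H"
      then obtain d where d: "d \<in> edges G" "f ` {u, v} = f ` d" by auto
      then have "{u, v} = d" using inj_on_image_eq_iff[OF inj, of "{u, v}" d] E uv by auto
      then show "{u, v} \<in> edges G" using d by simp
    qed (auto intro: rev_image_eqI)
  qed (use f in auto)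
  ultimately show ?thesis unfolding iso_to_subgraph_def by blast
qed

lemma W_edge:
  assumes "i < n" "j < n" "i \<noteq> j" "i < k \<or> j < k \<or> (i < c - k + 1 \<and> j < c - k + 1)"
  shows "{i, j} \<in> edges (W_graph n k c)"
proof -
  have *: "{i, j} \<in> edges (W_graph n k c)"
    if "i < j" "j < n" "i < k \<or> j < c - k + 1" for i j
  proof (cases "j < c - k + 1")
    case True then show ?thesis using that by (auto simp: W_graph_def)
  next
    case False
    then have "\<exists>i' j'. {i, j} = {i', j'} \<and> i' < k \<and> c - k + 1 \<le> j' \<and> j' < n"
      using that by (intro exI[of _ i] exI[of _ j]) auto
    then have "{i, j} \<in> {{i, j} | i j. i < k \<and> c - k + 1 \<le> j \<and> j < n}" by (rule CollectI)
    then show ?thesis by (simp add: W_graph_def)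
  qed
  show ?thesis
  proof (cases "i < j")
    case True then show ?thesis using assms * by auto
  next
    case False
    then have "{j, i} \<in> edges (W_graph n k c)" using assms * by auto
    then show ?thesis by (simp add: insert_commute)
  qed
qed

text \<open>\<open>A\<close> goes to the \<open>k\<close> vertices joined to everything,
  \<open>M\<close> into the rest of the clique, and all other vertices have neighbours only in
  \<open>A\<close>. For \<open>k = c div 2\<close> the clique has room for one vertex besides
  \<open>A\<close> if \<open>c\<close> is even, and for two, the long gap, if \<open>c\<close> is
  odd.\<close>

lemma embed_W:
  fixes G :: "'a sgraph"
  assumes G: "simple_graph G" "card (verts G) = n" and A: "A \<subseteq> verts G" "card A = k"
    and M: "M \<subseteq> verts G - A" "k + card M \<le> c - k + 1"
    and o: "\<And>u u'. outer G A u u' \<Longrightarrow> u \<in> M \<and> u' \<in> M"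
  shows "iso_to_subgraph G (W_graph n k c)"
proof -
  have fin: "finite (verts G)" using G by (simp add: simple_graph_def)
  then have fA: "finite A" "finite M" using finite_subset[OF A(1)] finite_subset[OF M(1)] by auto
  let ?R = "verts G - A - M"
  have cR: "card ?R = n - k - card M"
    using G A M fA by (simp add: card_Diff_subset)
  have "A \<inter> M = {}" "A \<union> M \<subseteq> verts G" using A M by auto
  then have cn: "k + card M \<le> n"
    using card_Un_disjoint[OF fA] card_mono[OF fin, of "A \<union> M"] A(2) G(2) by simp
  obtain f1 where f1: "bij_betw f1 A {..<k}"
    using finite_same_card_bij[of A "{..<k}"] fA A by auto
  obtain f2 where f2: "bij_betw f2 M {k..<k + card M}"
    using finite_same_card_bij[of M "{k..<k + card M}"] fA by auto
  obtain f3 where f3: "bij_betw f3 ?R {k + card M..<n}"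
    using finite_same_card_bij[of ?R "{k + card M..<n}"] fin cR by auto
  define f where "f u = (if u \<in> A then f1 u else if u \<in> M then f2 u else f3 u)" for u
  have b1: "bij_betw f A {..<k}" using f1 by (rule bij_betw_cong[THEN iffD1, rotated]) (simp add: f_def)
  have b2: "bij_betw f M {k..<k + card M}"
    using f2 M by (intro bij_betw_cong[THEN iffD1, OF _ f2]) (auto simp: f_def)
  have b3: "bij_betw f ?R {k + card M..<n}"
    by (intro bij_betw_cong[THEN iffD1, OF _ f3]) (auto simp: f_def)
  have "bij_betw f (A \<union> M) ({..<k} \<union> {k..<k + card M})" using b1 b2 by (rule bij_betw_combine) auto
  then have "bij_betw f (A \<union> M \<union> ?R) ({..<k} \<union> {k..<k + card M} \<union> {k + card M..<n})"
    using b3 by (rule bij_betw_combine) auto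
  moreover have "A \<union> M \<union> ?R = verts G" using A M by auto
  moreover have "{..<k} \<union> {k..<k + card M} \<union> {k + card M..<n} = {..<n}" using cn by auto
  ultimately have bij: "bij_betw f (verts G) {..<n}" by simp
  have fin_n: "f u < n" if "u \<in> verts G" for u using bij that by (auto simp: bij_betw_def)
  have fk: "f u < k" if "u \<in> A" for u using b1 that by (auto simp: bij_betw_def)
  have fM: "f u < k + card M" if "u \<in> M" for u using b2 that by (fastforce simp: bij_betw_def)
  show ?thesis
  proof (rule iso_to_subgraphI[OF G(1)])
    show "bij_betw f (verts G) (verts (W_graph n k c))" using bij by (simp add: W_graph_def)
    show "finite (verts (W_graph n k c))" by (simp add: W_graph_def)
    fix u v assume uv: "adj G u v"
    then have e: "{u, v} \<in> edges G" by (simp add: adj_def)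
    then have "{u, v} \<subseteq> verts G" "card {u, v} = 2" using G(1) by (auto simp: simple_graph_def)
    then have V: "u \<in> verts G" "v \<in> verts G" "u \<noteq> v" by auto
    then have "f u \<noteq> f v" using bij by (auto simp: bij_betw_def inj_on_def)
    moreover have "f u < k \<or> f v < k \<or> (f u < c - k + 1 \<and> f v < c - k + 1)"
    proof (cases "u \<in> A \<or> v \<in> A")
      case False
      then have "u \<in> M" "v \<in> M" using o[of u v] uv by (auto simp: outer_def)
      then show ?thesis using fM M(2) by (meson less_le_trans)
    qed (use fk in auto)
    ultimately show "{f u, f v} \<in> edges (W_graph n k c)" using W_edge fin_n V by blast
  qed
qed

text \<open>\<open>z\<close> is placed in \<open>D\<close>, the side completely joined to
  \<open>A\<close>, and the leaves \<open>L\<close> become the set \<open>X\<close> of the family;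
  their neighbourhoods in \<open>G\<close> are already \<open>{w, z}\<close>.\<close>

lemma embed_X:
  fixes G :: "'a sgraph"
  assumes G: "simple_graph G" "card (verts G) = n" and A: "A \<subseteq> verts G" "card A = c div 2"
    and s: "star_structure G A"
  shows "\<exists>H :: nat sgraph. H \<in> X_family n c \<and> iso_to_subgraph G H"
proof -
  obtain z w where z: "z \<in> verts G" "z \<notin> A" "w \<in> A" and o: "\<And>u u'. outer G A u u' \<Longrightarrow> u = z \<or> u' = z"
    and lf: "\<And>l. outer G A z l \<Longrightarrow> {b. adj G l b} = {w, z}"
    using s unfolding star_structure_def by blast
  have fin: "finite (verts G)" using G by (simp add: simple_graph_def)
  have V: "u \<in> verts G \<and> v \<in> verts G \<and> u \<noteq> v" if "adj G u v" for u v
  proof -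
    have "{u, v} \<subseteq> verts G" "card {u, v} = 2" using that G(1) by (auto simp: simple_graph_def adj_def)
    then show ?thesis by auto
  qed
  obtain f where f: "bij_betw f (verts G) {..<n}"
    using finite_same_card_bij[of "verts G" "{..<n}"] fin G by auto
  have inj: "inj_on f (verts G)" using f by (simp add: bij_betw_def)
  define L where "L = {l. outer G A z l}"
  define D where "D = verts G - A - L"
  have LV: "L \<subseteq> verts G" "L \<inter> A = {}" "z \<notin> L" "w \<in> verts G" using V z A by (auto simp: L_def outer_def)
  have DV: "D \<subseteq> verts G" by (auto simp: D_def)
  define A' D' L' w' z' where im_defs: "A' = f ` A" "D' = f ` D" "L' = f ` L" "w' = f w" "z' = f z"
  define E where "E = {{i, j} | i j. i \<in> A' \<and> j \<in> A' \<and> i \<noteq> j} \<union> {{i, j} | i j. i \<in> A' \<and> j \<in> D'}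
      \<union> {{i, j} | i j. i \<in> {w', z'} \<and> j \<in> L'}"
  have E1: "{i, j} \<in> E" if "i \<in> A'" "j \<in> A'" "i \<noteq> j" for i j using that unfolding E_def by blast
  have E2: "{i, j} \<in> E" if "i \<in> A'" "j \<in> D'" for i j using that unfolding E_def by blast
  have E3: "{i, j} \<in> E" if "i = w' \<or> i = z'" "j \<in> L'" for i j using that unfolding E_def by blast
  have mems: "u \<in> A \<Longrightarrow> f u \<in> A'" "u \<in> D \<Longrightarrow> f u \<in> D'" "u \<in> L \<Longrightarrow> f u \<in> L'" for u by (auto simp: im_defs)
  define H where "H = \<lparr>verts = {..<n}, edges = E\<rparr>"
  have im: "f ` verts G = {..<n}" using f by (simp add: bij_betw_def)
  have part: "{..<n} = A' \<union> D' \<union> L'" using im A LV unfolding im_defs D_def by blast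
  have dis: "f ` T \<inter> f ` T' = {}" if "T \<inter> T' = {}" "T \<subseteq> verts G" "T' \<subseteq> verts G" for T T'
    using inj_on_image_Int[OF inj that(2,3)] that(1) by simp
  have AD: "A' \<inter> D' = {}" "A' \<inter> L' = {}" "D' \<inter> L' = {}"
  proof -
    have "A \<inter> D = {}" "A \<inter> L = {}" "D \<inter> L = {}" using LV by (auto simp: D_def)
    then show "A' \<inter> D' = {}" "A' \<inter> L' = {}" "D' \<inter> L' = {}"
      unfolding im_defs using dis A(1) DV LV(1) by blast+
  qed
  have wz: "w' \<in> A'" "z' \<in> D'" using z LV by (auto simp: im_defs D_def)
  have ends: "w' \<notin> L'" "z' \<notin> L'" "z' \<notin> A'" "w' \<notin> D'" using wz AD by auto
  have "simple_graph H"
    unfolding simple_graph_def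
  proof (intro conjI ballI)
    fix e assume "e \<in> edges H"
    then have "e \<in> E" by (simp add: H_def)
    then obtain i j where ij: "e = {i, j}" "i \<noteq> j" "i \<in> {..<n}" "j \<in> {..<n}"
      unfolding E_def part using AD wz ends by blast
    then show "e \<subseteq> verts H" "card e = 2" by (auto simp: H_def)
  qed (simp add: H_def)
  moreover have "card (A') = c div 2" unfolding im_defs using A inj card_image inj_on_subset by metis
  moreover have "clique H (A')" by (auto simp: clique_def H_def E_def)
  moreover have "independent H (D')"
    unfolding independent_def H_def E_def using AD by (auto simp: doubleton_eq_iff)
  moreover have "independent H (L')"
    unfolding independent_def H_def E_def using AD ends by (auto simp: doubleton_eq_iff)
  moreover have "completely_joined H (A') (D')"
    unfolding completely_joined_def H_def E_def by auto
  moreover have "nbhd H x = {w', z'}" if x: "x \<in> L'" for x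
  proof
    show "{w', z'} \<subseteq> nbhd H x"
      using x wz part by (auto simp: nbhd_def H_def E_def)
    show "nbhd H x \<subseteq> {w', z'}"
    proof
      fix i assume "i \<in> nbhd H x"
      then have "{i, x} \<in> E" by (simp add: nbhd_def H_def)
      then show "i \<in> {w', z'}" unfolding E_def using x AD ends by (auto simp: doubleton_eq_iff)
    qed
  qed
  moreover have "verts H = A' \<union> D' \<union> L'" using part by (simp add: H_def)
  moreover have "card (verts H) = n" by (simp add: H_def)
  ultimately have "H \<in> X_family n c"
    unfolding X_family_def using AD wz
    by (intro CollectI conjI exI[of _ A'] exI[of _ D'] exI[of _ L'] bexI[of _ w'] bexI[of _ z'] ballI) simp_all
  moreover have "iso_to_subgraph G H"
  proof (rule iso_to_subgraphI[OF G(1)])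
    show "bij_betw f (verts G) (verts H)" "finite (verts H)" using f by (auto simp: H_def)
    have half: "{f u, f v} \<in> E" if uv: "adj G u v" "u \<in> A \<or> u = z" for u v
    proof (cases "v \<in> L")
      case True
      then have "u \<in> {w, z}" using lf[of v] uv(1) adj_sym unfolding L_def by (metis mem_Collect_eq)
      then show ?thesis using True E3[of "f u" "f v"] mems(3)[of v] by (auto simp: im_defs)
    next
      case v: False
      show ?thesis
      proof (cases "u \<in> A")
        case True
        then have "v \<in> A \<or> v \<in> D" using v V[OF uv(1)] by (auto simp: D_def)
        moreover have "f u \<noteq> f v" using V[OF uv(1)] inj by (auto simp: inj_on_def)
        ultimately show ?thesis using True E1[of "f u" "f v"] E2[of "f u" "f v"] mems(1,2) by blast
      next
        case False
        then have "u = z" using uv by blast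
        moreover have "v \<in> A" using v uv False calculation by (auto simp: L_def outer_def)
        ultimately have "{f v, f u} \<in> E" using wz E2[of "f v" "f u"] mems(1) by (auto simp: im_defs)
        then show ?thesis by (simp add: insert_commute)
      qed
    qed
    fix u v assume uv: "adj G u v"
    have "(u \<in> A \<or> u = z) \<or> (v \<in> A \<or> v = z)" using o[of u v] uv by (auto simp: outer_def)
    then have "{f u, f v} \<in> E" using half[of u v] half[of v u] uv adj_sym by (metis insert_commute)
    then show "{f u, f v} \<in> edges H" by (simp add: H_def)
  qed
  ultimately show ?thesis by blast
qed

text \<open>Add all edges within \<open>A\<close> and between \<open>A\<close> and the set
  \<open>B\<close> of vertices isolated in \<open>G - A\<close>. No edge at \<open>Y\<close> is
  added, so the attachments and leaf degrees of the stars are those in \<open>G\<close>.\<close>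

lemma supergraph_Y_family:
  fixes G :: "'a sgraph"
  assumes G: "simple_graph G" "card (verts G) = n" and A: "A \<subseteq> verts G" "card A = c div 2"
    and s: "star_forest_structure G A a b"
  shows "\<exists>H. H \<in> Y_family n c \<and> verts H = verts G \<and> edges G \<subseteq> edges H"
proof -
  let ?o = "outer G A"
  note s' = s[unfolded star_forest_structure_def]
  have ab: "a \<in> A" "b \<in> A" using s' by simp_all
  have un: "nbA G A u \<union> nbA G A u' = {a, b}" if "?o u u'" for u u'
    using s'[THEN conjunct2, THEN conjunct2, THEN conjunct1] that by simp
  have tri: "\<not> ?o u w" and p3: "\<exists>c. nbA G A u = {c} \<and> nbA G A w = {c}"
    if "?o u v" "?o v w" "u \<noteq> w" for u v w
    using s'[THEN conjunct2, THEN conjunct2, THEN conjunct2, THEN conjunct1, rule_format, of u v w] that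
    by simp_all
  have p4: "u = x" if "?o u v" "?o v w" "?o w x" "u \<noteq> w" "v \<noteq> x" for u v w x
    using s'[THEN conjunct2, THEN conjunct2, THEN conjunct2, THEN conjunct2, THEN conjunct1, rule_format, of u v w x] that
    by simp
  have two: "\<exists>u v w x. ?o u v \<and> ?o w x \<and> {u, v} \<inter> {w, x} = {}"
    using s'[THEN conjunct2, THEN conjunct2, THEN conjunct2, THEN conjunct2, THEN conjunct2] .
  have fin: "finite (verts G)" using G by (simp add: simple_graph_def)
  have V: "u \<in> verts G \<and> v \<in> verts G \<and> u \<noteq> v" if "adj G u v" for u v
  proof -
    have "{u, v} \<subseteq> verts G" "card {u, v} = 2" using that G(1) by (auto simp: simple_graph_def adj_def)
    then show ?thesis by auto
  qed
  have oV: "u \<in> verts G" "v \<in> verts G" "u \<noteq> v" "u \<notin> A" "v \<notin> A" "?o v u" if "?o u v" for u v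
    using that V[of u v] outer_sym[of G A u v] by (auto simp: outer_def)
  define Y where "Y = {u. \<exists>v. ?o u v}"
  define B where "B = verts G - A - Y"
  have YV: "Y \<subseteq> verts G" "Y \<inter> A = {}" using oV by (auto simp: Y_def)
  define H where "H = \<lparr>verts = verts G, edges = edges G \<union> {{u, v} | u v. u \<in> A \<and> v \<in> A \<and> u \<noteq> v}
      \<union> {{u, v} | u v. u \<in> A \<and> v \<in> B}\<rparr>"
  have vH: "verts H = verts G" by (simp add: H_def)
  have eH: "edges H = edges G \<union> {{u, v} | u v. u \<in> A \<and> v \<in> A \<and> u \<noteq> v} \<union> {{u, v} | u v. u \<in> A \<and> v \<in> B}"
    by (simp add: H_def)
  have HY: "{u, v} \<in> edges H \<longleftrightarrow> adj G u v" if "v \<in> Y" for u v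
    using that YV by (auto simp: eH adj_def B_def doubleton_eq_iff)
  have sH: "simple_graph H"
    unfolding simple_graph_def vH
  proof (intro conjI ballI)
    fix e assume "e \<in> edges H"
    then consider "e \<in> edges G" | u v where "e = {u, v}" "u \<in> A" "v \<in> A" "u \<noteq> v"
      | u v where "e = {u, v}" "u \<in> A" "v \<in> B" unfolding eH by blast
    then have "e \<subseteq> verts G \<and> card e = 2"
    proof cases
      case 1 then show ?thesis using G(1) by (auto simp: simple_graph_def)
    next
      case 2 then show ?thesis using A(1) by auto
    next
      case 3
      then have "u \<noteq> v" by (auto simp: B_def)
      then show ?thesis using 3 A(1) by (auto simp: B_def)
    qed
    then show "e \<subseteq> verts G" "card e = 2" by auto
  qed (rule fin)
  have indep: "independent H B"
    unfolding independent_def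
  proof (intro ballI notI)
    fix u v assume uv: "u \<in> B" "v \<in> B" "{u, v} \<in> edges H"
    then have "{u, v} \<in> edges G" unfolding eH by (auto simp: B_def doubleton_eq_iff)
    then have "?o u v" using uv by (auto simp: outer_def adj_def B_def)
    then show False using uv by (auto simp: B_def Y_def)
  qed
  let ?I = "induced H Y"
  have vI: "verts ?I = Y" using YV by (auto simp: induced_def vH)
  have eI: "{u, v} \<in> edges ?I \<longleftrightarrow> ?o u v" for u v
  proof
    assume "{u, v} \<in> edges ?I"
    then show "?o u v" using HY[of v u] YV by (auto simp: induced_def outer_def)
  next
    assume "?o u v"
    then show "{u, v} \<in> edges ?I" using HY[of v u] oV(6) by (auto simp: induced_def Y_def outer_def)
  qed
  have star: "\<exists>z. {v \<in> Y. reachable ?I u v} = insert z {t. ?o z t} \<and> (\<exists>t. ?o z t)" if u: "u \<in> Y" for u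
  proof -
    \<comment> \<open>A vertex with two outer neighbours is the centre of its star; otherwise its
      only outer neighbour is taken as centre.\<close>
    have "\<exists>z. (u = z \<or> ?o z u) \<and> (\<exists>t. ?o z t) \<and> (\<forall>t w. ?o z t \<and> ?o t w \<longrightarrow> w = z)"
    proof (cases "\<exists>t t'. ?o u t \<and> ?o u t' \<and> t \<noteq> t'")
      case True
      have "w = u" if tw: "?o u t" "?o t w" for t w
      proof (rule ccontr)
        assume wu: "w \<noteq> u"
        obtain t' where t': "?o u t'" "t' \<noteq> t" using True by blast
        have "w = t'" using p4[of w t u t'] tw t' oV(6) wu by blast
        then show False using tri[of u t w] tw wu t' by blast
      qed
      then show ?thesis using True by blast
    next
      case False
      obtain z where z: "?o u z" using u by (auto simp: Y_def)
      have uz: "t = z" if "?o u t" for t using False z that by blast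
      have "w = z" if tw: "?o z t" "?o t w" for t w
      proof (rule ccontr)
        assume wz: "w \<noteq> z"
        have "t \<noteq> u" using uz[of w] tw wz by blast
        then have "w = u" using p4[of w t z u] tw oV(6) z wz by blast
        then show False using uz[of t] tw oV by blast
      qed
      then show ?thesis using z oV(6) by blast
    qed
    then obtain z where z: "u = z \<or> ?o z u" "\<exists>t. ?o z t" "\<And>t w. ?o z t \<Longrightarrow> ?o t w \<Longrightarrow> w = z" by blast
    have "{v \<in> Y. reachable ?I u v} = insert z {t. ?o z t}"
    proof
      have "v \<in> insert z {t. ?o z t}" if "(u, v) \<in> {(x, y). {x, y} \<in> edges ?I}\<^sup>*" for v
        using that
      proof (induction rule: rtrancl_induct)
        case base then show ?case using z(1) by blast
      next
        case (step y w)
        then have "?o y w" using eI by blast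
        then show ?case using step z(3)[of y w] by auto
      qed
      then show "{v \<in> Y. reachable ?I u v} \<subseteq> insert z {t. ?o z t}" by (auto simp: reachable_def)
      have r1: "(x, y) \<in> {(x, y). {x, y} \<in> edges ?I}" if "?o x y" for x y using eI that by blast
      have uz: "(u, z) \<in> {(x, y). {x, y} \<in> edges ?I}\<^sup>*" using z(1) r1[of u z] oV(6)[of z u] by (auto intro: r_into_rtrancl)
      show "insert z {t. ?o z t} \<subseteq> {v \<in> Y. reachable ?I u v}"
      proof
        fix t assume t: "t \<in> insert z {t. ?o z t}"
        then have "t \<in> Y" using z(2) oV(6) by (auto simp: Y_def)
        moreover have "(u, t) \<in> {(x, y). {x, y} \<in> edges ?I}\<^sup>*"
        proof (cases "t = z")
          case True then show ?thesis using uz by simp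
        next
          case False
          then have "?o z t" using t by simp
          then show ?thesis by (rule rtrancl.rtrancl_into_rtrancl[OF uz r1])
        qed
        ultimately show "t \<in> {v \<in> Y. reachable ?I u v}" by (simp add: reachable_def)
      qed
    qed
    then show ?thesis using z(2) by blast
  qed
  have comp: "\<exists>z. K = insert z {t. ?o z t} \<and> (\<exists>t. ?o z t)" if "K \<in> components ?I" for K
    using that star vI by (auto simp: components_def)
  have KY: "insert z {t. ?o z t} \<subseteq> Y" if "?o z t" for z t using that oV(6) by (auto simp: Y_def)
  have inK: "s = z \<or> t = z" if "?o s t" "s \<in> insert z {t. ?o z t}" "t \<in> insert z {t. ?o z t}" for s t z
    using that tri[of z s t] oV by auto
  have closed: "t \<in> insert z {t. ?o z t}" if kk: "K \<in> components ?I" "K = insert z {t. ?o z t}" "s \<in> K" "?o s t" for K z s t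
  proof -
    obtain u where u: "K = {v \<in> Y. reachable ?I u v}" using kk(1) vI by (auto simp: components_def)
    have "(u, s) \<in> {(x, y). {x, y} \<in> edges ?I}\<^sup>*" using kk(3) u by (auto simp: reachable_def)
    moreover have "(s, t) \<in> {(x, y). {x, y} \<in> edges ?I}" using kk(4) eI[of s t] by simp
    ultimately have "(u, t) \<in> {(x, y). {x, y} \<in> edges ?I}\<^sup>*" by (rule rtrancl.rtrancl_into_rtrancl)
    moreover have "t \<in> Y" using kk(4) oV(6) by (auto simp: Y_def)
    ultimately show ?thesis using u kk(2) by (auto simp: reachable_def)
  qed
  have SF: "star_forest ?I"
    unfolding star_forest_def
  proof
    fix K assume K: "K \<in> components ?I"
    obtain z t where z: "K = insert z {t. ?o z t}" "?o z t" using comp[OF K] by blast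
    have vK: "verts (induced ?I K) = K" using KY[OF z(2)] z(1) vI by (auto simp: induced_def)
    have "edges (induced ?I K) = {{z, x} | x. x \<in> K - {z}}"
    proof
      show "edges (induced ?I K) \<subseteq> {{z, x} | x. x \<in> K - {z}}"
      proof
        fix e assume "e \<in> edges (induced ?I K)"
        then have e: "e \<in> edges ?I" "e \<subseteq> K" by (auto simp: induced_def)
        then have "e \<in> edges H" by (auto simp: induced_def)
        then have "card e = 2" using sH by (simp add: simple_graph_def)
        then obtain p q where pq: "e = {p, q}" "p \<noteq> q" by (auto simp: card_2_iff)
        then have "?o p q" using e eI by blast
        then have "p = z \<or> q = z" using inK[of p q z] e pq z(1) by auto
        then show "e \<in> {{z, x} | x. x \<in> K - {z}}" using pq e by auto
      qed
      show "{{z, x} | x. x \<in> K - {z}} \<subseteq> edges (induced ?I K)"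
      proof
        fix e assume "e \<in> {{z, x} | x. x \<in> K - {z}}"
        then obtain x where x: "e = {z, x}" "x \<in> K" "x \<noteq> z" by blast
        then have "?o z x" using z(1) by auto
        then show "e \<in> edges (induced ?I K)" using eI[of z x] x z(1) by (simp add: induced_def)
      qed
    qed
    then show "is_star (induced ?I K)" unfolding is_star_def vK using z(1) by blast
  qed
  have ne: "edges (induced H K) \<noteq> {}" if K: "K \<in> components ?I" for K
  proof -
    obtain z t where z: "K = insert z {t. ?o z t}" "?o z t" using comp[OF K] by blast
    have "{z, t} \<in> edges ?I" using eI z by blast
    then have "{z, t} \<in> edges (induced H K)" using z by (simp add: induced_def)
    then show ?thesis by blast
  qed
  have nb: "set_nbhd H K = {a, b}" if K: "K \<in> components ?I" for K
  proof -
    obtain z t where z: "K = insert z {t. ?o z t}" "?o z t" using comp[OF K] by blast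
    have KY': "K \<subseteq> Y" using KY[OF z(2)] z(1) by simp
    show ?thesis
    proof
      show "set_nbhd H K \<subseteq> {a, b}"
      proof
        fix u assume "u \<in> set_nbhd H K"
        then obtain s where s: "u \<notin> K" "s \<in> K" "{u, s} \<in> edges H" by (auto simp: set_nbhd_def)
        have us: "adj G u s" using HY[of s u] s KY' by auto
        obtain s' where s': "?o s s'" using KY' s(2) by (auto simp: Y_def)
        have "u \<in> A"
        proof (rule ccontr)
          assume "u \<notin> A"
          then have "?o s u" using us s' by (auto simp: outer_def adj_sym)
          then show False using closed[OF K z(1) s(2)] s(1) z(1) by blast
        qed
        then have "u \<in> nbA G A s" using us by (simp add: nbA_def)
        then show "u \<in> {a, b}" using un[OF s'] by blast
      qed
      show "{a, b} \<subseteq> set_nbhd H K"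
      proof
        fix u assume "u \<in> {a, b}"
        then have "u \<in> nbA G A z \<union> nbA G A t" using un[OF z(2)] by simp
        then obtain s where s: "s \<in> K" "u \<in> A" "adj G u s" using z by (auto simp: nbA_def)
        have "{u, s} \<in> edges H" using HY[of s u] s KY' by auto
        moreover have "u \<notin> K" "u \<in> verts H" using s(2) KY' YV A(1) vH by auto
        ultimately show "u \<in> set_nbhd H K" using s(1) by (auto simp: set_nbhd_def)
      qed
    qed
  qed
  have lf: "(\<forall>l\<in>leaves (induced H K). degree H l = 2) \<and> (\<exists>w\<in>{a, b}. \<forall>l\<in>leaves (induced H K). w \<in> nbhd H l)"
    if K: "K \<in> components ?I" and K3: "card K \<ge> 3" for K
  proof -
    obtain z t where z: "K = insert z {t. ?o z t}" "?o z t" using comp[OF K] by blast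
    have KY': "K \<subseteq> Y" using KY[OF z(2)] z(1) by simp
    then have fK: "finite K" using YV fin by (meson finite_subset)
    \<comment> \<open>Three vertices give two distinct neighbours \<open>t\<close>,
      \<open>t'\<close> of the centre, and these determine the common neighbour \<open>w\<close> in
      \<open>A\<close>.\<close>
    have "\<not> K \<subseteq> {z, t}" using K3 card_mono[of "{z, t}" K] card_insert_le_m1[of 2 "{t}" z] by auto
    then obtain t' where t': "?o z t'" "t' \<noteq> t" using z(1) by auto
    have tz: "?o t z" using z(2) oV(6) by blast
    obtain w where w: "nbA G A t = {w}" "nbA G A t' = {w}" using p3[OF tz t'(1)] t'(2) by blast
    have wab: "w \<in> {a, b}" using un[OF z(2)] w(1) by blast
    have wA: "w \<in> A" using wab ab by blast
    have all: "nbA G A l = {w}" if l: "?o z l" for l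
    proof (cases "l = t")
      case False
      then obtain d where "nbA G A t = {d}" "nbA G A l = {d}" using p3[OF tz l] by blast
      then show ?thesis using w by simp
    qed (use w in simp)
    have leaf: "nbhd H l = {z, w} \<and> z \<noteq> w" if l: "l \<in> leaves (induced H K)" for l
    proof -
      have vK: "verts (induced H K) = K" using KY' YV vH by (auto simp: induced_def)
      have lK: "l \<in> K" and dl: "degree (induced H K) l = 1" using l vK by (auto simp: leaves_def)
      have eK: "{x, y} \<in> edges (induced H K) \<longleftrightarrow> ?o x y" if "x \<in> K" "y \<in> K" for x y
      proof -
        have "{x, y} \<in> edges (induced H K) \<longleftrightarrow> {x, y} \<in> edges ?I" using that KY' by (auto simp: induced_def)
        then show ?thesis using eI by simp
      qed
      have "l \<noteq> z"
      proof
        assume "l = z"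
        have "{t, t'} \<subseteq> nbhd (induced H K) z"
          using z t' tz oV(6)[OF t'(1)] eK[of t z] eK[of t' z] vK by (auto simp: nbhd_def)
        moreover have "finite (nbhd (induced H K) z)" using fK vK by (simp add: nbhd_def)
        ultimately have "card {t, t'} \<le> degree (induced H K) z" unfolding degree_def by (intro card_mono)
        then show False using t'(2) dl \<open>l = z\<close> by simp
      qed
      then have zl: "?o z l" using lK z(1) by simp
      have "nbhd H l = {z, w}"
      proof
        show "{z, w} \<subseteq> nbhd H l"
        proof -
          have "w \<in> nbA G A l" using all[OF zl] by simp
          then have "adj G w l" by (simp add: nbA_def)
          moreover have "adj G z l" using zl by (simp add: outer_def)
          ultimately show ?thesis using HY[of l] lK KY' V vH by (auto simp: nbhd_def)
        qed
        show "nbhd H l \<subseteq> {z, w}"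
        proof
          fix u assume "u \<in> nbhd H l"
          then have ul: "adj G u l" using HY[of l u] lK KY' by (auto simp: nbhd_def)
          show "u \<in> {z, w}"
          proof (cases "u \<in> A")
            case True
            then have "u \<in> nbA G A l" using ul by (simp add: nbA_def)
            then show ?thesis using all[OF zl] by simp
          next
            case False
            then have lu: "?o l u" using ul zl by (auto simp: outer_def adj_sym)
            then have "u \<in> K" using closed[OF K z(1) lK] z(1) by blast
            then show ?thesis using inK[OF lu, of z] lK z(1) \<open>l \<noteq> z\<close> by blast
          qed
        qed
      qed
      moreover have "z \<noteq> w" using oV(4)[OF z(2)] wA by blast
      ultimately show ?thesis by blast
    qed
    show ?thesis
    proof (intro conjI ballI bexI[of _ w])
      fix l assume "l \<in> leaves (induced H K)"
      then show "degree H l = 2" "w \<in> nbhd H l" using leaf[of l] by (simp_all add: degree_def)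
    qed (rule wab)
  qed
  have two_comp: "card (components ?I) \<ge> 2"
  proof -
    obtain u v w x where uv: "?o u v" "?o w x" "{u, v} \<inter> {w, x} = {}" using two by blast
    let ?K = "{t \<in> Y. reachable ?I u t}" and ?L = "{t \<in> Y. reachable ?I w t}"
    have uw: "u \<in> Y" "w \<in> Y" using uv by (auto simp: Y_def)
    then have KL: "?K \<in> components ?I" "?L \<in> components ?I" using vI by (auto simp: components_def)
    \<comment> \<open>Two edges of one component both contain its centre and so cannot be
      disjoint.\<close>
    have "?K \<noteq> ?L"
    proof
      assume eq: "?K = ?L"
      obtain z where z: "?K = insert z {t. ?o z t}" using comp[OF KL(1)] by blast
      have "u \<in> ?K" "w \<in> ?L" using uw by (auto simp: reachable_def)
      then have "u \<in> ?K" "w \<in> ?K" using eq by blast+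
      then have m: "u \<in> ?K" "w \<in> ?K" "v \<in> insert z {t. ?o z t}" "x \<in> insert z {t. ?o z t}"
        using closed[OF KL(1) z _ uv(1)] closed[OF KL(1) z _ uv(2)] by blast+
      then have "u = z \<or> v = z" "w = z \<or> x = z" using inK[OF uv(1), of z] inK[OF uv(2), of z] z by blast+
      then show False using uv(3) by blast
    qed
    then have "card {?K, ?L} = 2" by simp
    moreover have "finite (components ?I)"
      by (rule finite_subset[of _ "Pow Y"]) (use vI YV fin finite_subset in \<open>auto simp: components_def\<close>)
    then have "card {?K, ?L} \<le> card (components ?I)" using KL by (intro card_mono) auto
    ultimately show ?thesis by simp
  qed
  have K: "\<exists>a\<in>A. \<exists>b\<in>A. \<forall>S\<in>components ?I. set_nbhd H S = {a, b} \<and>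
      (card S \<ge> 3 \<longrightarrow> (\<forall>l\<in>leaves (induced H S). degree H l = 2) \<and>
        (\<exists>w\<in>{a, b}. \<forall>l\<in>leaves (induced H S). w \<in> nbhd H l))"
  proof (rule bexI[OF _ ab(1)], rule bexI[OF _ ab(2)], intro ballI)
    fix S assume S: "S \<in> components ?I"
    show "set_nbhd H S = {a, b} \<and>
      (card S \<ge> 3 \<longrightarrow> (\<forall>l\<in>leaves (induced H S). degree H l = 2) \<and>
        (\<exists>w\<in>{a, b}. \<forall>l\<in>leaves (induced H S). w \<in> nbhd H l))"
      using nb[OF S] lf[OF S] by simp
  qed
  have "verts H = A \<union> B \<union> Y" using YV A(1) by (auto simp: vH B_def)
  moreover have "A \<inter> B = {}" "A \<inter> Y = {}" "B \<inter> Y = {}" using YV by (auto simp: B_def)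
  moreover have "clique H A" "completely_joined H A B" by (auto simp: clique_def completely_joined_def eH)
  moreover have "card (verts H) = n" using vH G(2) by simp
  ultimately have "H \<in> Y_family n c"
    unfolding Y_family_def using sH A(2) indep SF two_comp ne K
    by (intro CollectI conjI, simp, simp, rule_tac exI[of _ A], rule_tac exI[of _ B], rule_tac exI[of _ Y])
      (intro conjI, simp_all)
  then show ?thesis using vH eH by blast
qed

text \<open>The member of the family is sought on natural numbers, so \<open>G\<close> is first
  copied to \<open>{..<n}\<close>, and the supergraph is built for the copy.\<close>

lemma embed_Y:
  fixes G :: "'a sgraph"
  assumes G: "simple_graph G" "card (verts G) = n" and A: "A \<subseteq> verts G" "card A = c div 2"
    and s: "star_forest_structure G A a b"
  shows "\<exists>H :: nat sgraph. H \<in> Y_family n c \<and> iso_to_subgraph G H"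
proof -
  have fin: "finite (verts G)" using G by (simp add: simple_graph_def)
  obtain f where f: "bij_betw f (verts G) {..<n}"
    using finite_same_card_bij[of "verts G" "{..<n}"] fin G by auto
  have inj: "inj_on f (verts G)" and im: "f ` verts G = {..<n}" using f by (auto simp: bij_betw_def)
  define g where "g = inv_into (verts G) f"
  have gf: "g (f u) = u" if "u \<in> verts G" for u using inj that by (simp add: g_def inv_into_f_f)
  have fg: "f (g i) = i" "g i \<in> verts G" if "i < n" for i
    using that im by (auto simp: g_def f_inv_into_f inv_into_into)
  have V: "u \<in> verts G \<and> v \<in> verts G" if "adj G u v" for u v
    using that G(1) by (auto simp: simple_graph_def adj_def)
  define G' where "G' = \<lparr>verts = {..<n}, edges = (\<lambda>e. f ` e) ` edges G\<rparr>"
  have fE: "f ` e \<in> edges G'" if "e \<in> edges G" for e using that by (simp add: G'_def)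
  have EV: "e \<subseteq> verts G" "card e = 2" if "e \<in> edges G" for e using G(1) that by (auto simp: simple_graph_def)
  have sG': "simple_graph G'"
    unfolding simple_graph_def
  proof (intro conjI ballI)
    fix e' assume "e' \<in> edges G'"
    then obtain e where e: "e \<in> edges G" "e' = f ` e" by (auto simp: G'_def)
    show "e' \<subseteq> verts G'" using e EV(1)[OF e(1)] im by (auto simp: G'_def)
    show "card e' = 2" using e EV[OF e(1)] inj by (metis card_image inj_on_subset)
  qed (simp add: G'_def)
  have adj: "adj G' i j \<longleftrightarrow> i < n \<and> j < n \<and> adj G (g i) (g j)" for i j
  proof
    assume "adj G' i j"
    then obtain e where e: "e \<in> edges G" "{i, j} = f ` e" by (auto simp: adj_def G'_def)
    have "{i, j} \<subseteq> {..<n}" unfolding e(2) im[symmetric] using EV(1)[OF e(1)] by (rule image_mono)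
    then have ij: "i < n" "j < n" by auto
    have "g ` (f ` e) = e"
      unfolding image_image using EV(1)[OF e(1)] gf by (force simp: subset_iff)
    then have "{g i, g j} = e" unfolding e(2)[symmetric] by simp
    then show "i < n \<and> j < n \<and> adj G (g i) (g j)" using ij e(1) by (simp add: adj_def)
  next
    assume a: "i < n \<and> j < n \<and> adj G (g i) (g j)"
    then have "f ` {g i, g j} = {i, j}" using fg by simp
    moreover have "f ` {g i, g j} \<in> edges G'" using a by (intro fE) (simp add: adj_def)
    ultimately show "adj G' i j" by (simp add: adj_def)
  qed
  let ?A = "f ` A"
  have memA: "i \<in> ?A \<longleftrightarrow> g i \<in> A" if "i < n" for i
    using that A(1) gf fg by (metis image_iff subsetD)
  have out: "outer G' ?A i j \<longleftrightarrow> i < n \<and> j < n \<and> outer G A (g i) (g j)" for i j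
    using adj memA by (auto simp: outer_def)
  have nb: "nbA G' ?A i = f ` nbA G A (g i)" if i: "i < n" for i
  proof
    show "nbA G' ?A i \<subseteq> f ` nbA G A (g i)"
    proof
      fix j assume "j \<in> nbA G' ?A i"
      then have "j \<in> ?A" "adj G' j i" by (auto simp: nbA_def)
      then have "g j \<in> nbA G A (g i)" "f (g j) = j" using adj memA fg by (auto simp: nbA_def)
      then show "j \<in> f ` nbA G A (g i)" by (metis imageI)
    qed
    show "f ` nbA G A (g i) \<subseteq> nbA G' ?A i"
    proof
      fix j assume "j \<in> f ` nbA G A (g i)"
      then obtain u where u: "j = f u" "u \<in> A" "adj G u (g i)" by (auto simp: nbA_def)
      then have "j < n" "g j = u" using V gf im by auto
      then show "j \<in> nbA G' ?A i" using u i adj by (auto simp: nbA_def)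
    qed
  qed
  have ginj: "i = j" if "g i = g j" "i < n" "j < n" for i j using that fg by metis
  have "star_forest_structure G' ?A (f a) (f b)"
    unfolding star_forest_structure_def
  proof (intro conjI allI impI)
    note s' = s[unfolded star_forest_structure_def]
    show "f a \<in> ?A" "f b \<in> ?A" using s' by auto
    show "nbA G' ?A u \<union> nbA G' ?A u' = {f a, f b}" if "outer G' ?A u u'" for u u'
    proof -
      have "nbA G A (g u) \<union> nbA G A (g u') = {a, b}"
        using s'[THEN conjunct2, THEN conjunct2, THEN conjunct1] that out by blast
      then show ?thesis using nb that out by (metis image_Un image_empty image_insert)
    qed
    show "\<not> outer G' ?A u w" "\<exists>c. nbA G' ?A u = {c} \<and> nbA G' ?A w = {c}"
      if "outer G' ?A u v \<and> outer G' ?A v w \<and> u \<noteq> w" for u v w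
    proof -
      have n: "u < n" "w < n" and o: "outer G A (g u) (g v) \<and> outer G A (g v) (g w) \<and> g u \<noteq> g w"
        using that out ginj by blast+
      from s'[THEN conjunct2, THEN conjunct2, THEN conjunct2, THEN conjunct1, rule_format, OF o]
      have r: "\<not> outer G A (g u) (g w)" "\<exists>c. nbA G A (g u) = {c} \<and> nbA G A (g w) = {c}" by blast+
      show "\<not> outer G' ?A u w" using r(1) out by blast
      show "\<exists>c. nbA G' ?A u = {c} \<and> nbA G' ?A w = {c}" using r(2) nb n by (metis image_empty image_insert)
    qed
    show "u = x" if "outer G' ?A u v \<and> outer G' ?A v w \<and> outer G' ?A w x \<and> u \<noteq> w \<and> v \<noteq> x" for u v w x
    proof -
      have n: "u < n" "x < n" and o: "outer G A (g u) (g v) \<and> outer G A (g v) (g w) \<and> outer G A (g w) (g x) \<and> g u \<noteq> g w \<and> g v \<noteq> g x"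
        using that out ginj by blast+
      from s'[THEN conjunct2, THEN conjunct2, THEN conjunct2, THEN conjunct2, THEN conjunct1, rule_format, OF o]
      show ?thesis using ginj n by blast
    qed
    obtain u v w x where o: "outer G A u v" "outer G A w x" "{u, v} \<inter> {w, x} = {}"
      using s'[THEN conjunct2, THEN conjunct2, THEN conjunct2, THEN conjunct2, THEN conjunct2] by blast
    have vs: "u \<in> verts G" "v \<in> verts G" "w \<in> verts G" "x \<in> verts G" using o V by (auto simp: outer_def)
    then have n: "f u < n" "f v < n" "f w < n" "f x < n" using im by auto
    have "{f u, f v} \<inter> {f w, f x} = {}" using o(3) vs inj by (auto dest: inj_onD)
    moreover have "outer G' ?A (f u) (f v)" "outer G' ?A (f w) (f x)" using o out n vs gf by simp_all
    ultimately show "\<exists>u v w x. outer G' ?A u v \<and> outer G' ?A w x \<and> {u, v} \<inter> {w, x} = {}" by blast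
  qed
  moreover have "?A \<subseteq> verts G'" using A(1) im by (auto simp: G'_def)
  moreover have "card ?A = c div 2" using A inj card_image inj_on_subset by metis
  moreover have "card (verts G') = n" by (simp add: G'_def)
  ultimately obtain H where H: "H \<in> Y_family n c" "verts H = verts G'" "edges G' \<subseteq> edges H"
    using supergraph_Y_family[OF sG', of n ?A c "f a" "f b"] by blast
  have "iso_to_subgraph G H"
  proof (rule iso_to_subgraphI[OF G(1)])
    show "bij_betw f (verts G) (verts H)" "finite (verts H)" using f H(2) by (auto simp: G'_def)
    fix u v assume "adj G u v"
    then have "f ` {u, v} \<in> edges G'" by (intro fE) (simp add: adj_def)
    then show "{f u, f v} \<in> edges H" using H(3) by auto
  qed
  then show ?thesis using H(1) by blast
qed

theorem theorem1p11:
  fixes G :: "'a sgraph" and C :: "'a list" and n c :: nat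
  assumes "simple_graph G"
    and "card (verts G) = n"
    and "k_connected 2 G"
    and "longest_cycle G C"
    and "length C = c"
    and "10 \<le> c" and "c \<le> n - 1"
    and "card {e \<in> edges G. card (e \<inter> set C) \<le> 1} > (c div 2 - 1) * (n - c)"
  shows "iso_to_subgraph G (W_graph n (c div 2) c) \<or>
         odd c \<and> (\<exists>H :: nat sgraph. H \<in> X_family n c \<union> Y_family n c \<and> iso_to_subgraph G H)"
proof -
  interpret longest_cycle_graph G C
    using assms(1,3,4) by unfold_locales
  define k where "k = c div 2"
  have k: "k = length C div 2" "k \<ge> 5" using assms(5,6) by (auto simp: k_def)
  have "card (verts G - set C) = n - c"
    using C_facts(1,2) assms(2,5) by (simp add: card_Diff_subset distinct_card)
  then have "wt (verts G - set C) > 2 * (k - 1) * card (verts G - set C)"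
    using edges_le_wt assms(8) by (simp add: k_def)
  then obtain v where v: "v \<in> verts G" "v \<notin> set C" "{b. adj G v b} \<subseteq> set C" "card {b. adj G v b} = k"
    using exists_full_vertex[OF k] by blast
  have k2: "k \<ge> 2" using k by simp
  obtain S X where SX: "longest_cycle G (S @ X)" "set (S @ X) = set C" "length (S @ X) = length C"
    "length S = 2 * k - 1" "{b. adj G v b} = (\<lambda>i. S ! (2 * i)) ` {..<k}"
    using exists_alternating_rotation[OF k(1) k2 v] by blast
  have lX: "length X = (if even c then 1 else 2)" using SX(3,4) assms(5) k_def k(2) by (auto elim!: evenE oddE)
  interpret alt: alternating_cycle G "2 * k - 2" S X v
  proof unfold_locales
    show "length S = Suc (2 * k - 2)" using SX(4) k by simp
    show "X \<noteq> []" "length X \<le> 2" using lX by (auto split: if_splits)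
    show "v \<notin> set (S @ X)" using v SX(2) by blast
    have "{S ! i | i. i \<le> 2 * k - 2 \<and> even i} = (\<lambda>i. S ! (2 * i)) ` {..<k}"
    proof
      show "{S ! i | i. i \<le> 2 * k - 2 \<and> even i} \<subseteq> (\<lambda>i. S ! (2 * i)) ` {..<k}"
        using k2 by (auto elim!: evenE)
      show "(\<lambda>i. S ! (2 * i)) ` {..<k} \<subseteq> {S ! i | i. i \<le> 2 * k - 2 \<and> even i}"
      proof
        fix b assume "b \<in> (\<lambda>i. S ! (2 * i)) ` {..<k}"
        then obtain i where "b = S ! (2 * i)" "i < k" by blast
        then show "b \<in> {S ! i | i. i \<le> 2 * k - 2 \<and> even i}" by (intro CollectI exI[of _ "2 * i"]) auto
      qed
    qed
    then show "{b. adj G v b} = {S ! i | i. i \<le> 2 * k - 2 \<and> even i}" using SX(5) by simp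
  qed (use SX v k in auto)
  have "alt.A = {b. adj G v b}" using alt.adj_v by blast
  then have A: "alt.A \<subseteq> verts G" "card alt.A = k" "card alt.A = c div 2" using v alt.S_AB(6) k_def by auto
  show ?thesis
  proof (cases "even c")
    case True
    have "False" if "outer G alt.A u u'" for u u'
      using alt.even_outcome[of u u'] lX True that by (auto simp: outer_def)
    moreover have "k + card ({} :: 'a set) \<le> c - k + 1" using k_def by simp
    ultimately have "iso_to_subgraph G (W_graph n k c)"
      using embed_W[OF assms(1,2) A(1,2), of "{}" c] by blast
    then show ?thesis by (simp add: k_def)
  next
    case False
    then obtain x y where xy: "X = [x, y]" using lX by (auto simp: length_Suc_conv numeral_2_eq_2)
    interpret od: odd_alternating_cycle G "2 * k - 2" S X v x y
      by unfold_locales (rule xy)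
    have xyV: "{x, y} \<subseteq> verts G - alt.A" "x \<noteq> y" using od.xy(1) alt.outer_AB[OF od.xy(1)] by auto
    \<comment> \<open>For odd \<open>c\<close> the clique of \<open>W_graph\<close> has
      \<open>c - k + 1 = k + 2\<close> vertices.\<close>
    have c2: "k + card {x, y} \<le> c - k + 1" using False xyV(2) k_def by (auto elim!: oddE)
    consider "\<forall>u u'. outer G alt.A u u' \<longrightarrow> {u, u'} = {x, y}" | "star_structure G alt.A"
      | "star_forest_structure G alt.A (S ! 0) (S ! (2 * k - 2))" using od.odd_outcome by blast
    then show ?thesis
    proof cases
      case 1
      then have "u \<in> {x, y} \<and> u' \<in> {x, y}" if "outer G alt.A u u'" for u u' using that by blast
      then have "iso_to_subgraph G (W_graph n k c)"
        using embed_W[OF assms(1,2) A(1,2) xyV(1) c2] by blast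
      then show ?thesis by (simp add: k_def)
    next
      case 2
      then show ?thesis using embed_X[OF assms(1,2) A(1,3)] False by blast
    next
      case 3
      then show ?thesis using embed_Y[OF assms(1,2) A(1,3)] False by blast
    qed
  qed
qed

end
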